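(* The set of primitive ideals of $\mathcal A_\infty$ is countable and consists of the following ideals: (1) $\{0\}$; (2) $\ker(\xi_j\circ\rho_0)$, $j=1,2,3$; (3) $\ker(\eta_{m-1,j}\circ\rho_m)$, $j=1,2,3$, $m\ge1$.
   Context: Indices $j\in\{1,2,3\}$ are taken mod $3$. $M_3(\mathbb C)$ has matrix units $e_{ij}$. $\mathrm{UHF}(3^\infty)$ is the $C^*$-inductive limit of $M_3(\mathbb C)^{\otimes n}$ under $x\mapsto x\otimes I_3$; each $M_3(\mathbb C)^{\otimes n}$ is regarded as a unital subalgebra of it. For $n\ge0$ put $\alpha^n_j=e_{jj}\otimes e_{22}^{\otimes n}\in M_3(\mathbb C)^{\otimes(n+1)}$, and for $k\ge1$ put $\beta^k_j=(e_{jj}\otimes e_{11}+e_{j+2,j+2}\otimes e_{33})\otimes e_{22}^{\otimes(k-1)}\in M_3(\mathbb C)^{\otimes(k+1)}$. The finite-dimensional $*$-algebra $\mathcal A_n\subset M_3(\mathbb C)^{\otimes(n+1)}$ is the linear span of the $\alpha^n_j$ and of the $x\otimes\beta^k_j$ with $j=1,2,3$, $k=1,\dots,n$, $x\in M_3(\mathbb C)^{\otimes(n-k)}$. $\mathcal A_\infty$ is the $C^*$-subalgebra of $\mathrm{UHF}(3^\infty)$ of all norm limits $\lim_n a_n$ with $a_n\in\mathcal A_n$. The slice map $\rho_m:\mathrm{UHF}(3^\infty)\to M_3(\mathbb C)^{\otimes(m+1)}$, identity on the first $m+1$ tensor factors and applying the state $x\mapsto x_{22}$ to each of the others, restricts to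 a $*$-homomorphism $\rho_m:\mathcal A_\infty\to\mathcal A_m$. Every $b\in\mathcal A_n$ can be written uniquely as $b=\sum_{j=1}^3\xi_j(b)\alpha^n_j+\sum_{k=0}^{n-1}\sum_{j=1}^3\eta_{k,j}(b)\otimes\beta^{n-k}_j$ with $\xi_j(b)\in\mathbb C$, $\eta_{k,j}(b)\in M_3(\mathbb C)^{\otimes k}$; this defines the characters $\xi_j$ of $\mathcal A_n$ and the $*$-homomorphisms $\eta_{k,j}:\mathcal A_n\to M_3(\mathbb C)^{\otimes k}$ (with $M_3(\mathbb C)^{\otimes0}=\mathbb C$). A primitive ideal is the kernel of an irreducible representation. *)

theory Defs
  imports "HOL-Analysis.Analysis" "Jordan_Normal_Form.VS_Connect"
    "Jordan_Normal_Form.Schur_Decomposition"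
begin

section \<open>Tensor powers of the 3 by 3 matrices\<close>

text \<open>The \<open>n\<close>-fold tensor power of \<open>M\<^sub>3(\<complex>)\<close> is the algebra of complex matrices of size \<open>3 ^ n\<close>;
  rows and columns are numbered by words of length \<open>n\<close> over a three-letter alphabet, read as
  base 3 numerals with the first tensor factor as leading digit.\<close>

abbreviation M3 :: "nat \<Rightarrow> complex mat set" where
  "M3 n \<equiv> carrier_mat (3 ^ n) (3 ^ n)"

abbreviation M3_space :: "nat \<Rightarrow> (complex, complex mat) module" where
  "M3_space n \<equiv> module_mat TYPE(complex) (3 ^ n) (3 ^ n)"

definition kron :: "complex mat \<Rightarrow> complex mat \<Rightarrow> complex mat" (infixr \<open>\<otimes>\<^sub>K\<close> 72) where
  "A \<otimes>\<^sub>K B = mat (dim_row A * dim_row B) (dim_col A * dim_col B)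
     (\<lambda>(r, c). A $$ (r div dim_row B, c div dim_col B) * B $$ (r mod dim_row B, c mod dim_col B))"

text \<open>For \<open>n = 0\<close> the power is the unit of the one by one matrices.\<close>

primrec kron_pow :: "complex mat \<Rightarrow> nat \<Rightarrow> complex mat" where
  "kron_pow A 0 = 1\<^sub>m 1"
| "kron_pow A (Suc n) = A \<otimes>\<^sub>K kron_pow A n"

text \<open>The matrix units \<open>e\<^sub>i\<^sub>j\<close>, with \<open>i, j\<close> read modulo 3 (so that \<open>1, 2, 3\<close> stand for the rows
  \<open>0, 1, 2\<close>).\<close>

definition e :: "nat \<Rightarrow> nat \<Rightarrow> complex mat" where
  "e i j = mat 3 3 (\<lambda>(r, c). if (r + 1) mod 3 = i mod 3 \<and> (c + 1) mod 3 = j mod 3 then 1 else 0)"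

definition \<alpha> :: "nat \<Rightarrow> nat \<Rightarrow> complex mat" where
  "\<alpha> n j = e j j \<otimes>\<^sub>K kron_pow (e 2 2) n"

definition \<beta> :: "nat \<Rightarrow> nat \<Rightarrow> complex mat" where
  "\<beta> k j = (e j j \<otimes>\<^sub>K e 1 1 + e (j + 2) (j + 2) \<otimes>\<^sub>K e 3 3) \<otimes>\<^sub>K kron_pow (e 2 2) (k - 1)"

definition \<A> :: "nat \<Rightarrow> complex mat set" where
  "\<A> n = LinearCombinations.module.span class_ring (M3_space (n + 1))
     ({\<alpha> n j | j. j \<in> {1, 2, 3}} \<union>
      {x \<otimes>\<^sub>K \<beta> k j | x k j. j \<in> {1, 2, 3} \<and> k \<in> {1..n} \<and> x \<in> M3 (n - k)})"

definition decomposes :: "nat \<Rightarrow> complex mat \<Rightarrow> (nat \<Rightarrow> complex) \<Rightarrow> (nat \<Rightarrow> nat \<Rightarrow> complex mat) \<Rightarrow> bool" where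
  "decomposes n b x y \<longleftrightarrow>
     (\<forall>k<n. \<forall>j\<in>{1, 2, 3}. y k j \<in> M3 k) \<and>
     b = (\<Oplus>\<^bsub>M3_space (n + 1)\<^esub> j\<in>{1, 2, 3}. x j \<cdot>\<^sub>m \<alpha> n j) +
         (\<Oplus>\<^bsub>M3_space (n + 1)\<^esub> k\<in>{..<n}. \<Oplus>\<^bsub>M3_space (n + 1)\<^esub> j\<in>{1, 2, 3}. y k j \<otimes>\<^sub>K \<beta> (n - k) j)"

text \<open>The coefficients of the (unique) decomposition of an element \<open>b\<close> of \<open>\<A> n\<close>; they are only
  meaningful for \<open>j \<in> {1, 2, 3}\<close> and \<open>k < n\<close>.\<close>

definition \<xi> :: "nat \<Rightarrow> nat \<Rightarrow> complex mat \<Rightarrow> complex" where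
  "\<xi> n j b = (THE c. \<exists>x y. decomposes n b x y \<and> c = x j)"

definition \<eta> :: "nat \<Rightarrow> nat \<Rightarrow> nat \<Rightarrow> complex mat \<Rightarrow> complex mat" where
  "\<eta> n k j b = (THE c. \<exists>x y. decomposes n b x y \<and> c = y k j)"


section \<open>The UHF algebra\<close>

text \<open>Nonzero unital complex C*-algebras; \<open>norm 1 = 1\<close> is part of \<open>real_normed_algebra_1\<close>.\<close>

class unital_cstar_algebra = real_normed_algebra_1 + banach +
  fixes scaleC :: "complex \<Rightarrow> 'a \<Rightarrow> 'a" (infixr \<open>*\<^sub>C\<close> 75)
    and star :: "'a \<Rightarrow> 'a"
  assumes scaleC_add_right: "c *\<^sub>C (x + y) = c *\<^sub>C x + c *\<^sub>C y"
    and scaleC_add_left: "(c + d) *\<^sub>C x = c *\<^sub>C x + d *\<^sub>C x"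
    and scaleC_scaleC: "c *\<^sub>C d *\<^sub>C x = (c * d) *\<^sub>C x"
    and scaleC_of_real: "complex_of_real r *\<^sub>C x = r *\<^sub>R x"
    and mult_scaleC_left: "(c *\<^sub>C x) * y = c *\<^sub>C (x * y)"
    and mult_scaleC_right: "x * (c *\<^sub>C y) = c *\<^sub>C (x * y)"
    and norm_scaleC: "norm (c *\<^sub>C x) = cmod c * norm x"
    and star_add: "star (x + y) = star x + star y"
    and star_scaleC: "star (c *\<^sub>C x) = cnj c *\<^sub>C star x"
    and star_mult: "star (x * y) = star y * star x"
    and star_star: "star (star x) = x"
    and cstar_identity: "norm (star x * x) = (norm x)\<^sup>2"

text \<open>The C*-inductive limit of the system \<open>x \<mapsto> x \<otimes> I\<^sub>3\<close>, determined up to isomorphism: a unital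
  C*-algebra \<open>'u\<close> with compatible unital *-embeddings \<open>\<iota> n\<close> of the algebras of the system such that
  the union of their ranges is dense. An injective *-homomorphism from a finite-dimensional
  C*-algebra is automatically isometric.\<close>

locale uhf_three_infty =
  fixes \<iota> :: "nat \<Rightarrow> complex mat \<Rightarrow> 'u :: unital_cstar_algebra"
  assumes \<iota>_add: "x \<in> M3 n \<Longrightarrow> y \<in> M3 n \<Longrightarrow> \<iota> n (x + y) = \<iota> n x + \<iota> n y"
    and \<iota>_smult: "x \<in> M3 n \<Longrightarrow> \<iota> n (c \<cdot>\<^sub>m x) = c *\<^sub>C \<iota> n x"
    and \<iota>_mult: "x \<in> M3 n \<Longrightarrow> y \<in> M3 n \<Longrightarrow> \<iota> n (x * y) = \<iota> n x * \<iota> n y"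
    and \<iota>_adjoint: "x \<in> M3 n \<Longrightarrow> \<iota> n (mat_adjoint x) = star (\<iota> n x)"
    and \<iota>_one: "\<iota> n (1\<^sub>m (3 ^ n)) = 1"
    and \<iota>_inj: "inj_on (\<iota> n) (M3 n)"
    and \<iota>_compatible: "x \<in> M3 n \<Longrightarrow> \<iota> (n + 1) (x \<otimes>\<^sub>K 1\<^sub>m 3) = \<iota> n x"
    and \<iota>_dense: "closure (\<Union>n. \<iota> n ` M3 n) = UNIV"

definition \<A>_infty :: "(nat \<Rightarrow> complex mat \<Rightarrow> 'u :: unital_cstar_algebra) \<Rightarrow> 'u set" where
  "\<A>_infty \<iota> = {a. \<exists>b. (\<forall>n. b n \<in> \<A> n) \<and> (\<lambda>n. \<iota> (n + 1) (b n)) \<longlonglongrightarrow> a}"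

text \<open>\<open>is_slice_map \<iota> m R\<close>: the map \<open>R\<close> is linear, continuous, the identity on the first \<open>m + 1\<close>
  tensor factors, and evaluates the state \<open>y \<mapsto> y\<^sub>2\<^sub>2\<close> on every later factor. The position \<open>(2, 2)\<close> is
  \<open>(1, 1)\<close> in the zero-based numbering of matrix entries. Continuity is entrywise, as matrices
  carry no topology here; the target is finite-dimensional. By density, there is exactly one such map.\<close>

definition is_slice_map ::
    "(nat \<Rightarrow> complex mat \<Rightarrow> 'u :: unital_cstar_algebra) \<Rightarrow> nat \<Rightarrow> ('u \<Rightarrow> complex mat) \<Rightarrow> bool" where
  "is_slice_map \<iota> m R \<longleftrightarrow>
     range R \<subseteq> M3 (m + 1) \<and>
     (\<forall>a b. R (a + b) = R a + R b) \<and>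
     (\<forall>c a. R (c *\<^sub>C a) = c \<cdot>\<^sub>m R a) \<and>
     (\<forall>r<3 ^ (m + 1). \<forall>s<3 ^ (m + 1). continuous_on UNIV (\<lambda>a. R a $$ (r, s))) \<and>
     (\<forall>x\<in>M3 (m + 1). R (\<iota> (m + 1) x) = x) \<and>
     (\<forall>n\<ge>m + 1. \<forall>x\<in>M3 n. \<forall>y\<in>carrier_mat 3 3.
        R (\<iota> (n + 1) (x \<otimes>\<^sub>K y)) = y $$ (1, 1) \<cdot>\<^sub>m R (\<iota> n x))"

definition \<rho> :: "(nat \<Rightarrow> complex mat \<Rightarrow> 'u :: unital_cstar_algebra) \<Rightarrow> nat \<Rightarrow> 'u \<Rightarrow> complex mat" where
  "\<rho> \<iota> m = (THE R. is_slice_map \<iota> m R)"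

definition ker_\<xi>_\<rho> :: "(nat \<Rightarrow> complex mat \<Rightarrow> 'u :: unital_cstar_algebra) \<Rightarrow> nat \<Rightarrow> 'u set" where
  "ker_\<xi>_\<rho> \<iota> j = {a \<in> \<A>_infty \<iota>. \<xi> 0 j (\<rho> \<iota> 0 a) = 0}"

definition ker_\<eta>_\<rho> :: "(nat \<Rightarrow> complex mat \<Rightarrow> 'u :: unital_cstar_algebra) \<Rightarrow> nat \<Rightarrow> nat \<Rightarrow> 'u set" where
  "ker_\<eta>_\<rho> \<iota> m j =
     {a \<in> \<A>_infty \<iota>. \<eta> m (m - 1) j (\<rho> \<iota> m a) = 0\<^sub>m (3 ^ (m - 1)) (3 ^ (m - 1))}"


section \<open>Irreducible representations and primitive ideals\<close>

text \<open>Hilbert spaces have an explicit carrier, since a definition cannot quantify over types.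
  The inner product \<open>ip\<close> is linear in its first argument. Off the carrier the distance is set to 0, as
  \<open>Metric_space\<close> requires nonnegativity and symmetry there too.\<close>

definition ip_dist :: "(complex, 'h) module \<Rightarrow> ('h \<Rightarrow> 'h \<Rightarrow> complex) \<Rightarrow> 'h \<Rightarrow> 'h \<Rightarrow> real" where
  "ip_dist V ip x y =
     (if x \<in> carrier V \<and> y \<in> carrier V then sqrt (Re (ip (x \<ominus>\<^bsub>V\<^esub> y) (x \<ominus>\<^bsub>V\<^esub> y))) else 0)"

locale complex_hilbert_space =
  fixes V :: "(complex, 'h) module" (structure)
    and ip :: "'h \<Rightarrow> 'h \<Rightarrow> complex"
  assumes vectorspace: "vectorspace class_ring V"
    and ip_add: "\<lbrakk>x \<in> carrier V; y \<in> carrier V; z \<in> carrier V\<rbrakk> \<Longrightarrow> ip (x \<oplus> y) z = ip x z + ip y z"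
    and ip_smult: "\<lbrakk>x \<in> carrier V; y \<in> carrier V\<rbrakk> \<Longrightarrow> ip (c \<odot>\<^bsub>V\<^esub> x) y = c * ip x y"
    and ip_commute: "\<lbrakk>x \<in> carrier V; y \<in> carrier V\<rbrakk> \<Longrightarrow> ip x y = cnj (ip y x)"
    and ip_nonneg: "x \<in> carrier V \<Longrightarrow> 0 \<le> Re (ip x x)"
    and ip_definite: "x \<in> carrier V \<Longrightarrow> ip x x = 0 \<Longrightarrow> x = \<zero>"
    and complete: "Metric_space.mcomplete (carrier V) (ip_dist V ip)"

definition bounded_operator :: "(complex, 'h) module \<Rightarrow> ('h \<Rightarrow> 'h \<Rightarrow> complex) \<Rightarrow> ('h \<Rightarrow> 'h) \<Rightarrow> bool" where
  "bounded_operator V ip T \<longleftrightarrow>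
     T \<in> carrier V \<rightarrow> carrier V \<and>
     (\<forall>x\<in>carrier V. \<forall>y\<in>carrier V. T (x \<oplus>\<^bsub>V\<^esub> y) = T x \<oplus>\<^bsub>V\<^esub> T y) \<and>
     (\<forall>c. \<forall>x\<in>carrier V. T (c \<odot>\<^bsub>V\<^esub> x) = c \<odot>\<^bsub>V\<^esub> T x) \<and>
     (\<exists>K. \<forall>x\<in>carrier V. sqrt (Re (ip (T x) (T x))) \<le> K * sqrt (Re (ip x x)))"

text \<open>*-representations of a *-subalgebra \<open>A\<close> of \<open>'u\<close> on the Hilbert space \<open>(V, ip)\<close>.\<close>

definition star_representation ::
    "'u :: unital_cstar_algebra set \<Rightarrow> (complex, 'h) module \<Rightarrow> ('h \<Rightarrow> 'h \<Rightarrow> complex)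
      \<Rightarrow> ('u \<Rightarrow> 'h \<Rightarrow> 'h) \<Rightarrow> bool" where
  "star_representation A V ip \<pi> \<longleftrightarrow>
     complex_hilbert_space V ip \<and>
     (\<forall>a\<in>A. bounded_operator V ip (\<pi> a)) \<and>
     (\<forall>a\<in>A. \<forall>b\<in>A. \<forall>x\<in>carrier V. \<pi> (a + b) x = \<pi> a x \<oplus>\<^bsub>V\<^esub> \<pi> b x) \<and>
     (\<forall>c. \<forall>a\<in>A. \<forall>x\<in>carrier V. \<pi> (c *\<^sub>C a) x = c \<odot>\<^bsub>V\<^esub> \<pi> a x) \<and>
     (\<forall>a\<in>A. \<forall>b\<in>A. \<forall>x\<in>carrier V. \<pi> (a * b) x = \<pi> a (\<pi> b x)) \<and>
     (\<forall>a\<in>A. \<forall>x\<in>carrier V. \<forall>y\<in>carrier V. ip (\<pi> a x) y = ip x (\<pi> (star a) y))"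

definition rep_kernel ::
    "'u set \<Rightarrow> (complex, 'h) module \<Rightarrow> ('u \<Rightarrow> 'h \<Rightarrow> 'h) \<Rightarrow> 'u set" where
  "rep_kernel A V \<pi> = {a \<in> A. \<forall>x\<in>carrier V. \<pi> a x = \<zero>\<^bsub>V\<^esub>}"

text \<open>Irreducible: nonzero, and without closed invariant subspaces other than the two trivial ones.\<close>

definition irreducible_representation ::
    "'u :: unital_cstar_algebra set \<Rightarrow> (complex, 'h) module \<Rightarrow> ('h \<Rightarrow> 'h \<Rightarrow> complex)
      \<Rightarrow> ('u \<Rightarrow> 'h \<Rightarrow> 'h) \<Rightarrow> bool" where
  "irreducible_representation A V ip \<pi> \<longleftrightarrow>
     star_representation A V ip \<pi> \<and>
     rep_kernel A V \<pi> \<noteq> A \<and>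
     (\<forall>W. VectorSpace.subspace class_ring W V \<and>
          closedin (Metric_space.mtopology (carrier V) (ip_dist V ip)) W \<and>
          (\<forall>a\<in>A. \<pi> a ` W \<subseteq> W)
        \<longrightarrow> W = {\<zero>\<^bsub>V\<^esub>} \<or> W = carrier V)"

text \<open>Kernels of the irreducible representations of \<open>A\<close> on Hilbert spaces whose points are elements
  of \<open>'h\<close>. Nonzero complex Hilbert spaces need at least \<open>card \<complex>\<close> many points, and separable ones
  fit into any such type; so, for separable \<open>A\<close>, every \<open>'h\<close> of at least that cardinality yields all
  primitive ideals.\<close>

definition primitive_ideals :: "'h itself \<Rightarrow> 'u :: unital_cstar_algebra set \<Rightarrow> 'u set set" where
  "primitive_ideals _ A =
     {rep_kernel A V \<pi> | (V :: (complex, 'h) module) ip \<pi>. irreducible_representation A V ip \<pi>}"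

end

theory Submission
  imports Defs
begin

text \<open>Let \<open>J\<^sub>m\<close> be the kernel of \<open>\<rho>\<^sub>m\<close> on \<open>\<A>_infty\<close>. It is an ideal that is moreover stable under
  multiplication by the \<open>m\<close>-fold tensor power of \<open>M\<^sub>3(\<complex>)\<close>. If an irreducible representation \<open>\<pi>\<close> is nonzero on
  every \<open>J\<^sub>m\<close>, take \<open>a\<close> with \<open>\<pi>(a) = 0\<close> and \<open>b\<close> in the \<open>m\<close>-fold tensor power close to \<open>a\<close>: on the
  part \<open>\<pi>(J\<^sub>m)\<close>, multiplication by \<open>b\<close> is at the same time given by the matrix \<open>b\<close> and of norm at most \<open>\<parallel>b - a\<parallel>\<close>,
  so the entries of \<open>b\<close> are small and \<open>a = 0\<close>. Otherwise let \<open>m\<close> be least with \<open>\<pi>(J\<^sub>m) = 0\<close>. Then \<open>\<pi>\<close>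
  factors through \<open>\<A> m\<close> but does not vanish on the kernel of \<open>\<A> m \<rightarrow> \<A> (m - 1)\<close>, which is a sum of three full matrix
  algebras; by irreducibility \<open>\<pi>\<close> lives on one of them, and this determines its kernel.

  Conversely, let the UHF algebra act on the square summable functions of infinite words over
  \<open>{0, 1, 2}\<close> by changing the first letters. The words that end in \<open>0111\<dots>\<close> from a fixed position on, with the letter
  before also fixed, span an irreducible representation with kernel of type (2) or (3). The
  words that are eventually \<open>0\<close> span an irreducible representation that is nonzero on all \<open>J\<^sub>m\<close>.\<close>

section \<open>Square summable families\<close>

text \<open>The algebras \<open>\<A> n\<close> are not nested in the UHF algebra: passing from
  \<open>\<A> n\<close> to \<open>\<A> (n + 1)\<close> keeps the old element in the middle block and
  leaves three new coefficients free. It is therefore not clear that every element of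
  \<open>\<A> m\<close> is a slice of an element of \<open>\<A>_infty\<close>; this is achieved by
  taking averages as new coefficients, so that successive lifts differ by a geometric sequence. The
  stability of \<open>J m\<close> has a related origin: at level \<open>n\<close> the kernel of the
  slice map involves only coefficients with at least \<open>m\<close> tensor factors, and these may
  be multiplied freely by matrices on the first \<open>m\<close> factors. A matrix \<open>b\<close>
  lies outside \<open>\<A>_infty\<close> in general, so \<open>\<pi>\<close> is applied only to
  products \<open>b * j\<close> with \<open>j\<close> in \<open>J m\<close>, and the norm bound
  comes from a positivity argument for multipliers of \<open>J m\<close>. One action on words serves
  several ends: letter 1 is the vector of the slice state, so \<open>\<rho>\<close> is a compression
  of the action, and the same action gives the norms of block matrices and both kinds of irreducible
  representations.\<close>

typedef 'i ell2 = "{v :: 'i \<Rightarrow> complex. (\<lambda>i. (cmod (v i))\<^sup>2) summable_on UNIV}"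
  morphisms ell2_fun Abs_ell2
  by (rule exI[of _ "\<lambda>_. 0"]) simp

setup_lifting type_definition_ell2

lemma ell2_summable: "(\<lambda>i. (cmod (ell2_fun v i))\<^sup>2) summable_on UNIV"
  using ell2_fun by blast

lemma cmod_add_power2_le: "(cmod (a + b))\<^sup>2 \<le> 2 * (cmod a)\<^sup>2 + 2 * (cmod b)\<^sup>2"
proof -
  have "(cmod (a + b))\<^sup>2 \<le> (cmod a + cmod b)\<^sup>2"
    by (intro power_mono norm_triangle_ineq) auto
  also have "\<dots> \<le> 2 * (cmod a)\<^sup>2 + 2 * (cmod b)\<^sup>2"
    using sum_squares_bound[of "cmod a" "cmod b"] by (simp add: power2_sum)
  finally show ?thesis .
qed

lemma square_summable_add:
  assumes "(\<lambda>i. (cmod (v i))\<^sup>2) summable_on A" "(\<lambda>i. (cmod (w i))\<^sup>2) summable_on A"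
  shows "(\<lambda>i. (cmod (v i + w i))\<^sup>2) summable_on A"
proof (rule summable_on_comparison_test)
  show "(\<lambda>i. 2 * (cmod (v i))\<^sup>2 + 2 * (cmod (w i))\<^sup>2) summable_on A"
    by (intro summable_on_add summable_on_cmult_right assms)
qed (auto intro: cmod_add_power2_le)

lemma square_summable_scale:
  assumes "(\<lambda>i. (cmod (v i))\<^sup>2) summable_on A"
  shows "(\<lambda>i. (cmod (c * v i))\<^sup>2) summable_on A"
  unfolding norm_mult power_mult_distrib by (intro summable_on_cmult_right assms)

lemma square_summable_product:
  assumes "(\<lambda>i. (cmod (v i))\<^sup>2) summable_on A" "(\<lambda>i. (cmod (w i))\<^sup>2) summable_on A"
  shows "(\<lambda>i. v i * cnj (w i)) summable_on A"
proof -
  have "(\<lambda>i. norm (v i * cnj (w i))) summable_on A"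
  proof (rule summable_on_comparison_test)
    show "(\<lambda>i. (cmod (v i))\<^sup>2 + (cmod (w i))\<^sup>2) summable_on A"
      by (intro summable_on_add assms)
    fix i
    have "0 \<le> (cmod (v i))\<^sup>2 + (cmod (w i))\<^sup>2" "2 * (cmod (v i) * cmod (w i)) \<le> (cmod (v i))\<^sup>2 + (cmod (w i))\<^sup>2"
      using sum_squares_bound[of "cmod (v i)" "cmod (w i)"] by (auto simp: mult.assoc)
    moreover have "0 \<le> cmod (v i) * cmod (w i)" by simp
    ultimately show "norm (v i * cnj (w i)) \<le> (cmod (v i))\<^sup>2 + (cmod (w i))\<^sup>2"
      unfolding norm_mult complex_mod_cnj by linarith
  qed auto
  then show ?thesis by (rule abs_summable_summable)
qed

instantiation ell2 :: (type) real_vector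
begin
lift_definition zero_ell2 :: "'a ell2" is "\<lambda>_. 0" by simp
lift_definition plus_ell2 :: "'a ell2 \<Rightarrow> 'a ell2 \<Rightarrow> 'a ell2" is "\<lambda>v w i. v i + w i"
  by (rule square_summable_add)
lift_definition uminus_ell2 :: "'a ell2 \<Rightarrow> 'a ell2" is "\<lambda>v i. - v i" by simp
lift_definition minus_ell2 :: "'a ell2 \<Rightarrow> 'a ell2 \<Rightarrow> 'a ell2" is "\<lambda>v w i. v i - w i"
  using square_summable_add[where w = "\<lambda>i. - _ i"] by fastforce
lift_definition scaleR_ell2 :: "real \<Rightarrow> 'a ell2 \<Rightarrow> 'a ell2" is "\<lambda>r v i. of_real r * v i"
  by (rule square_summable_scale)
instance by (standard; transfer; auto simp: algebra_simps)
end

lift_definition cscale :: "complex \<Rightarrow> 'i ell2 \<Rightarrow> 'i ell2" is "\<lambda>c v i. c * v i"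
  by (rule square_summable_scale)

definition cip :: "'i ell2 \<Rightarrow> 'i ell2 \<Rightarrow> complex" where
  "cip v w = (\<Sum>\<^sub>\<infinity>i. ell2_fun v i * cnj (ell2_fun w i))"

lemma ell2_fun_simps [simp]:
  "ell2_fun 0 i = 0"
  "ell2_fun (v + w) i = ell2_fun v i + ell2_fun w i"
  "ell2_fun (v - w) i = ell2_fun v i - ell2_fun w i"
  "ell2_fun (- v) i = - ell2_fun v i"
  "ell2_fun (r *\<^sub>R v) i = of_real r * ell2_fun v i"
  "ell2_fun (cscale c v) i = c * ell2_fun v i"
  by (transfer; simp)+

lemma ell2_eqI: "(\<And>i. ell2_fun v i = ell2_fun w i) \<Longrightarrow> v = w"
  by transfer auto

lemma cip_summable: "(\<lambda>i. ell2_fun v i * cnj (ell2_fun w i)) summable_on UNIV"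
  by (intro square_summable_product ell2_summable)

lemma cip_add_left: "cip (u + v) w = cip u w + cip v w"
  unfolding cip_def by (simp add: ring_distribs infsum_add cip_summable)

lemma cip_scale_left: "cip (cscale c v) w = c * cip v w"
  unfolding cip_def by (simp add: mult.assoc infsum_cmult_right cip_summable)

lemma cip_commute: "cip v w = cnj (cip w v)"
  unfolding cip_def by (subst infsum_cnj[symmetric]) (simp add: mult.commute)

lemma cip_self: "cip v v = of_real (\<Sum>\<^sub>\<infinity>i. (cmod (ell2_fun v i))\<^sup>2)"
  unfolding cip_def complex_norm_square[symmetric]
  by (intro infsumI has_sum_of_real has_sum_infsum ell2_summable)

lemma cip_scale_right: "cip v (cscale c w) = cnj c * cip v w"
  by (metis cip_commute cip_scale_left complex_cnj_mult)

lemma cip_add_right: "cip w (u + v) = cip w u + cip w v"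
  by (metis cip_commute cip_add_left complex_cnj_add)

lemma scaleR_eq_cscale: "r *\<^sub>R v = cscale (of_real r) v"
  by (rule ell2_eqI) simp

instantiation ell2 :: (type) real_inner
begin
definition inner_ell2 :: "'a ell2 \<Rightarrow> 'a ell2 \<Rightarrow> real" where "inner_ell2 v w = Re (cip v w)"
definition norm_ell2 :: "'a ell2 \<Rightarrow> real" where "norm_ell2 v = sqrt (inner v v)"
definition dist_ell2 :: "'a ell2 \<Rightarrow> 'a ell2 \<Rightarrow> real" where "dist_ell2 v w = norm (v - w)"
definition sgn_ell2 :: "'a ell2 \<Rightarrow> 'a ell2" where "sgn_ell2 v = v /\<^sub>R norm v"
definition uniformity_ell2 :: "('a ell2 \<times> 'a ell2) filter"
  where "uniformity_ell2 = (INF r\<in>{0 <..}. principal {(v, w). dist v w < r})"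
definition open_ell2 :: "'a ell2 set \<Rightarrow> bool"
  where "open_ell2 U = (\<forall>v\<in>U. eventually (\<lambda>(v', w). v' = v \<longrightarrow> w \<in> U) uniformity)"
instance
proof
  fix u v w :: "'a ell2" and r :: real
  show "inner v w = inner w v"
    unfolding inner_ell2_def by (subst cip_commute) simp
  show "inner (u + v) w = inner u w + inner v w"
    by (simp add: inner_ell2_def cip_add_left)
  show "inner (r *\<^sub>R v) w = r * inner v w"
    by (simp add: inner_ell2_def scaleR_eq_cscale cip_scale_left)
  show "0 \<le> inner v v"
    by (simp add: inner_ell2_def cip_self infsum_nonneg)
  show "inner v v = 0 \<longleftrightarrow> v = 0"
  proof
    assume "inner v v = 0"
    then have "(\<Sum>\<^sub>\<infinity>i. (cmod (ell2_fun v i))\<^sup>2) = 0"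
      by (simp add: inner_ell2_def cip_self)
    then have "(cmod (ell2_fun v i))\<^sup>2 = 0" for i
      using nonneg_infsum_le_0D[of "\<lambda>i. (cmod (ell2_fun v i))\<^sup>2" UNIV i] ell2_summable[of v] by auto
    then show "v = 0" by (intro ell2_eqI) simp
  qed (simp add: inner_ell2_def cip_def)
qed (simp_all add: norm_ell2_def dist_ell2_def sgn_ell2_def uniformity_ell2_def open_ell2_def)
end

lemma ell2_norm_power2: "(norm v)\<^sup>2 = (\<Sum>\<^sub>\<infinity>i. (cmod (ell2_fun v i))\<^sup>2)"
  by (simp only: power2_norm_eq_inner[of v] inner_ell2_def cip_self Re_complex_of_real)

lemma cip_self_norm: "cip v v = of_real ((norm v)\<^sup>2)"
  by (simp add: cip_self ell2_norm_power2)

lemma ell2_norm_sum_le: "finite F \<Longrightarrow> (\<Sum>i\<in>F. (cmod (ell2_fun v i))\<^sup>2) \<le> (norm v)\<^sup>2"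
  unfolding ell2_norm_power2 by (rule finite_sum_le_infsum) (auto simp: ell2_summable)

lemma ell2_coord_le: "cmod (ell2_fun v i) \<le> norm v"
  using ell2_norm_sum_le[of "{i}" v] by (simp add: power2_le_iff_abs_le)

lemma ell2_fun_tendsto:
  assumes "u \<longlonglongrightarrow> v"
  shows "(\<lambda>k. ell2_fun (u k) i) \<longlonglongrightarrow> ell2_fun v i"
proof (rule metric_tendsto_imp_tendsto[OF assms])
  show "\<forall>\<^sub>F k in sequentially. dist (ell2_fun (u k) i) (ell2_fun v i) \<le> dist (u k) v"
    using ell2_coord_le[of "_ - v" i] by (simp add: dist_norm)
qed

lemma ell2_norm_cscale: "norm (cscale c v) = cmod c * norm v"
proof -
  have "(norm (cscale c v))\<^sup>2 = (cmod c * norm v)\<^sup>2"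
    unfolding power_mult_distrib ell2_norm_power2
    by (simp add: norm_mult power_mult_distrib infsum_cmult_right ell2_summable)
  then show ?thesis by (simp add: power2_eq_iff_nonneg)
qed

text \<open>Vectors are constructed through this lemma from a bound on finite partial sums: square
  summability and the norm bound come out together.\<close>

lemma ell2_bounded_sums:
  assumes "\<And>F. finite F \<Longrightarrow> (\<Sum>i\<in>F. (cmod (f i))\<^sup>2) \<le> B\<^sup>2" and "B \<ge> 0"
  obtains v where "\<And>i. ell2_fun v i = f i" "norm v \<le> B"
proof -
  have s: "(\<lambda>i. (cmod (f i))\<^sup>2) summable_on UNIV"
    by (rule nonneg_bdd_above_summable_on) (auto intro!: bdd_aboveI2[where M = "B\<^sup>2"] assms)
  define v where "v = Abs_ell2 f"
  have v: "ell2_fun v = f"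
    using s by (simp add: v_def Abs_ell2_inverse)
  have "(norm v)\<^sup>2 \<le> B\<^sup>2"
    unfolding ell2_norm_power2 v by (rule infsum_le_finite_sums[OF s]) (auto intro: assms)
  then have "norm v \<le> B" using assms(2) by (simp add: power2_le_iff_abs_le)
  then show ?thesis using v by (intro that) auto
qed

lemma cip_bound: "cmod (cip v w) \<le> norm v * norm w"
proof -
  \<comment> \<open>The phase of \<open>cip v w\<close> is rotated away, which reduces the complex
    inequality to the real Cauchy-Schwarz inequality for \<open>inner\<close>.\<close>
  define c where "c = (if cip v w = 0 then 1 else cnj (cip v w) / cmod (cip v w))"
  have c: "cmod c = 1" by (auto simp: c_def norm_divide)
  have "complex_of_real (cmod (cip v w)) = c * cip v w"
    using complex_norm_square[of "cip v w"] by (auto simp: c_def mult.commute power2_eq_square nonzero_eq_divide_eq)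
  also have "\<dots> = cip (cscale c v) w" by (simp add: cip_scale_left)
  finally have "cmod (cip v w) = inner (cscale c v) w"
    unfolding inner_ell2_def by (metis Re_complex_of_real)
  also have "\<dots> \<le> norm (cscale c v) * norm w" by (rule norm_cauchy_schwarz)
  finally show ?thesis by (simp add: ell2_norm_cscale c)
qed

instance ell2 :: (type) complete_space
proof
  fix X :: "nat \<Rightarrow> 'a ell2"
  assume X: "Cauchy X"
  have "Cauchy (\<lambda>n. ell2_fun (X n) i)" for i
  proof (rule metric_CauchyI)
    fix r :: real assume "0 < r"
    then obtain N where N: "\<And>m n. m \<ge> N \<Longrightarrow> n \<ge> N \<Longrightarrow> dist (X m) (X n) < r"
      using metric_CauchyD[OF X] by blast
    show "\<exists>N. \<forall>m\<ge>N. \<forall>n\<ge>N. dist (ell2_fun (X m) i) (ell2_fun (X n) i) < r"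
    proof (intro exI allI impI)
      fix m n assume "N \<le> m" "N \<le> n"
      then show "dist (ell2_fun (X m) i) (ell2_fun (X n) i) < r"
        using N[of m n] ell2_coord_le[of "X m - X n" i] by (simp add: dist_norm)
    qed
  qed
  then have "\<exists>l. (\<lambda>n. ell2_fun (X n) i) \<longlonglongrightarrow> l" for i
    using Cauchy_convergent convergent_def by blast
  then obtain f where f: "\<And>i. (\<lambda>n. ell2_fun (X n) i) \<longlonglongrightarrow> f i" by metis
  \<comment> \<open>The coordinatewise limit \<open>f\<close> is not yet known to be square
    summable. Its difference from \<open>X n\<close> is, because the bound on each finite partial
    sum of \<open>X m - X n\<close> survives the limit in \<open>m\<close>.\<close>
  have tail: "\<exists>v. (\<forall>i. ell2_fun v i = f i - ell2_fun (X n) i) \<and> norm v \<le> r"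
    if r: "r > 0" and n: "\<And>m. m \<ge> n \<Longrightarrow> dist (X m) (X n) < r" for n r
  proof -
    have "(\<Sum>i\<in>F. (cmod (f i - ell2_fun (X n) i))\<^sup>2) \<le> r\<^sup>2" if F: "finite F" for F
    proof (rule LIMSEQ_le_const2)
      show "(\<lambda>m. \<Sum>i\<in>F. (cmod (ell2_fun (X m) i - ell2_fun (X n) i))\<^sup>2)
          \<longlonglongrightarrow> (\<Sum>i\<in>F. (cmod (f i - ell2_fun (X n) i))\<^sup>2)"
        by (intro tendsto_sum tendsto_power tendsto_norm tendsto_diff f tendsto_const)
      show "\<exists>N. \<forall>m\<ge>N. (\<Sum>i\<in>F. (cmod (ell2_fun (X m) i - ell2_fun (X n) i))\<^sup>2) \<le> r\<^sup>2"
      proof (intro exI allI impI)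
        fix m assume "n \<le> m"
        then have "norm (X m - X n) \<le> r" using n[of m] by (simp add: dist_norm)
        then have "(norm (X m - X n))\<^sup>2 \<le> r\<^sup>2" by (rule power_mono) simp
        then show "(\<Sum>i\<in>F. (cmod (ell2_fun (X m) i - ell2_fun (X n) i))\<^sup>2) \<le> r\<^sup>2"
          using ell2_norm_sum_le[OF F, of "X m - X n"] by simp
      qed
    qed
    with r ell2_bounded_sums[of "\<lambda>i. f i - ell2_fun (X n) i" r] show ?thesis by (metis less_imp_le)
  qed
  obtain N where N: "\<And>m n. m \<ge> N \<Longrightarrow> n \<ge> N \<Longrightarrow> dist (X m) (X n) < 1"
    using metric_CauchyD[OF X, of 1] by auto
  obtain v where v: "\<And>i. ell2_fun v i = f i - ell2_fun (X N) i"
    using tail[of 1 N] N by force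
  have "X \<longlonglongrightarrow> v + X N"
  proof (rule metric_LIMSEQ_I)
    fix r :: real assume "r > 0"
    then obtain M where M: "\<And>m n. m \<ge> M \<Longrightarrow> n \<ge> M \<Longrightarrow> dist (X m) (X n) < r / 2"
      using metric_CauchyD[OF X, of "r / 2"] by auto
    have "dist (X n) (v + X N) < r" if n: "n \<ge> M" for n
    proof -
      obtain w where w: "\<And>i. ell2_fun w i = f i - ell2_fun (X n) i" "norm w \<le> r / 2"
        using tail[of "r / 2" n] M n \<open>r > 0\<close> by force
      have "v + X N - X n = w" by (rule ell2_eqI) (simp add: v w)
      then have "dist (X n) (v + X N) = norm w" by (metis dist_commute dist_norm)
      then show ?thesis using w \<open>r > 0\<close> by simp
    qed
    then show "\<exists>M. \<forall>n\<ge>M. dist (X n) (v + X N) < r" by blast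
  qed
  then show "convergent X" unfolding convergent_def by blast
qed

lift_definition basis_vec :: "'i \<Rightarrow> 'i ell2" is "\<lambda>i j. if j = i then 1 else 0"
proof -
  fix i :: 'i
  have "(\<lambda>j. (cmod (if j = i then 1 else 0))\<^sup>2) summable_on {i}" by simp
  then show "(\<lambda>j. (cmod (if j = i then 1 else 0))\<^sup>2) summable_on UNIV"
    by (rule summable_on_cong_neutral[THEN iffD1, rotated -1]) auto
qed

lemma basis_vec_fun: "ell2_fun (basis_vec i) j = (if j = i then 1 else 0)"
  by transfer simp

lemma cip_basis_vec: "cip v (basis_vec i) = ell2_fun v i"
proof -
  have "cip v (basis_vec i) = (\<Sum>\<^sub>\<infinity>j\<in>{i}. ell2_fun v j * cnj (ell2_fun (basis_vec i) j))"
    unfolding cip_def by (rule infsum_cong_neutral) (auto simp: basis_vec_fun)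
  then show ?thesis by (simp add: basis_vec_fun)
qed

lemma ell2_fun_sum: "ell2_fun (\<Sum>k\<in>K. v k) i = (\<Sum>k\<in>K. ell2_fun (v k) i)"
  by (induction K rule: infinite_finite_induct) auto

lemma ell2_restrict:
  obtains w where "\<And>i. ell2_fun w i = (if i \<in> S then ell2_fun v i else 0)" "norm w \<le> norm v"
proof (rule ell2_bounded_sums[where f = "\<lambda>i. if i \<in> S then ell2_fun v i else 0" and B = "norm v"])
  fix F :: "'a set" assume "finite F"
  have "(\<Sum>i\<in>F. (cmod (if i \<in> S then ell2_fun v i else 0))\<^sup>2) \<le> (\<Sum>i\<in>F. (cmod (ell2_fun v i))\<^sup>2)"
    by (rule sum_mono) auto
  then show "(\<Sum>i\<in>F. (cmod (if i \<in> S then ell2_fun v i else 0))\<^sup>2) \<le> (norm v)\<^sup>2"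
    using ell2_norm_sum_le[OF \<open>finite F\<close>, of v] by linarith
qed auto

text \<open>A suitable finite \<open>F\<close> carries all but \<open>r^2\<close> of the squared
  norm of \<open>v\<close>. Speaking about all dominated \<open>w\<close> lets the same
  \<open>F\<close> serve for truncations of \<open>v\<close> and for restrictions of
  \<open>v\<close> that are chosen after \<open>F\<close>.\<close>

lemma ell2_finite_tail:
  assumes "r > 0"
  obtains F where "finite F"
    "\<And>w. (\<And>i. i \<notin> F \<Longrightarrow> cmod (ell2_fun w i) \<le> cmod (ell2_fun v i)) \<Longrightarrow>
      (\<And>i. i \<in> F \<Longrightarrow> ell2_fun w i = 0) \<Longrightarrow> norm w \<le> r"
proof -
  have "((\<lambda>F. \<Sum>i\<in>F. (cmod (ell2_fun v i))\<^sup>2) \<longlongrightarrow> (norm v)\<^sup>2) (finite_subsets_at_top UNIV)"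
    unfolding ell2_norm_power2 by (rule infsum_tendsto[OF ell2_summable])
  then have "\<forall>\<^sub>F F in finite_subsets_at_top UNIV. dist (\<Sum>i\<in>F. (cmod (ell2_fun v i))\<^sup>2) ((norm v)\<^sup>2) < r\<^sup>2"
    using assms by (intro tendstoD) auto
  then obtain F where F: "finite F" "dist (\<Sum>i\<in>F. (cmod (ell2_fun v i))\<^sup>2) ((norm v)\<^sup>2) < r\<^sup>2"
    unfolding eventually_finite_subsets_at_top by blast
  show ?thesis
  proof (rule that[OF F(1)])
    fix w assume w: "\<And>i. i \<notin> F \<Longrightarrow> cmod (ell2_fun w i) \<le> cmod (ell2_fun v i)"
      "\<And>i. i \<in> F \<Longrightarrow> ell2_fun w i = 0"
    have "(\<Sum>i\<in>G. (cmod (ell2_fun w i))\<^sup>2) \<le> r\<^sup>2" if G: "finite G" for G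
    proof -
      have "(\<Sum>i\<in>G. (cmod (ell2_fun w i))\<^sup>2) = (\<Sum>i\<in>G - F. (cmod (ell2_fun w i))\<^sup>2)"
        by (rule sum.mono_neutral_right) (use G w(2) in auto)
      also have "\<dots> \<le> (\<Sum>i\<in>G - F. (cmod (ell2_fun v i))\<^sup>2)"
        by (intro sum_mono power_mono w) auto
      also have "\<dots> = (\<Sum>i\<in>G \<union> F. (cmod (ell2_fun v i))\<^sup>2) - (\<Sum>i\<in>F. (cmod (ell2_fun v i))\<^sup>2)"
        using F(1) G sum.union_disjoint[of "G - F" F "\<lambda>i. (cmod (ell2_fun v i))\<^sup>2"]
        by (simp add: Int_commute[of "G - F"])
      also have "\<dots> \<le> r\<^sup>2"
        using F ell2_norm_sum_le[of "G \<union> F" v] G by (simp add: dist_real_def)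
      finally show ?thesis .
    qed
    then have "(norm w)\<^sup>2 \<le> r\<^sup>2"
      unfolding ell2_norm_power2 by (intro infsum_le_finite_sums[OF ell2_summable]) auto
    then show "norm w \<le> r" using assms by (simp add: power2_le_iff_abs_le)
  qed
qed

text \<open>The finite truncations of \<open>v\<close> are combinations of basis vectors in
  \<open>W\<close> and approximate \<open>v\<close>.\<close>

lemma ell2_closed_subspace_eqI:
  assumes sub: "0 \<in> W" "\<And>v w. v \<in> W \<Longrightarrow> w \<in> W \<Longrightarrow> v + w \<in> W" "\<And>c v. v \<in> W \<Longrightarrow> cscale c v \<in> W"
    and closed: "closed W" and basis: "\<And>i. i \<in> X \<Longrightarrow> basis_vec i \<in> W"
    and v: "\<And>i. i \<notin> X \<Longrightarrow> ell2_fun v i = 0"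
  shows "v \<in> W"
proof -
  have "v \<in> closure W"
    unfolding closure_approachable
  proof (intro allI impI)
    fix r :: real assume "r > 0"
    then obtain F where F: "finite F"
      "\<And>w. (\<And>i. i \<notin> F \<Longrightarrow> cmod (ell2_fun w i) \<le> cmod (ell2_fun v i)) \<Longrightarrow>
        (\<And>i. i \<in> F \<Longrightarrow> ell2_fun w i = 0) \<Longrightarrow> norm w \<le> r / 2"
      using ell2_finite_tail[of "r / 2" v] by auto
    define u where "u = (\<Sum>i\<in>F \<inter> X. cscale (ell2_fun v i) (basis_vec i))"
    have sums: "sum f K \<in> W" if "finite K" "\<And>i. i \<in> K \<Longrightarrow> f i \<in> W" for f and K :: "'a set"
      using that by (induction K rule: finite_induct) (auto intro: sub)
    then have "u \<in> W" unfolding u_def using F(1) by (intro sums) (auto intro: sub basis)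
    have u: "ell2_fun u i = (if i \<in> F then ell2_fun v i else 0)" for i
      unfolding u_def using F(1) v[of i] by (auto simp: ell2_fun_sum basis_vec_fun if_distrib sum.If_cases cong: if_cong)
    have "norm (u - v) \<le> r / 2" by (rule F(2)) (auto simp: u)
    then show "\<exists>y\<in>W. dist y v < r" using \<open>u \<in> W\<close> \<open>r > 0\<close> by (force simp: dist_norm)
  qed
  then show ?thesis using closed by simp
qed

section \<open>Blocks with respect to the last tensor factor\<close>

text \<open>Indices are base 3 numerals, so the residue modulo 3 is the digit of the last tensor
  factor. In products of block diagonal matrices only one such digit contributes.\<close>

lemma sum_residue_class:
  assumes "c < (3::nat)" "\<And>q. q mod 3 \<noteq> c \<Longrightarrow> f q = 0"
  shows "(\<Sum>q<3 * N. f q) = (\<Sum>q<N. f (3 * q + c))"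
proof (induction N)
  case (Suc N)
  have *: "{..<3 * Suc N} = insert (3 * N) (insert (3 * N + 1) (insert (3 * N + 2) {..<3 * N}))" by auto
  have "f (3 * N) + (f (3 * N + 1) + f (3 * N + 2)) = f (3 * N + c)"
  proof -
    have m: "(3 * N) mod 3 = 0" "(3 * N + 1) mod 3 = 1" "(3 * N + 2) mod 3 = 2" by presburger+
    consider "c = 0" | "c = 1" | "c = 2" using assms(1) by linarith
    then show ?thesis
      using assms(2)[of "3 * N"] assms(2)[of "3 * N + 1"] assms(2)[of "3 * N + 2"] m by cases simp_all
  qed
  then have "sum f {..<3 * Suc N} = f (3 * N + c) + sum f {..<3 * N}"
    unfolding * by (simp add: add.assoc[symmetric])
  then show ?case by (simp add: Suc add.commute)
qed simp

lemma mat_mult_entry: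
  assumes "A \<in> carrier_mat n m" "B \<in> carrier_mat m p" "i < n" "j < p"
  shows "(A * B) $$ (i, j) = (\<Sum>k<m. A $$ (i, k) * B $$ (k, j))"
  using assms by (simp add: scalar_prod_def atLeast0LessThan)

lemma mat_adjoint_carrier [simp]: "A \<in> carrier_mat n m \<Longrightarrow> mat_adjoint A \<in> carrier_mat m n"
  unfolding mat_adjoint_def by (auto simp: mat_of_rows_def)

lemma mat_adjoint_entry:
  fixes A :: "complex mat"
  assumes "A \<in> carrier_mat n m" "i < m" "j < n"
  shows "mat_adjoint A $$ (i, j) = cnj (A $$ (j, i))"
  using assms unfolding mat_adjoint_def by (auto simp: mat_of_rows_def conjugate_complex_def)

text \<open>Since the last tensor factor is the lowest digit, this is \<open>z 0 \<otimes>\<^sub>K e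
  1 1 + z 1 \<otimes>\<^sub>K e 2 2 + z 2 \<otimes>\<^sub>K e 3 3\<close>.\<close>

definition dsum :: "nat \<Rightarrow> (nat \<Rightarrow> complex mat) \<Rightarrow> complex mat" where
  "dsum n z = mat (3 ^ Suc n) (3 ^ Suc n)
     (\<lambda>(r, s). if r mod 3 = s mod 3 then z (r mod 3) $$ (r div 3, s div 3) else 0)"

text \<open>The diagonal block at digit \<open>c\<close> of the last factor; a left inverse of
  \<open>dsum\<close> in each component.\<close>

definition cut :: "nat \<Rightarrow> complex mat \<Rightarrow> complex mat" where
  "cut c b = mat (dim_row b div 3) (dim_col b div 3) (\<lambda>(r, s). b $$ (3 * r + c, 3 * s + c))"

lemma dsum_carrier: "dsum n z \<in> M3 (Suc n)"
  by (simp add: dsum_def)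

lemma dsum_carrier_simps [simp]:
  "dsum n z \<in> carrier_mat (3 * 3 ^ n) (3 * 3 ^ n)"
  "dsum (Suc n) z \<in> carrier_mat (9 * 3 ^ n) (9 * 3 ^ n)"
  using dsum_carrier[of n z] dsum_carrier[of "Suc n" z] by simp_all

lemma dsum_dim [simp]: "dim_row (dsum n z) = 3 * 3 ^ n" "dim_col (dsum n z) = 3 * 3 ^ n"
  by (simp_all add: dsum_def)

lemma dsum_entry:
  "r < 3 ^ Suc n \<Longrightarrow> s < 3 ^ Suc n \<Longrightarrow>
    dsum n z $$ (r, s) = (if r mod 3 = s mod 3 then z (r mod 3) $$ (r div 3, s div 3) else 0)"
  by (simp add: dsum_def)

lemma dsum_cong: "(\<And>c. c < 3 \<Longrightarrow> z c = z' c) \<Longrightarrow> dsum n z = dsum n z'"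
  unfolding dsum_def by (intro cong_mat) auto

lemma dsum_eqI:
  assumes "b \<in> M3 (Suc n)"
    "\<And>r s. r < 3 ^ Suc n \<Longrightarrow> s < 3 ^ Suc n \<Longrightarrow>
      b $$ (r, s) = (if r mod 3 = s mod 3 then z (r mod 3) $$ (r div 3, s div 3) else 0)"
  shows "b = dsum n z"
  using assms by (intro eq_matI) (auto simp: dsum_entry)

lemma cut_carrier [simp]: "b \<in> M3 (Suc n) \<Longrightarrow> cut c b \<in> M3 n"
  by (auto simp: cut_def)

lemma cut_dim [simp]: "dim_row (cut c b) = dim_row b div 3" "dim_col (cut c b) = dim_col b div 3"
  by (simp_all add: cut_def)

lemma cut_entry:
  assumes "b \<in> M3 (Suc n)" "r < 3 ^ n" "s < 3 ^ n"
  shows "cut c b $$ (r, s) = b $$ (3 * r + c, 3 * s + c)"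
  using assms by (simp add: cut_def)

lemma digit_bound: "r < 3 ^ n \<Longrightarrow> c < (3::nat) \<Longrightarrow> 3 * r + c < 3 ^ Suc n"
  unfolding power_Suc by linarith

lemma div_bound: "r < 3 ^ Suc n \<Longrightarrow> r div (3::nat) < 3 ^ n"
  unfolding power_Suc by auto

lemma cut_dsum:
  assumes "c < 3" "z c \<in> M3 n"
  shows "cut c (dsum n z) = z c"
  using assms by (intro eq_matI) (auto simp: cut_entry[of _ n] dsum_entry digit_bound)

lemma dsum_add:
  assumes "\<And>c. c < 3 \<Longrightarrow> z c \<in> M3 n" "\<And>c. c < 3 \<Longrightarrow> z' c \<in> M3 n"
  shows "dsum n z + dsum n z' = dsum n (\<lambda>c. z c + z' c)"
proof (rule dsum_eqI)
  fix r s :: nat assume rs: "r < 3 ^ Suc n" "s < 3 ^ Suc n"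
  then have "r div 3 < 3 ^ n" "s div 3 < 3 ^ n" by (auto intro: div_bound)
  moreover have "r mod 3 < 3" by simp
  ultimately show "(dsum n z + dsum n z') $$ (r, s) =
      (if r mod 3 = s mod 3 then (z (r mod 3) + z' (r mod 3)) $$ (r div 3, s div 3) else 0)"
    using rs assms[of "r mod 3"] by (auto simp: dsum_entry)
qed (rule add_carrier_mat, rule dsum_carrier)

lemma dsum_smult:
  assumes "\<And>c. c < 3 \<Longrightarrow> z c \<in> M3 n"
  shows "k \<cdot>\<^sub>m dsum n z = dsum n (\<lambda>c. k \<cdot>\<^sub>m z c)"
proof (rule dsum_eqI)
  fix r s :: nat assume rs: "r < 3 ^ Suc n" "s < 3 ^ Suc n"
  then have "r div 3 < 3 ^ n" "s div 3 < 3 ^ n" by (auto intro: div_bound)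
  moreover have "r mod 3 < 3" by simp
  ultimately show "(k \<cdot>\<^sub>m dsum n z) $$ (r, s) =
      (if r mod 3 = s mod 3 then (k \<cdot>\<^sub>m z (r mod 3)) $$ (r div 3, s div 3) else 0)"
    using rs assms[of "r mod 3"] by (auto simp: dsum_entry)
qed (rule smult_carrier_mat, rule dsum_carrier)

lemma dsum_adjoint:
  assumes "\<And>c. c < 3 \<Longrightarrow> z c \<in> M3 n"
  shows "mat_adjoint (dsum n z) = dsum n (\<lambda>c. mat_adjoint (z c))"
proof (rule dsum_eqI)
  fix r s :: nat assume rs: "r < 3 ^ Suc n" "s < 3 ^ Suc n"
  then have "r div 3 < 3 ^ n" "s div 3 < 3 ^ n" by (auto intro: div_bound)
  moreover have "r mod 3 < 3" by simp
  ultimately show "mat_adjoint (dsum n z) $$ (r, s) =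
      (if r mod 3 = s mod 3 then mat_adjoint (z (r mod 3)) $$ (r div 3, s div 3) else 0)"
    using rs assms[of "r mod 3"]
    by (auto simp: dsum_entry mat_adjoint_entry[OF dsum_carrier] mat_adjoint_entry[of _ "3 ^ n" "3 ^ n"])
qed (rule mat_adjoint_carrier, rule dsum_carrier)

lemma dsum_mult:
  assumes "\<And>c. c < 3 \<Longrightarrow> z c \<in> M3 n" "\<And>c. c < 3 \<Longrightarrow> z' c \<in> M3 n"
  shows "dsum n z * dsum n z' = dsum n (\<lambda>c. z c * z' c)"
proof (rule dsum_eqI)
  fix r s :: nat assume rs: "r < 3 ^ Suc n" "s < 3 ^ Suc n"
  then have d: "r div 3 < 3 ^ n" "s div 3 < 3 ^ n" by (auto intro: div_bound)
  have c: "r mod 3 < 3" by simp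
  define f where "f q = (if q < 3 * 3 ^ n then dsum n z $$ (r, q) * dsum n z' $$ (q, s) else 0)" for q
  have "(dsum n z * dsum n z') $$ (r, s) = (\<Sum>q<3 ^ Suc n. dsum n z $$ (r, q) * dsum n z' $$ (q, s))"
    by (rule mat_mult_entry[OF dsum_carrier dsum_carrier rs])
  also have "\<dots> = (\<Sum>q<3 * 3 ^ n. f q)"
    by (rule sum.cong) (auto simp: f_def)
  also have "\<dots> = (\<Sum>q<3 ^ n. f (3 * q + r mod 3))"
    by (rule sum_residue_class[OF c]) (use rs in \<open>auto simp: f_def dsum_entry power_Suc\<close>)
  also have "\<dots> = (\<Sum>q<3 ^ n. if r mod 3 = s mod 3 then z (r mod 3) $$ (r div 3, q) * z' (r mod 3) $$ (q, s div 3) else 0)"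
    by (rule sum.cong) (use rs digit_bound[of _ n "r mod 3"] in \<open>auto simp: f_def dsum_entry power_Suc\<close>)
  also have "\<dots> = (if r mod 3 = s mod 3 then (z (r mod 3) * z' (r mod 3)) $$ (r div 3, s div 3) else 0)"
    using mat_mult_entry[OF assms(1)[OF c] assms(2)[OF c] d] by auto
  finally show "(dsum n z * dsum n z') $$ (r, s) =
    (if r mod 3 = s mod 3 then (z (r mod 3) * z' (r mod 3)) $$ (r div 3, s div 3) else 0)" .
qed (rule mult_carrier_mat[OF dsum_carrier dsum_carrier])

lemma dsum_one: "dsum n (\<lambda>_. 1\<^sub>m (3 ^ n)) = 1\<^sub>m (3 ^ Suc n)"
proof (rule dsum_eqI[symmetric])
  fix r s :: nat assume rs: "r < 3 ^ Suc n" "s < 3 ^ Suc n"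
  have "r div 3 = s div 3 \<Longrightarrow> r mod 3 = s mod 3 \<Longrightarrow> r = s" by (metis div_mult_mod_eq)
  then show "1\<^sub>m (3 ^ Suc n) $$ (r, s) =
      (if r mod 3 = s mod 3 then 1\<^sub>m (3 ^ n) $$ (r div 3, s div 3) else (0 :: complex))"
    using rs div_bound[OF rs(1)] div_bound[OF rs(2)] by auto
qed simp

lemma dsum_zero: "dsum n (\<lambda>_. 0\<^sub>m (3 ^ n) (3 ^ n)) = 0\<^sub>m (3 ^ Suc n) (3 ^ Suc n)"
  by (rule dsum_eqI[symmetric]) (auto simp: div_bound)

text \<open>\<open>join n y b\<close> is the element \<open>b \<otimes> e\<^sub>2\<^sub>2 + (\<Sum>\<^sub>j y\<^sub>j \<otimes> \<beta>\<^sup>1\<^sub>j)\<close>; blocks are numbered from \<open>0\<close>, so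
  the paper's index \<open>j\<close> is \<open>j - 1\<close> here.\<close>

definition join :: "nat \<Rightarrow> (nat \<Rightarrow> complex mat) \<Rightarrow> complex mat \<Rightarrow> complex mat" where
  "join n y b = dsum (Suc n)
     (\<lambda>c. if c = 1 then b else if c = 0 then dsum n y else dsum n (\<lambda>a. y ((a + 1) mod 3)))"

text \<open>Recursive form of \<open>\<A> n\<close>: the new last factor carries the previous
  algebra in its middle block and three free coefficients in \<open>M3 n\<close>, each of which
  occurs once in either outer block. Closure under the algebraic operations thus becomes an
  induction.\<close>

primrec Aset :: "nat \<Rightarrow> complex mat set" where
  "Aset 0 = {dsum 0 z | z. \<forall>c<3. z c \<in> M3 0}"
| "Aset (Suc n) = {join n y b | y b. (\<forall>c<3. y c \<in> M3 n) \<and> b \<in> Aset n}"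

lemma join_carrier: "join n y b \<in> M3 (Suc (Suc n))"
  by (simp add: join_def)

lemma join_carrier_simps [simp]: "join n y b \<in> carrier_mat (9 * 3 ^ n) (9 * 3 ^ n)"
  using join_carrier[of n y b] by simp

lemma Aset_carrier: "b \<in> Aset n \<Longrightarrow> b \<in> M3 (Suc n)"
  by (cases n) (auto simp: dsum_carrier join_carrier simp del: power_Suc)

lemma join_in_Aset: "(\<And>c. c < 3 \<Longrightarrow> y c \<in> M3 n) \<Longrightarrow> b \<in> Aset n \<Longrightarrow> join n y b \<in> Aset (Suc n)"
  by auto

lemma Aset_carrier_simps [simp]: "b \<in> Aset n \<Longrightarrow> b \<in> carrier_mat (3 * 3 ^ n) (3 * 3 ^ n)"
  using Aset_carrier[of b n] by simp

lemma join_add: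
  assumes "\<And>c. c < 3 \<Longrightarrow> y c \<in> M3 n" "\<And>c. c < 3 \<Longrightarrow> y' c \<in> M3 n" "b \<in> M3 (Suc n)" "b' \<in> M3 (Suc n)"
  shows "join n y b + join n y' b' = join n (\<lambda>c. y c + y' c) (b + b')"
  unfolding join_def
  by (subst dsum_add) (use assms in \<open>auto simp: dsum_add intro!: dsum_cong\<close>)

lemma join_smult:
  assumes "\<And>c. c < 3 \<Longrightarrow> y c \<in> M3 n" "b \<in> M3 (Suc n)"
  shows "k \<cdot>\<^sub>m join n y b = join n (\<lambda>c. k \<cdot>\<^sub>m y c) (k \<cdot>\<^sub>m b)"
  unfolding join_def
  by (subst dsum_smult) (use assms in \<open>auto simp: dsum_smult intro!: dsum_cong\<close>)

lemma join_mult: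
  assumes "\<And>c. c < 3 \<Longrightarrow> y c \<in> M3 n" "\<And>c. c < 3 \<Longrightarrow> y' c \<in> M3 n" "b \<in> M3 (Suc n)" "b' \<in> M3 (Suc n)"
  shows "join n y b * join n y' b' = join n (\<lambda>c. y c * y' c) (b * b')"
  unfolding join_def
  by (subst dsum_mult) (use assms in \<open>auto simp: dsum_mult intro!: dsum_cong\<close>)

lemma join_adjoint:
  assumes "\<And>c. c < 3 \<Longrightarrow> y c \<in> M3 n" "b \<in> M3 (Suc n)"
  shows "mat_adjoint (join n y b) = join n (\<lambda>c. mat_adjoint (y c)) (mat_adjoint b)"
  unfolding join_def
  by (subst dsum_adjoint) (use assms in \<open>auto simp: dsum_adjoint intro!: dsum_cong\<close>)

lemma join_one: "join n (\<lambda>_. 1\<^sub>m (3 ^ n)) (1\<^sub>m (3 ^ Suc n)) = 1\<^sub>m (3 ^ Suc (Suc n))"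
proof -
  have "join n (\<lambda>_. 1\<^sub>m (3 ^ n)) (1\<^sub>m (3 ^ Suc n)) = dsum (Suc n) (\<lambda>_. 1\<^sub>m (3 ^ Suc n))"
    unfolding join_def by (rule dsum_cong) (simp only: dsum_one if_cancel)
  then show ?thesis by (simp only: dsum_one)
qed

lemma join_zero: "join n (\<lambda>_. 0\<^sub>m (3 ^ n) (3 ^ n)) (0\<^sub>m (3 ^ Suc n) (3 ^ Suc n)) = 0\<^sub>m (3 ^ Suc (Suc n)) (3 ^ Suc (Suc n))"
proof -
  have "join n (\<lambda>_. 0\<^sub>m (3 ^ n) (3 ^ n)) (0\<^sub>m (3 ^ Suc n) (3 ^ Suc n))
      = dsum (Suc n) (\<lambda>_. 0\<^sub>m (3 ^ Suc n) (3 ^ Suc n))"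
    unfolding join_def by (rule dsum_cong) (simp only: dsum_zero if_cancel)
  then show ?thesis by (simp only: dsum_zero)
qed

lemma join_cong: "(\<And>c. c < 3 \<Longrightarrow> y c = y' c) \<Longrightarrow> join n y b = join n y' b"
  unfolding join_def by (rule dsum_cong) (auto intro!: dsum_cong)

lemma cut_join:
  assumes "b \<in> M3 (Suc n)"
  shows "cut 1 (join n y b) = b" "cut 0 (join n y b) = dsum n y"
    "cut 2 (join n y b) = dsum n (\<lambda>a. y ((a + 1) mod 3))"
  unfolding join_def using assms by (subst cut_dsum; simp add: dsum_carrier_simps[of n])+

lemma Aset_dsum:
  assumes "b \<in> Aset n"
  obtains z where "b = dsum n z" "\<And>c. c < 3 \<Longrightarrow> z c \<in> M3 n"
proof (cases n)
  case 0
  then show ?thesis using assms that by auto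
next
  case (Suc m)
  then obtain y a where ya: "b = join m y a" "\<And>c. c < 3 \<Longrightarrow> y c \<in> M3 m" "a \<in> Aset m"
    using assms by auto
  show ?thesis
    by (rule that[unfolded Suc, OF ya(1)[unfolded join_def]]) (use Aset_carrier[OF ya(3)] in auto)
qed

lemma Aset_cut_1: "b \<in> Aset (Suc n) \<Longrightarrow> cut 1 b \<in> Aset n"
  using cut_join(1) Aset_carrier by auto

lemma Aset_add: "a \<in> Aset n \<Longrightarrow> b \<in> Aset n \<Longrightarrow> a + b \<in> Aset n"
proof (induction n arbitrary: a b)
  case 0
  then obtain z z' where "a = dsum 0 z" "b = dsum 0 z'" "\<forall>c<3. z c \<in> M3 0" "\<forall>c<3. z' c \<in> M3 0" by auto
  then show ?case by (force simp: dsum_add)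
next
  case (Suc n)
  then obtain y a' y' b' where *: "a = join n y a'" "b = join n y' b'" "\<forall>c<3. y c \<in> M3 n" "\<forall>c<3. y' c \<in> M3 n"
    "a' \<in> Aset n" "b' \<in> Aset n" by auto
  then have "a + b = join n (\<lambda>c. y c + y' c) (a' + b')" by (auto intro!: join_add Aset_carrier)
  then show ?case using * Suc.IH[OF *(5,6)] by (simp only:) (rule join_in_Aset; simp)
qed

lemma Aset_smult: "a \<in> Aset n \<Longrightarrow> k \<cdot>\<^sub>m a \<in> Aset n"
proof (induction n arbitrary: a)
  case 0
  then obtain z where "a = dsum 0 z" "\<forall>c<3. z c \<in> M3 0" by auto
  then show ?case by (force simp: dsum_smult)
next
  case (Suc n)
  then obtain y a' where *: "a = join n y a'" "\<forall>c<3. y c \<in> M3 n" "a' \<in> Aset n" by auto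
  then have "k \<cdot>\<^sub>m a = join n (\<lambda>c. k \<cdot>\<^sub>m y c) (k \<cdot>\<^sub>m a')" by (auto intro!: join_smult Aset_carrier)
  then show ?case using * Suc.IH[OF *(3)] by (simp only:) (rule join_in_Aset; simp)
qed

lemma Aset_mult: "a \<in> Aset n \<Longrightarrow> b \<in> Aset n \<Longrightarrow> a * b \<in> Aset n"
proof (induction n arbitrary: a b)
  case 0
  then obtain z z' where "a = dsum 0 z" "b = dsum 0 z'" "\<forall>c<3. z c \<in> M3 0" "\<forall>c<3. z' c \<in> M3 0" by auto
  then show ?case by (force simp: dsum_mult)
next
  case (Suc n)
  then obtain y a' y' b' where *: "a = join n y a'" "b = join n y' b'" "\<forall>c<3. y c \<in> M3 n" "\<forall>c<3. y' c \<in> M3 n"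
    "a' \<in> Aset n" "b' \<in> Aset n" by auto
  then have "a * b = join n (\<lambda>c. y c * y' c) (a' * b')" by (auto intro!: join_mult Aset_carrier)
  then show ?case using * Suc.IH[OF *(5,6)] by (simp only:) (rule join_in_Aset, auto intro!: mult_carrier_mat)
qed

lemma Aset_adjoint: "a \<in> Aset n \<Longrightarrow> mat_adjoint a \<in> Aset n"
proof (induction n arbitrary: a)
  case 0
  then obtain z where "a = dsum 0 z" "\<forall>c<3. z c \<in> M3 0" by auto
  then show ?case by (force simp: dsum_adjoint)
next
  case (Suc n)
  then obtain y a' where *: "a = join n y a'" "\<forall>c<3. y c \<in> M3 n" "a' \<in> Aset n" by auto
  then have "mat_adjoint a = join n (\<lambda>c. mat_adjoint (y c)) (mat_adjoint a')" by (auto intro!: join_adjoint Aset_carrier)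
  then show ?case using * Suc.IH[OF *(3)] by (simp only:) (rule join_in_Aset; simp)
qed

lemma Aset_one: "1\<^sub>m (3 ^ Suc n) \<in> Aset n"
proof (induction n)
  case 0
  show ?case unfolding dsum_one[symmetric] by auto
next
  case (Suc n)
  then show ?case unfolding join_one[symmetric] Aset.simps by (intro CollectI exI conjI) auto
qed

lemma Aset_zero: "0\<^sub>m (3 ^ Suc n) (3 ^ Suc n) \<in> Aset n"
proof (induction n)
  case 0
  show ?case unfolding dsum_zero[symmetric] by auto
next
  case (Suc n)
  then show ?case unfolding join_zero[symmetric] Aset.simps by (intro CollectI exI conjI) auto
qed

text \<open>Compression to a block is not multiplicative on all matrices; here the off-diagonal
  blocks with respect to the last factor vanish. This is the source of the multiplicativity of the
  slice maps on \<open>\<A>_infty\<close>.\<close>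

lemma cut_mult_Aset:
  assumes "a \<in> Aset n" "b \<in> Aset n" "c < 3"
  shows "cut c (a * b) = cut c a * cut c b"
proof -
  obtain z z' where z: "a = dsum n z" "\<And>c. c < 3 \<Longrightarrow> z c \<in> M3 n" "b = dsum n z'" "\<And>c. c < 3 \<Longrightarrow> z' c \<in> M3 n"
    using assms Aset_dsum by metis
  then have "z c * z' c \<in> M3 n" using assms(3) by (intro mult_carrier_mat)
  then show ?thesis using assms(3) z by (simp add: dsum_mult cut_dsum)
qed

section \<open>The algebras \<open>\<A> n\<close> in block form\<close>

lemma M3_eqI:
  assumes "a \<in> M3 n" "b \<in> M3 n" "\<And>r s. r < 3 ^ n \<Longrightarrow> s < 3 ^ n \<Longrightarrow> a $$ (r, s) = b $$ (r, s)"
  shows "a = b"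
  using assms by (intro eq_matI) auto

lemma less_3_cases: "c < 3 \<Longrightarrow> c = 0 \<or> c = 1 \<or> c = (2::nat)"
  by linarith

lemma kron_carrier:
  "A \<in> carrier_mat a b \<Longrightarrow> B \<in> carrier_mat c d \<Longrightarrow> A \<otimes>\<^sub>K B \<in> carrier_mat (a * c) (b * d)"
  by (auto simp: kron_def)

lemma kron_dim: "dim_row (A \<otimes>\<^sub>K B) = dim_row A * dim_row B" "dim_col (A \<otimes>\<^sub>K B) = dim_col A * dim_col B"
  by (simp_all add: kron_def)

lemma kron_entry:
  assumes "A \<in> carrier_mat a b" "B \<in> carrier_mat c d" "r < a * c" "s < b * d"
  shows "(A \<otimes>\<^sub>K B) $$ (r, s) = A $$ (r div c, s div d) * B $$ (r mod c, s mod d)"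
  using assms by (auto simp: kron_def)

lemma mod_mult_div_mod:
  fixes i b c :: nat
  shows "i mod (b * c) div c = i div c mod b" "i mod (b * c) mod c = i mod c"
proof -
  have *: "i mod (b * c) = c * (i div c mod b) + i mod c"
    by (subst mult.commute) (rule mod_mult2_eq)
  show "i mod (b * c) mod c = i mod c" by (simp add: *)
  show "i mod (b * c) div c = i div c mod b" by (cases "c = 0") (simp_all add: *)
qed

lemma kron_assoc:
  "(A \<otimes>\<^sub>K B) \<otimes>\<^sub>K C = A \<otimes>\<^sub>K (B \<otimes>\<^sub>K C)"
proof (rule eq_matI)
  let ?a = "dim_row A" and ?b = "dim_row B" and ?c = "dim_row C"
  let ?a' = "dim_col A" and ?b' = "dim_col B" and ?c' = "dim_col C"
  fix i j assume "i < dim_row (A \<otimes>\<^sub>K (B \<otimes>\<^sub>K C))" "j < dim_col (A \<otimes>\<^sub>K (B \<otimes>\<^sub>K C))"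
  then have i: "i < ?a * ?b * ?c" and j: "j < ?a' * ?b' * ?c'"
    by (auto simp: kron_def mult.assoc)
  have bounds: "i div ?c < ?a * ?b" "j div ?c' < ?a' * ?b'" "i mod (?b * ?c) < ?b * ?c" "j mod (?b' * ?c') < ?b' * ?c'"
    using i j by (auto simp: less_mult_imp_div_less intro!: mod_less_divisor Nat.gr0I)
  have "((A \<otimes>\<^sub>K B) \<otimes>\<^sub>K C) $$ (i, j)
      = A $$ (i div ?c div ?b, j div ?c' div ?b') * B $$ (i div ?c mod ?b, j div ?c' mod ?b') * C $$ (i mod ?c, j mod ?c')"
    using i j bounds by (auto simp: kron_def)
  also have "\<dots> = (A \<otimes>\<^sub>K (B \<otimes>\<^sub>K C)) $$ (i, j)"
    using i j bounds
    by (simp add: kron_def mod_mult_div_mod mult.assoc) (simp add: div_mult2_eq[symmetric] mult.commute)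
  finally show "((A \<otimes>\<^sub>K B) \<otimes>\<^sub>K C) $$ (i, j) = (A \<otimes>\<^sub>K (B \<otimes>\<^sub>K C)) $$ (i, j)" .
qed (auto simp: kron_def mult.assoc)

lemma kron_one_1: "A \<otimes>\<^sub>K 1\<^sub>m 1 = A" "1\<^sub>m 1 \<otimes>\<^sub>K A = A"
  by (rule eq_matI; auto simp: kron_def)+

lemma kron_pow_Suc_right: "kron_pow A (Suc n) = kron_pow A n \<otimes>\<^sub>K A"
proof (induction n)
  case 0
  show ?case by (simp only: kron_pow.simps kron_one_1)
next
  case (Suc n)
  have "kron_pow A (Suc (Suc n)) = A \<otimes>\<^sub>K (kron_pow A n \<otimes>\<^sub>K A)"
    by (simp only: kron_pow.simps(2)[of A "Suc n"] Suc)
  then show ?case by (simp add: kron_assoc)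
qed

lemma unit_carrier [simp]: "e i j \<in> carrier_mat 3 3"
  by (simp add: e_def)

lemma unit_dim [simp]: "dim_row (e i j) = 3" "dim_col (e i j) = 3"
  by (simp_all add: e_def)

lemma kron_pow_carrier: "A \<in> carrier_mat 3 3 \<Longrightarrow> kron_pow A n \<in> M3 n"
  by (induction n) (auto intro: kron_carrier)

lemma \<alpha>_carrier: "\<alpha> n j \<in> M3 (Suc n)"
  unfolding \<alpha>_def power_Suc by (intro kron_carrier kron_pow_carrier unit_carrier)

lemma \<alpha>_0: "\<alpha> 0 j = e j j"
  unfolding \<alpha>_def by (simp only: kron_pow.simps kron_one_1)

lemma \<alpha>_Suc: "\<alpha> (Suc n) j = \<alpha> n j \<otimes>\<^sub>K e 2 2"
  unfolding \<alpha>_def by (simp only: kron_pow_Suc_right kron_assoc)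

lemma \<beta>_1: "\<beta> 1 j = e j j \<otimes>\<^sub>K e 1 1 + e (j + 2) (j + 2) \<otimes>\<^sub>K e 3 3"
  unfolding \<beta>_def by (simp only: diff_self_eq_0 kron_pow.simps kron_one_1)

lemma \<beta>_Suc_Suc: "\<beta> (Suc (Suc k)) j = \<beta> (Suc k) j \<otimes>\<^sub>K e 2 2"
  unfolding \<beta>_def by (simp only: diff_Suc_1 kron_pow_Suc_right kron_assoc)

lemma \<beta>_carrier: "\<beta> (Suc k) j \<in> M3 (Suc (Suc k))"
proof (induction k)
  case 0
  have "e j j \<otimes>\<^sub>K e 1 1 + e (j + 2) (j + 2) \<otimes>\<^sub>K e 3 3 \<in> carrier_mat (3 * 3) (3 * 3)"
    by (intro add_carrier_mat kron_carrier unit_carrier)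
  then show ?case using \<beta>_1[of j] by simp
next
  case (Suc k)
  have "\<beta> (Suc k) j \<otimes>\<^sub>K e 2 2 \<in> carrier_mat (3 ^ Suc (Suc k) * 3) (3 ^ Suc (Suc k) * 3)"
    by (intro kron_carrier Suc unit_carrier)
  then show ?case unfolding \<beta>_Suc_Suc by (simp add: mult.commute)
qed

lemma kron_digit:
  assumes "x \<in> M3 n" "y \<in> carrier_mat 3 3" "r < 3 ^ Suc n" "s < 3 ^ Suc n"
  shows "(x \<otimes>\<^sub>K y) $$ (r, s) = x $$ (r div 3, s div 3) * y $$ (r mod 3, s mod 3)"
  using assms(3,4) by (intro kron_entry[OF assms(1,2)]) auto

lemma kron_M3: "x \<in> M3 n \<Longrightarrow> y \<in> carrier_mat 3 3 \<Longrightarrow> x \<otimes>\<^sub>K y \<in> M3 (Suc n)"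
  using kron_carrier[of x "3 ^ n" "3 ^ n" y 3 3] by (simp add: mult.commute)

lemma kron_one_3: "x \<in> M3 n \<Longrightarrow> x \<otimes>\<^sub>K 1\<^sub>m 3 = dsum n (\<lambda>_. x)"
  by (rule dsum_eqI, rule kron_M3[OF _ one_carrier_mat]) (auto simp: kron_digit[OF _ one_carrier_mat])

lemma e22_entry: "c < 3 \<Longrightarrow> d < 3 \<Longrightarrow> e 2 2 $$ (c, d) = (if c = 1 \<and> d = 1 then 1 else 0)"
  unfolding e_def by (auto dest!: less_3_cases)

lemma kron_e22:
  assumes "x \<in> M3 n"
  shows "x \<otimes>\<^sub>K e 2 2 = dsum n (\<lambda>c. if c = 1 then x else 0\<^sub>m (3 ^ n) (3 ^ n))"
proof (rule dsum_eqI)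
  fix r s :: nat assume rs: "r < 3 ^ Suc n" "s < 3 ^ Suc n"
  show "(x \<otimes>\<^sub>K e 2 2) $$ (r, s) = (if r mod 3 = s mod 3
      then (if r mod 3 = 1 then x else 0\<^sub>m (3 ^ n) (3 ^ n)) $$ (r div 3, s div 3) else 0)"
    using kron_digit[OF assms unit_carrier rs, of 2 2] div_bound[OF rs(1)] div_bound[OF rs(2)]
    by (auto simp: e22_entry)
qed (use assms in \<open>intro kron_M3 unit_carrier\<close>)

text \<open>Tensoring with \<open>e 2 2\<close> adds zero coefficients; in this way \<alpha> and the
  older \<beta> pass to the next level.\<close>

lemma kron_e22_join:
  assumes "x \<in> M3 (Suc n)"
  shows "x \<otimes>\<^sub>K e 2 2 = join n (\<lambda>_. 0\<^sub>m (3 ^ n) (3 ^ n)) x"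
  unfolding kron_e22[OF assms] join_def by (rule dsum_cong) (simp only: dsum_zero if_cancel)

lemma kron_\<beta>_1:
  assumes "x \<in> M3 n" "r < 3 ^ Suc (Suc n)" "s < 3 ^ Suc (Suc n)" "j \<in> {1, 2, 3}"
  shows "(x \<otimes>\<^sub>K \<beta> 1 j) $$ (r, s) =
    (if r mod 3 = s mod 3 \<and> r div 3 mod 3 = s div 3 mod 3 \<and>
        (r mod 3 = 0 \<and> r div 3 mod 3 = j - 1 \<or> r mod 3 = 2 \<and> (r div 3 mod 3 + 1) mod 3 = j - 1)
     then x $$ (r div 3 div 3, s div 3 div 3) else 0)"
proof -
  have bd: "r div 3 mod 3 < 3" "s div 3 mod 3 < 3" "r mod 3 < 3" "s mod 3 < 3" by auto
  have unit: "e i i $$ (c, d) = (if c = d \<and> (c + 1) mod 3 = i mod 3 then 1 else 0)" if "c < 3" "d < 3" for i c d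
  proof -
    have "c = d" if "(c + 1) mod 3 = (d + 1) mod 3"
      using less_3_cases[OF \<open>c < 3\<close>] less_3_cases[OF \<open>d < 3\<close>] that by (elim disjE; simp)
    moreover have "e i i $$ (c, d) = (if (c + 1) mod 3 = i mod 3 \<and> (d + 1) mod 3 = i mod 3 then 1 else 0)"
      unfolding e_def using that by (subst index_mat) simp_all
    ultimately show ?thesis by metis
  qed
  have r9: "r mod 9 < 3 * 3" "s mod 9 < 3 * 3" by auto
  have dm: "r mod 9 div 3 = r div 3 mod 3" "r mod 9 mod 3 = r mod 3" "s mod 9 div 3 = s div 3 mod 3" "s mod 9 mod 3 = s mod 3"
  proof -
    have nine: "(9 :: nat) = 3 * 3" by simp
    show "r mod 9 div 3 = r div 3 mod 3" "r mod 9 mod 3 = r mod 3" "s mod 9 div 3 = s div 3 mod 3" "s mod 9 mod 3 = s mod 3"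
      unfolding nine by (rule mod_mult_div_mod)+
  qed
  have \<beta>1: "\<beta> 1 j $$ (r mod 9, s mod 9) =
      e j j $$ (r div 3 mod 3, s div 3 mod 3) * e 1 1 $$ (r mod 3, s mod 3) +
      e (j + 2) (j + 2) $$ (r div 3 mod 3, s div 3 mod 3) * e 3 3 $$ (r mod 3, s mod 3)"
    unfolding \<beta>_1
    using r9 unit_carrier
    by (subst index_add_mat) (simp_all add: kron_entry[OF unit_carrier unit_carrier r9] dm kron_dim)
  have "(x \<otimes>\<^sub>K \<beta> 1 j) $$ (r, s) = x $$ (r div 9, s div 9) * \<beta> 1 j $$ (r mod 9, s mod 9)"
    using assms(2,3) \<beta>_carrier[of 0 j] by (subst kron_entry[OF assms(1), of "\<beta> 1 j" 9 9]) auto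
  moreover have "r div 9 = r div 3 div 3" "s div 9 = s div 3 div 3"
    by (simp_all flip: div_mult2_eq)
  ultimately have prod: "(x \<otimes>\<^sub>K \<beta> 1 j) $$ (r, s) = x $$ (r div 3 div 3, s div 3 div 3) * \<beta> 1 j $$ (r mod 9, s mod 9)"
    by simp
  \<comment> \<open>The two summands of \<open>\<beta> 1 j\<close> sit at the last digits 0 and 2,
    so \<open>Q\<close> and \<open>Q'\<close> exclude each other and the sum of two products
    collapses to one case distinction.\<close>
  have key: "z * ((if A = A' \<and> P then 1 else 0) * (if C = C' \<and> Q then 1 else 0) +
      (if A = A' \<and> P' then 1 else 0) * (if C = C' \<and> Q' then 1 else 0)) =
      (if C = C' \<and> A = A' \<and> (Q \<and> P \<or> Q' \<and> P') then z else 0)" if "\<not> (Q \<and> Q')"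
    for z :: complex and A A' C C' :: nat and P P' Q Q'
    using that by auto
  \<comment> \<open>In zero-based digits, \<open>e j j\<close> sits at \<open>j - 1\<close>, and
    \<open>e (j + 2) (j + 2)\<close> at the digit whose cyclic successor is
    \<open>j - 1\<close>.\<close>
  have ja: "(a + 1) mod 3 = j mod 3 \<longleftrightarrow> a = j - 1"
      "(a + 1) mod 3 = (j + 2) mod 3 \<longleftrightarrow> (a + 1) mod 3 = j - 1" if "a < 3" for a
    using less_3_cases[OF that] assms(4) by (elim disjE; auto)+
  have jc: "(c + 1) mod 3 = 1 mod 3 \<longleftrightarrow> c = 0" "(c + 1) mod 3 = 3 mod 3 \<longleftrightarrow> c = 2" if "c < 3" for c :: nat
    using less_3_cases[OF that] by (elim disjE; simp)+
  show ?thesis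
    unfolding prod \<beta>1 unit[OF bd(1,2)] unit[OF bd(3,4)] ja[OF bd(1)] jc[OF bd(3)]
    by (rule key) linarith
qed

lemma join_entry:
  assumes "r < 3 ^ Suc (Suc n)" "s < 3 ^ Suc (Suc n)"
  shows "join n y b $$ (r, s) = (if r mod 3 = s mod 3 then
      if r mod 3 = 1 then b $$ (r div 3, s div 3)
      else if r div 3 mod 3 = s div 3 mod 3 then
        y (if r mod 3 = 0 then r div 3 mod 3 else (r div 3 mod 3 + 1) mod 3) $$ (r div 3 div 3, s div 3 div 3)
      else 0 else 0)"
  unfolding join_def using assms div_bound[OF assms(1)] div_bound[OF assms(2)]
  by (simp add: dsum_entry del: power_Suc)

text \<open>Entry \<open>p\<close> of the right-hand side of \<open>decomposes\<close>, with sums of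
  complex numbers in place of sums in a module that depends on \<open>n\<close>; this makes the
  passage from \<open>n\<close> to \<open>n + 1\<close> a computation with entries.\<close>

definition dec :: "nat \<Rightarrow> (nat \<Rightarrow> complex) \<Rightarrow> (nat \<Rightarrow> nat \<Rightarrow> complex mat) \<Rightarrow> nat \<times> nat \<Rightarrow> complex" where
  "dec n x y p = (\<Sum>j\<in>{1,2,3}. x j * \<alpha> n j $$ p) + (\<Sum>k<n. \<Sum>j\<in>{1,2,3}. (y k j \<otimes>\<^sub>K \<beta> (n - k) j) $$ p)"

lemma finsum_M3:
  assumes "finite I" "\<And>i. i \<in> I \<Longrightarrow> f i \<in> M3 N"
  shows "finsum (M3_space N) f I \<in> M3 N \<and>
    (\<forall>r<3 ^ N. \<forall>s<3 ^ N. finsum (M3_space N) f I $$ (r, s) = (\<Sum>i\<in>I. f i $$ (r, s)))"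
  using assms
proof (induction I rule: finite_induct)
  case empty
  interpret abelian_group "M3_space N" by (rule abelian_group_mat)
  show ?case by (simp add: module_mat_simps)
next
  case (insert i I)
  interpret abelian_group "M3_space N" by (rule abelian_group_mat)
  have "finsum (M3_space N) f (insert i I) = f i + finsum (M3_space N) f I"
    using insert by (subst finsum_insert) (auto simp: module_mat_simps)
  then show ?case using insert by auto
qed

lemma kron_\<beta>_carrier:
  assumes "x \<in> M3 k" "k < n"
  shows "x \<otimes>\<^sub>K \<beta> (n - k) j \<in> M3 (Suc n)"
proof -
  obtain m where m: "n = Suc (k + m)" using assms(2) less_iff_Suc_add by auto
  have "x \<otimes>\<^sub>K \<beta> (Suc m) j \<in> carrier_mat (3 ^ k * 3 ^ Suc (Suc m)) (3 ^ k * 3 ^ Suc (Suc m))"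
    by (intro kron_carrier assms \<beta>_carrier)
  then show ?thesis by (simp add: m power_add mult.left_commute)
qed

lemma decomposes_iff:
  "decomposes n b x y \<longleftrightarrow> (\<forall>k<n. \<forall>j\<in>{1, 2, 3}. y k j \<in> M3 k) \<and> b \<in> M3 (Suc n) \<and>
    (\<forall>r<3 ^ Suc n. \<forall>s<3 ^ Suc n. b $$ (r, s) = dec n x y (r, s))"
proof (cases "\<forall>k<n. \<forall>j\<in>{1, 2, 3}. y k j \<in> M3 k")
  case True
  define A where "A = (\<Oplus>\<^bsub>M3_space (Suc n)\<^esub> j\<in>{1, 2, 3}. x j \<cdot>\<^sub>m \<alpha> n j)"
  define B where "B k = (\<Oplus>\<^bsub>M3_space (Suc n)\<^esub> j\<in>{1, 2, 3}. y k j \<otimes>\<^sub>K \<beta> (n - k) j)" for k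
  define C where "C = (\<Oplus>\<^bsub>M3_space (Suc n)\<^esub> k\<in>{..<n}. B k)"
  have A: "A \<in> M3 (Suc n)" "\<forall>r<3 ^ Suc n. \<forall>s<3 ^ Suc n. A $$ (r, s) = (\<Sum>j\<in>{1,2,3}. x j * \<alpha> n j $$ (r, s))"
    using finsum_M3[of "{1,2,3::nat}" "\<lambda>j. x j \<cdot>\<^sub>m \<alpha> n j" "Suc n"] \<alpha>_carrier[of n]
      carrier_matD[OF \<alpha>_carrier[of n]]
    unfolding A_def by auto
  have B: "B k \<in> M3 (Suc n)" "\<forall>r<3 ^ Suc n. \<forall>s<3 ^ Suc n. B k $$ (r, s) = (\<Sum>j\<in>{1,2,3}. (y k j \<otimes>\<^sub>K \<beta> (n - k) j) $$ (r, s))"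
    if "k < n" for k
    using finsum_M3[of "{1,2,3::nat}" "\<lambda>j. y k j \<otimes>\<^sub>K \<beta> (n - k) j" "Suc n"] True that kron_\<beta>_carrier[of _ k n]
    unfolding B_def by (auto simp del: power_Suc)
  have C: "C \<in> M3 (Suc n)" "\<forall>r<3 ^ Suc n. \<forall>s<3 ^ Suc n. C $$ (r, s) = (\<Sum>k<n. B k $$ (r, s))"
    using finsum_M3[of "{..<n}" B "Suc n"] B(1) unfolding C_def by (auto simp del: power_Suc)
  have AC: "A + C \<in> M3 (Suc n)" "\<forall>r<3 ^ Suc n. \<forall>s<3 ^ Suc n. (A + C) $$ (r, s) = dec n x y (r, s)"
    using A C B(2) by (auto simp: dec_def simp del: power_Suc)
  have "decomposes n b x y \<longleftrightarrow> b = A + C"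
    using True unfolding decomposes_def A_def B_def C_def by simp
  moreover have "b = A + C" if "b \<in> M3 (Suc n)" "\<forall>r<3 ^ Suc n. \<forall>s<3 ^ Suc n. b $$ (r, s) = dec n x y (r, s)"
    by (rule M3_eqI[OF that(1) AC(1)]) (simp add: that(2) AC(2))
  ultimately show ?thesis using True AC by blast
next
  case False
  then show ?thesis unfolding decomposes_def by blast
qed

text \<open>The terms with \<alpha> and those with \<open>k < n\<close> only acquire a trailing
  \<open>e 2 2\<close> and hence live in the middle block; the coefficients with
  \<open>k = n\<close> are the new ones.\<close>

lemma dec_Suc:
  assumes "\<And>k j. k < n \<Longrightarrow> j \<in> {1, 2, 3} \<Longrightarrow> y k j \<in> M3 k" "r < 3 ^ Suc (Suc n)" "s < 3 ^ Suc (Suc n)"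
  shows "dec (Suc n) x y (r, s) = (if r mod 3 = 1 \<and> s mod 3 = 1 then dec n x y (r div 3, s div 3) else 0)
    + (\<Sum>j\<in>{1,2,3}. (y n j \<otimes>\<^sub>K \<beta> 1 j) $$ (r, s))"
proof -
  define u where "u = (if r mod 3 = 1 \<and> s mod 3 = 1 then 1 else (0 :: complex))"
  have u: "u = e 2 2 $$ (r mod 3, s mod 3)" by (simp add: e22_entry u_def)
  have a: "\<alpha> (Suc n) j $$ (r, s) = \<alpha> n j $$ (r div 3, s div 3) * u" for j
    unfolding \<alpha>_Suc u by (rule kron_digit[OF \<alpha>_carrier unit_carrier assms(2,3)])
  have b: "(y k j \<otimes>\<^sub>K \<beta> (Suc n - k) j) $$ (r, s) = (y k j \<otimes>\<^sub>K \<beta> (n - k) j) $$ (r div 3, s div 3) * u"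
    if k: "k < n" and "j \<in> {1, 2, 3}" for k j
  proof -
    obtain m where m: "n - k = Suc m" "Suc n - k = Suc (Suc m)" using k by (metis Suc_diff_Suc Suc_diff_le less_imp_le)
    show ?thesis
      unfolding m \<beta>_Suc_Suc kron_assoc[symmetric] u
      using kron_\<beta>_carrier[OF assms(1)[OF that] k, of j] unfolding m by (rule kron_digit[OF _ unit_carrier assms(2,3)])
  qed
  have "dec (Suc n) x y (r, s) = (\<Sum>j\<in>{1,2,3}. x j * (\<alpha> n j $$ (r div 3, s div 3) * u)) +
     ((\<Sum>k<n. \<Sum>j\<in>{1,2,3}. (y k j \<otimes>\<^sub>K \<beta> (n - k) j) $$ (r div 3, s div 3) * u) +
      (\<Sum>j\<in>{1,2,3}. (y n j \<otimes>\<^sub>K \<beta> 1 j) $$ (r, s)))"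
    unfolding dec_def a sum.lessThan_Suc using b by simp
  also have "\<dots> = dec n x y (r div 3, s div 3) * u + (\<Sum>j\<in>{1,2,3}. (y n j \<otimes>\<^sub>K \<beta> 1 j) $$ (r, s))"
    unfolding dec_def by (simp add: algebra_simps sum_distrib_left)
  finally show ?thesis by (simp add: u_def)
qed

lemma \<beta>_1_sum:
  assumes y: "\<And>j. j \<in> {1, 2, 3} \<Longrightarrow> y j \<in> M3 n" and "r < 3 ^ Suc (Suc n)" "s < 3 ^ Suc (Suc n)"
  shows "(\<Sum>j\<in>{1,2,3}. (y j \<otimes>\<^sub>K \<beta> 1 j) $$ (r, s)) =
    (if r mod 3 = s mod 3 \<and> r mod 3 \<noteq> 1 \<and> r div 3 mod 3 = s div 3 mod 3 then
        y (Suc (if r mod 3 = 0 then r div 3 mod 3 else (r div 3 mod 3 + 1) mod 3)) $$ (r div 3 div 3, s div 3 div 3)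
      else 0)"
proof -
  define m where "m = (if r mod 3 = 0 then r div 3 mod 3 else (r div 3 mod 3 + 1) mod 3)"
  define P where "P \<longleftrightarrow> r mod 3 = s mod 3 \<and> r mod 3 \<noteq> 1 \<and> r div 3 mod 3 = s div 3 mod 3"
  have "r mod 3 < 3" by simp
  note r3 = less_3_cases[OF this]
  have cond: "R = S \<and> A = B \<and> (R = 0 \<and> A = i \<or> R = 2 \<and> A' = i) \<longleftrightarrow>
      (R = S \<and> R \<noteq> 1 \<and> A = B) \<and> (if R = 0 then A else A') = i" if "R = 0 \<or> R = 1 \<or> R = 2" for R S A A' B i :: nat
    using that by auto
  have t: "(y j \<otimes>\<^sub>K \<beta> 1 j) $$ (r, s) = (if P \<and> m = j - 1 then y j $$ (r div 3 div 3, s div 3 div 3) else 0)"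
    if j: "j \<in> {1, 2, 3}" for j
    unfolding kron_\<beta>_1[OF y[OF j] assms(2,3) j] P_def m_def cond[OF r3] ..
  have "m < 3" by (simp add: m_def)
  have sum: "(\<Sum>j\<in>{1,2,3}. if P \<and> m = j - 1 then g j else 0) = (if P then g (Suc m) else 0)" for g :: "nat \<Rightarrow> complex"
    using less_3_cases[OF \<open>m < 3\<close>] by (elim disjE) (simp_all add: numeral_2_eq_2 numeral_3_eq_3)
  have "(\<Sum>j\<in>{1,2,3}. (y j \<otimes>\<^sub>K \<beta> 1 j) $$ (r, s)) =
      (\<Sum>j\<in>{1,2,3}. if P \<and> m = j - 1 then y j $$ (r div 3 div 3, s div 3 div 3) else 0)"
    by (rule sum.cong[OF refl t])
  also have "\<dots> = (if P then y (Suc m) $$ (r div 3 div 3, s div 3 div 3) else 0)"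
    by (rule sum)
  finally show ?thesis unfolding P_def m_def by simp
qed

text \<open>Peeling off one tensor factor matches the recursion of \<open>Aset\<close>, and the
  newest coefficients become visible in the blocks of \<open>b\<close>.\<close>

lemma decomposes_Suc:
  "decomposes (Suc n) b x y \<longleftrightarrow>
    (\<exists>b'. decomposes n b' x y \<and> (\<forall>j\<in>{1, 2, 3}. y n j \<in> M3 n) \<and> b = join n (\<lambda>c. y n (Suc c)) b')"
proof (cases "\<forall>k<Suc n. \<forall>j\<in>{1, 2, 3}. y k j \<in> M3 k")
  case True
  define b' where "b' = mat (3 ^ Suc n) (3 ^ Suc n) (dec n x y)"
  have b': "decomposes n b'' x y \<longleftrightarrow> b'' = b'" for b''
  proof
    have c: "b' \<in> M3 (Suc n)" unfolding b'_def by (rule mat_carrier)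
    have e: "b' $$ (r, s) = dec n x y (r, s)" if "r < 3 ^ Suc n" "s < 3 ^ Suc n" for r s
      using that by (simp add: b'_def)
    show "b'' = b'" if "decomposes n b'' x y"
      by (rule M3_eqI[of _ "Suc n"]) (use that c e in \<open>unfold decomposes_iff, metis+\<close>)
    show "decomposes n b'' x y" if "b'' = b'"
      unfolding decomposes_iff that using c e True by (metis less_Suc_eq)
  qed
  have y: "y k j \<in> M3 k" if "k < n" "j \<in> {1, 2, 3}" for k j using True that by (meson less_SucI)
  have yn: "y n j \<in> M3 n" if "j \<in> {1, 2, 3}" for j using True that by (meson lessI)
  let ?J = "join n (\<lambda>c. y n (Suc c)) b'"
  have J: "dec (Suc n) x y (r, s) = ?J $$ (r, s)"
    if rs: "r < 3 ^ Suc (Suc n)" "s < 3 ^ Suc (Suc n)" for r s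
  proof -
    have "b' $$ (r div 3, s div 3) = dec n x y (r div 3, s div 3)"
      using div_bound[OF rs(1)] div_bound[OF rs(2)] by (simp add: b'_def)
    moreover have "dec (Suc n) x y (r, s) = (if r mod 3 = 1 \<and> s mod 3 = 1 then dec n x y (r div 3, s div 3) else 0)
        + (\<Sum>j\<in>{1,2,3}. (y n j \<otimes>\<^sub>K \<beta> 1 j) $$ (r, s))"
      by (rule dec_Suc[OF _ rs]) (rule y)
    moreover have "(if R = 1 \<and> S = 1 then d else 0) + (if R = S \<and> R \<noteq> 1 \<and> Q then g else 0) =
        (if R = S then if R = 1 then d else if Q then g else 0 else 0)" for R S :: nat and d g :: complex and Q
      by auto
    ultimately show ?thesis
      by (simp only: \<beta>_1_sum[OF yn rs] join_entry[OF rs])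
  qed
  have "b = ?J" if "b \<in> M3 (Suc (Suc n))" "\<forall>r<3 ^ Suc (Suc n). \<forall>s<3 ^ Suc (Suc n). b $$ (r, s) = dec (Suc n) x y (r, s)"
    by (rule M3_eqI[OF that(1) join_carrier]) (simp only: that(2) J)
  then have "decomposes (Suc n) b x y \<longleftrightarrow> b = ?J"
    unfolding decomposes_iff using True join_carrier[of n _ b'] J by metis
  then show ?thesis using b' yn by metis
next
  case False
  then show ?thesis unfolding decomposes_iff by (auto simp: less_Suc_eq)
qed

lemma decomposes_0:
  "decomposes 0 b x y \<longleftrightarrow> b = dsum 0 (\<lambda>c. mat 1 1 (\<lambda>_. x (Suc c)))"
proof -
  have "dec 0 x y (r, s) = dsum 0 (\<lambda>c. mat 1 1 (\<lambda>_. x (Suc c))) $$ (r, s)" if "r < 3" "s < 3" for r s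
    using that[THEN less_3_cases] by (auto simp: dec_def \<alpha>_0 e_def dsum_entry numeral_3_eq_3[symmetric] numeral_2_eq_2)
  then show ?thesis
    unfolding decomposes_iff using dsum_carrier[of 0] by (auto intro!: eq_matI)
qed

lemma Aset_decomposes: "b \<in> Aset n \<Longrightarrow> \<exists>x y. decomposes n b x y"
proof (induction n arbitrary: b)
  case 0
  then obtain z where z: "b = dsum 0 z" "\<forall>c<3. z c \<in> M3 0" by auto
  have "z c = mat 1 1 (\<lambda>_. z (Suc c - 1) $$ (0, 0))" if "c < 3" for c
    by (rule eq_matI) (use z that in auto)
  then have "b = dsum 0 (\<lambda>c. mat 1 1 (\<lambda>_. z (Suc c - 1) $$ (0, 0)))"
    unfolding z(1) by (rule dsum_cong)
  then show ?case unfolding decomposes_0 by - (rule exI[of _ "\<lambda>i. z (i - 1) $$ (0, 0)"], simp)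
next
  case (Suc n)
  then obtain y b' where y: "b = join n y b'" "\<forall>c<3. y c \<in> M3 n" "b' \<in> Aset n" by auto
  obtain x0 y0 where d: "decomposes n b' x0 y0" using Suc.IH y by blast
  \<comment> \<open>The decomposition of \<open>b'\<close> at level \<open>n\<close> reads only
    coefficients with index below \<open>n\<close>, so slot \<open>n\<close> may be
    overwritten.\<close>
  define y1 where "y1 = y0(n := \<lambda>j. y (j - 1))"
  have "dec n x0 y1 p = dec n x0 y0 p" for p
    unfolding dec_def by (intro arg_cong2[of _ _ _ _ "(+)"] refl sum.cong) (auto simp: y1_def)
  moreover have "y1 k = y0 k" if "k < n" for k using that by (simp add: y1_def)
  ultimately have "decomposes n b' x0 y1"
    using d unfolding decomposes_iff by metis
  moreover have "y1 n (Suc c) = y c" for c by (simp add: y1_def)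
  then have "b = join n (\<lambda>c. y1 n (Suc c)) b'" by (simp only: y)
  moreover have "\<forall>j\<in>{1, 2, 3}. y1 n j \<in> M3 n" using y(2) by (auto simp: y1_def)
  ultimately have "decomposes (Suc n) b x0 y1" unfolding decomposes_Suc by (intro exI[of _ b'] conjI)
  then show ?case by blast
qed

lemma \<alpha>_in_Aset: "j \<in> {1, 2, 3} \<Longrightarrow> \<alpha> n j \<in> Aset n"
proof (induction n)
  case 0
  define z where "z c = (if Suc c = j then 1\<^sub>m 1 else 0\<^sub>m 1 1 :: complex mat)" for c
  have "\<alpha> 0 j = dsum 0 z"
    unfolding \<alpha>_0
  proof (rule dsum_eqI)
    fix r s :: nat assume "r < 3 ^ Suc 0" "s < 3 ^ Suc 0"
    then have rs: "r < 3" "s < 3" by simp_all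
    then have "(c + 1) mod 3 = j mod 3 \<longleftrightarrow> Suc c = j" if "c < 3" for c
      using less_3_cases[OF that] 0 by (elim disjE; auto)
    then have "e j j $$ (r, s) = (if Suc r = j \<and> Suc s = j then 1 else 0)"
      using rs unfolding e_def by simp
    also have "\<dots> = (if r mod 3 = s mod 3 then z (r mod 3) $$ (r div 3, s div 3) else 0)"
      using rs by (auto simp: z_def)
    finally show "e j j $$ (r, s) = (if r mod 3 = s mod 3 then z (r mod 3) $$ (r div 3, s div 3) else 0)" .
  qed simp
  moreover have "\<forall>c<3. z c \<in> M3 0" by (simp add: z_def)
  ultimately show ?case unfolding Aset.simps by blast
next
  case (Suc n)
  then show ?case
    unfolding \<alpha>_Suc by (subst kron_e22_join[OF \<alpha>_carrier]) (rule join_in_Aset, auto)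
qed

lemma kron_\<beta>_in_Aset:
  assumes "j \<in> {1, 2, 3}"
  shows "x \<in> M3 k \<Longrightarrow> x \<otimes>\<^sub>K \<beta> (Suc m) j \<in> Aset (Suc (k + m))"
proof (induction m)
  case 0
  define y where "y i = (if i = j then x else 0\<^sub>m (3 ^ k) (3 ^ k))" for i
  define w where "w = join k (\<lambda>c. y (Suc c)) (0\<^sub>m (3 ^ Suc k) (3 ^ Suc k))"
  have "x \<otimes>\<^sub>K \<beta> 1 j = w"
  proof (rule eq_matI)
    have x\<beta>: "x \<otimes>\<^sub>K \<beta> 1 j \<in> M3 (Suc (Suc k))" using kron_\<beta>_carrier[OF 0, of "Suc k" j] by simp
    then show "dim_row (x \<otimes>\<^sub>K \<beta> 1 j) = dim_row w" "dim_col (x \<otimes>\<^sub>K \<beta> 1 j) = dim_col w"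
      using carrier_matD[OF join_carrier[of k "\<lambda>c. y (Suc c)" "0\<^sub>m (3 ^ Suc k) (3 ^ Suc k)"]]
      unfolding w_def by auto
    fix r s assume "r < dim_row w" "s < dim_col w"
    then have rs: "r < 3 ^ Suc (Suc k)" "s < 3 ^ Suc (Suc k)"
      using carrier_matD[OF join_carrier] unfolding w_def by metis+
    note db = div_bound[OF rs(1)] div_bound[OF rs(2)]
    have "(x \<otimes>\<^sub>K \<beta> 1 j) $$ (r, s) = (\<Sum>i\<in>{1,2,3}. if i = j then (x \<otimes>\<^sub>K \<beta> 1 j) $$ (r, s) else 0)"
      using assms by auto
    also have "\<dots> = (\<Sum>i\<in>{1,2,3}. (y i \<otimes>\<^sub>K \<beta> 1 i) $$ (r, s))"
    proof (rule sum.cong)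
      fix i :: nat assume i: "i \<in> {1, 2, 3}"
      have "(0\<^sub>m (3 ^ k) (3 ^ k) \<otimes>\<^sub>K \<beta> 1 i) $$ (r, s) = 0"
        using div_bound[OF db(1)] div_bound[OF db(2)]
        by (simp only: kron_\<beta>_1[OF zero_carrier_mat rs i] index_zero_mat if_cancel)
      then show "(if i = j then (x \<otimes>\<^sub>K \<beta> 1 j) $$ (r, s) else 0) = (y i \<otimes>\<^sub>K \<beta> 1 i) $$ (r, s)"
        by (simp add: y_def)
    qed simp
    also have "\<dots> = w $$ (r, s)"
      unfolding w_def using 0 db
      by (subst \<beta>_1_sum[OF _ rs], simp add: y_def, subst join_entry[OF rs]) (auto simp del: power_Suc)
    finally show "(x \<otimes>\<^sub>K \<beta> 1 j) $$ (r, s) = w $$ (r, s)" .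
  qed
  moreover have "w \<in> Aset (Suc k)"
    unfolding w_def by (rule join_in_Aset) (use 0 in \<open>auto simp: y_def Aset_zero[unfolded power_Suc]\<close>)
  ultimately show ?case by simp
next
  case (Suc m)
  have *: "x \<otimes>\<^sub>K \<beta> (Suc m) j \<in> Aset (Suc (k + m))" using Suc by blast
  have "join (Suc (k + m)) (\<lambda>_. 0\<^sub>m (3 ^ Suc (k + m)) (3 ^ Suc (k + m))) (x \<otimes>\<^sub>K \<beta> (Suc m) j) \<in> Aset (Suc (Suc (k + m)))"
    by (rule join_in_Aset[OF _ *]) (rule zero_carrier_mat)
  then show ?case
    unfolding \<beta>_Suc_Suc kron_assoc[symmetric] kron_e22_join[OF Aset_carrier[OF *]] add_Suc_right .
qed

text \<open>One inclusion holds because \<open>Aset n\<close> is a submodule containing the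
  generators, the other because a decomposition exhibits an element as a combination of
  generators.\<close>

lemma \<A>_eq_Aset: "\<A> n = Aset n"
proof
  let ?V = "M3_space (Suc n)"
  let ?S = "{\<alpha> n j | j. j \<in> {1, 2, 3}} \<union> {x \<otimes>\<^sub>K \<beta> k j | x k j. j \<in> {1, 2, 3} \<and> k \<in> {1..n} \<and> x \<in> M3 (n - k)}"
  interpret V: vectorspace class_ring ?V by (rule matrix_vs)
  have gen: "?S \<subseteq> Aset n"
  proof -
    have "x \<otimes>\<^sub>K \<beta> k j \<in> Aset n" if "j \<in> {1, 2, 3}" "k \<in> {1..n}" "x \<in> M3 (n - k)" for x k j
    proof -
      have "Suc (n - k + (k - 1)) = n" "Suc (k - 1) = k" using that(2) by auto
      then show ?thesis using kron_\<beta>_in_Aset[OF that(1,3), of "k - 1"] by metis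
    qed
    then show ?thesis using \<alpha>_in_Aset by blast
  qed
  then have S: "?S \<subseteq> carrier ?V" using Aset_carrier unfolding module_mat_simps by blast
  have sub: "submodule class_ring (Aset n) ?V"
    unfolding submodule_def using V.module_axioms Aset_carrier Aset_zero
    by (auto simp: module_mat_simps Aset_add Aset_smult)
  show "\<A> n \<subseteq> Aset n"
    unfolding \<A>_def Suc_eq_plus1[symmetric] using V.span_is_subset[OF gen sub] .
  interpret sp: submodule class_ring "\<A> n" ?V
    unfolding \<A>_def Suc_eq_plus1[symmetric] using V.span_is_submodule[OF S] .
  have inS: "?S \<subseteq> \<A> n"
    unfolding \<A>_def Suc_eq_plus1[symmetric] using V.in_own_span[OF S] .
  have fin: "finsum ?V f I \<in> \<A> n" if "finite I" "\<And>i. i \<in> I \<Longrightarrow> f i \<in> \<A> n" for f :: "nat \<Rightarrow> complex mat" and I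
    using that
  proof (induction I rule: finite_induct)
    case empty
    then show ?case using sp.zero_closed by (simp only: V.finsum_empty)
  next
    case (insert i I)
    have c: "f \<in> I \<rightarrow> carrier ?V" "f i \<in> carrier ?V" using insert sp.subset by auto
    have "finsum ?V f (insert i I) = f i \<oplus>\<^bsub>?V\<^esub> finsum ?V f I"
      by (rule V.finsum_insert[OF insert(1,2) c])
    then show ?case using insert sp.m_closed by (simp del: module_mat_simps)
  qed
  show "Aset n \<subseteq> \<A> n"
  proof
    fix b assume "b \<in> Aset n"
    then obtain x y where d: "\<forall>k<n. \<forall>j\<in>{1, 2, 3}. y k j \<in> M3 k"
      and b: "b = (\<Oplus>\<^bsub>?V\<^esub> j\<in>{1, 2, 3}. x j \<cdot>\<^sub>m \<alpha> n j) +
         (\<Oplus>\<^bsub>?V\<^esub> k\<in>{..<n}. \<Oplus>\<^bsub>?V\<^esub> j\<in>{1, 2, 3}. y k j \<otimes>\<^sub>K \<beta> (n - k) j)"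
      using Aset_decomposes unfolding decomposes_def Suc_eq_plus1[symmetric] by blast
    have 1: "x j \<cdot>\<^sub>m \<alpha> n j \<in> \<A> n" if "j \<in> {1, 2, 3}" for j
      using sp.smult_closed[of "x j" "\<alpha> n j"] inS that by (auto simp: module_mat_simps)
    have 2: "y k j \<otimes>\<^sub>K \<beta> (n - k) j \<in> \<A> n" if "k < n" "j \<in> {1, 2, 3}" for k j
    proof -
      have "n - k \<in> {1..n}" "y k j \<in> M3 (n - (n - k))" using that d by auto
      then show ?thesis using inS that(2) by blast
    qed
    have "(\<Oplus>\<^bsub>?V\<^esub> j\<in>{1, 2, 3}. x j \<cdot>\<^sub>m \<alpha> n j) \<in> \<A> n"
      "(\<Oplus>\<^bsub>?V\<^esub> k\<in>{..<n}. \<Oplus>\<^bsub>?V\<^esub> j\<in>{1, 2, 3}. y k j \<otimes>\<^sub>K \<beta> (n - k) j) \<in> \<A> n"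
      by (intro fin 1 2; simp)+
    then show "b \<in> \<A> n"
      using sp.m_closed unfolding b by (simp add: module_mat_simps)
  qed
qed

lemma \<xi>_0:
  assumes "b \<in> Aset 0" "j \<in> {1, 2, 3}"
  shows "\<xi> 0 j b = cut (j - 1) b $$ (0, 0)"
proof -
  have "x j = cut (j - 1) b $$ (0, 0)" if "decomposes 0 b x y" for x y
  proof -
    have "cut (j - 1) b = mat 1 1 (\<lambda>_. x j)"
      using that assms(2) unfolding decomposes_0 by (auto simp: cut_dsum numeral_2_eq_2 numeral_3_eq_3)
    then show ?thesis by simp
  qed
  then show ?thesis
    unfolding \<xi>_def using Aset_decomposes[OF assms(1)] by (intro the_equality; metis)
qed

text \<open>Only the newest coefficients enter the theorem. They are determined by \<open>b\<close>,
  as outer block 0 is exactly their block sum.\<close>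

lemma \<eta>_Suc:
  assumes "b \<in> Aset (Suc n)" "j \<in> {1, 2, 3}"
  shows "\<eta> (Suc n) n j b = cut (j - 1) (cut 0 b)"
proof -
  have "y n j = cut (j - 1) (cut 0 b)" if d: "decomposes (Suc n) b x y" for x y
  proof -
    obtain b' where b': "decomposes n b' x y" "\<forall>j\<in>{1, 2, 3}. y n j \<in> M3 n" "b = join n (\<lambda>c. y n (Suc c)) b'"
      using d unfolding decomposes_Suc by metis
    have "b' \<in> M3 (Suc n)" using b'(1) unfolding decomposes_iff by blast
    moreover have "Suc (j - 1) = j" "j - 1 < 3" using assms(2) by auto
    ultimately show ?thesis
      using b'(2) assms(2) cut_dsum[of "j - 1" "\<lambda>c. y n (Suc c)" n] unfolding b'(3) by (metis cut_join(2))
  qed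
  then show ?thesis
    unfolding \<eta>_def using Aset_decomposes[OF assms(1)] by (intro the_equality; metis)
qed

section \<open>Elementary facts on C*-algebras\<close>

lemma scaleC_one [simp]: "1 *\<^sub>C x = (x :: 'u :: unital_cstar_algebra)"
  using scaleC_of_real[of 1 x] by simp

lemma scaleC_zero_left [simp]: "0 *\<^sub>C x = (0 :: 'u :: unital_cstar_algebra)"
  using scaleC_of_real[of 0 x] by simp

lemma scaleC_zero_right [simp]: "c *\<^sub>C 0 = (0 :: 'u :: unital_cstar_algebra)"
  using scaleC_add_right[of c 0 0] by simp

lemma scaleC_minus1: "(-1) *\<^sub>C x = - (x :: 'u :: unital_cstar_algebra)"
  using scaleC_of_real[of "-1" x] by simp

lemma star_zero [simp]: "star 0 = (0 :: 'u :: unital_cstar_algebra)"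
  using star_add[of 0 0] by simp

lemma star_scaleR: "star (r *\<^sub>R x) = r *\<^sub>R star (x :: 'u :: unital_cstar_algebra)"
  by (metis complex_cnj_complex_of_real scaleC_of_real star_scaleC)

lemma star_one [simp]: "star 1 = (1 :: 'u :: unital_cstar_algebra)"
  by (metis mult_1_left mult_1_right star_mult star_star)

lemma star_power: "star (x ^ n) = star (x :: 'u :: unital_cstar_algebra) ^ n"
  by (induction n) (simp_all add: star_mult power_commutes)

lemma norm_star [simp]: "norm (star x) = norm (x :: 'u :: unital_cstar_algebra)"
proof -
  have *: "norm x \<le> norm (star x)" for x :: 'u
  proof (cases "x = 0")
    case False
    have "norm x * norm x \<le> norm (star x) * norm x"
      using cstar_identity[of x] norm_mult_ineq[of "star x" x] by (simp add: power2_eq_square)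
    then show ?thesis using False by simp
  qed simp
  from *[of x] *[of "star x"] show ?thesis by (simp add: star_star)
qed

text \<open>Iterated C*-identity. Together with \<open>power_domination\<close> it turns norm bounds
  with an arbitrary constant into sharp ones, as the spectral radius formula would.\<close>

lemma norm_selfadjoint_power:
  fixes h :: "'u :: unital_cstar_algebra"
  assumes "star h = h"
  shows "norm (h ^ (2 ^ k)) = norm h ^ (2 ^ k)"
proof (induction k)
  case (Suc k)
  have "star (h ^ (2 ^ k)) = h ^ (2 ^ k)" by (simp add: star_power assms)
  then have "norm (h ^ (2 ^ k) * h ^ (2 ^ k)) = (norm h ^ (2 ^ k))\<^sup>2"
    using cstar_identity[of "h ^ (2 ^ k)"] Suc by simp
  then show ?case by (simp add: power_add[symmetric] mult_2 power_mult[symmetric] mult.commute)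
qed simp

lemma norm_projection_le:
  fixes p :: "'u :: unital_cstar_algebra"
  assumes "star p = p" "p * p = p"
  shows "norm p \<le> 1"
proof -
  have "norm p * norm p = norm p" using cstar_identity[of p] assms by (simp add: power2_eq_square)
  then show ?thesis by auto
qed

lemma bounded_linear_star: "bounded_linear (star :: 'u :: unital_cstar_algebra \<Rightarrow> 'u)"
  by (rule bounded_linear_intro[where K = 1]) (simp_all add: star_add star_scaleR)

lemmas tendsto_star = bounded_linear.tendsto[OF bounded_linear_star]

lemma bounded_linear_scaleC: "bounded_linear ((*\<^sub>C) c :: 'u :: unital_cstar_algebra \<Rightarrow> 'u)"
  by (rule bounded_linear_intro[where K = "cmod c"])
     (simp_all add: scaleC_add_right norm_scaleC scaleC_of_real[symmetric] scaleC_scaleC mult.commute)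

lemmas tendsto_scaleC = bounded_linear.tendsto[OF bounded_linear_scaleC]

text \<open>The square root of \<open>1 - h\<close> is given by the binomial series.\<close>

lemma selfadjoint_sqrt:
  fixes h :: "'u :: unital_cstar_algebra"
  assumes h: "star h = h" "norm h < 1"
    and D: "closed D" "1 \<in> D" "\<And>x y. x \<in> D \<Longrightarrow> y \<in> D \<Longrightarrow> x + y \<in> D"
      "\<And>r x. x \<in> D \<Longrightarrow> r *\<^sub>R x \<in> D" "\<And>x. x \<in> D \<Longrightarrow> h * x \<in> D"
  obtains s where "s \<in> D" "star s = s" "s * s = 1 - h"
proof -
  define c where "c n = ((1 / 2 :: real) gchoose n) * (- 1) ^ n" for n
  define s where "s = (\<Sum>n. c n *\<^sub>R h ^ n)"
  \<comment> \<open>The binomial series converges at the real point \<open>r\<close>, hence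
    absolutely at the smaller point \<open>norm h\<close>.\<close>
  obtain r where r: "norm h < r" "r < 1" using h(2) dense by blast
  have "summable (\<lambda>n. ((1 / 2 :: real) gchoose n) * r ^ n)"
    using gen_binomial_real[of r "1 / 2"] r norm_ge_zero[of h] by (auto simp: sums_iff)
  then have "summable (\<lambda>n. norm (((1 / 2 :: real) gchoose n) * norm h ^ n))"
    by (rule powser_insidea) (use r norm_ge_zero[of h] in auto)
  then have sn: "summable (\<lambda>n. norm (c n *\<^sub>R h ^ n))"
  proof (rule summable_comparison_test')
    fix n
    show "norm (norm (c n *\<^sub>R h ^ n)) \<le> norm (((1 / 2 :: real) gchoose n) * norm h ^ n)"
      by (auto simp: c_def abs_mult power_abs intro!: mult_left_mono norm_power_ineq)
  qed
  then have sm: "summable (\<lambda>n. c n *\<^sub>R h ^ n)" by (rule summable_norm_cancel)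
  have conv: "(\<lambda>N. \<Sum>n<N. c n *\<^sub>R h ^ n) \<longlonglongrightarrow> s" unfolding s_def by (rule summable_LIMSEQ[OF sm])
  \<comment> \<open>The powers of \<open>h\<close> stay in \<open>D\<close>, so do the partial sums,
    and closedness puts the square root into \<open>D\<close>. Later \<open>D\<close> is an
    idealizer, and this locates the root there.\<close>
  have pw: "h ^ n \<in> D" for n by (induction n) (auto intro: D)
  have "0 *\<^sub>R 1 \<in> D" using D by blast
  then have "(\<Sum>n<N. c n *\<^sub>R h ^ n) \<in> D" for N
    by (induction N) (auto intro: D pw)
  then have 1: "s \<in> D" by (rule closed_sequentially[OF D(1) _ conv])
  have "star (\<Sum>n<N. c n *\<^sub>R h ^ n) = (\<Sum>n<N. c n *\<^sub>R h ^ n)" for N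
    by (induction N) (auto simp: star_add star_scaleR star_power h)
  then have 2: "star s = s" using tendsto_star[OF conv] conv LIMSEQ_unique by auto
  \<comment> \<open>Vandermonde's identity: the square of the series with exponent 1/2 is the series
    with exponent 1, whose coefficients vanish from degree 2 on.\<close>
  have "(\<Sum>i\<le>k. (c i *\<^sub>R h ^ i) * (c (k - i) *\<^sub>R h ^ (k - i))) = (if k = 0 then 1 else if k = 1 then - h else 0)" for k
  proof -
    have "(\<Sum>i\<le>k. (c i *\<^sub>R h ^ i) * (c (k - i) *\<^sub>R h ^ (k - i))) = (\<Sum>i\<le>k. (c i * c (k - i)) *\<^sub>R h ^ k)"
      by (rule sum.cong) (auto simp: power_add[symmetric])
    also have "\<dots> = (\<Sum>i\<le>k. c i * c (k - i)) *\<^sub>R h ^ k" by (simp add: scaleR_sum_left)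
    also have "(\<Sum>i\<le>k. c i * c (k - i)) = (\<Sum>i\<le>k. ((1 / 2) gchoose i) * ((1 / 2) gchoose (k - i)) * (- 1) ^ k)"
      by (rule sum.cong) (auto simp: c_def power_add[symmetric] algebra_simps)
    also have "\<dots> = ((1 :: real) gchoose k) * (- 1) ^ k"
      using gbinomial_Vandermonde[of "1 / 2 :: real" "1 / 2" k] by (simp add: sum_distrib_right[symmetric] atLeast0AtMost)
    also have "(1 :: real) gchoose k = of_nat (1 choose k)" by (simp add: binomial_gbinomial)
    finally show ?thesis by (cases k; cases "k - 1") (auto simp: binomial_eq_0)
  qed
  then have "(\<lambda>k. if k = 0 then 1 else if k = 1 then - h else 0) sums (s * s)"
    using Cauchy_product_sums[OF sn sn] unfolding s_def by simp
  moreover have "(\<lambda>k. if k = 0 then 1 else if k = 1 then - h else 0) sums (\<Sum>k\<in>{0, 1 :: nat}. if k = 0 then 1 else if k = 1 then - h else 0)"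
    by (rule sums_finite) auto
  ultimately have "s * s = 1 - h" by (auto dest: sums_unique2)
  with 1 2 that show ?thesis by blast
qed

lemma tendsto_of_diff:
  fixes l :: "'a :: real_normed_vector"
  assumes "(\<lambda>k. l - f k) \<longlonglongrightarrow> 0"
  shows "f \<longlonglongrightarrow> l"
  using tendsto_diff[OF tendsto_const[of l] assms] by simp

section \<open>Infinite words over three letters\<close>

typedef digits = "{w :: nat \<Rightarrow> nat. \<forall>i. w i < 3}" morphisms dig Abs_digits
  by (rule exI[of _ "\<lambda>_. 0"]) simp

setup_lifting type_definition_digits

lemma dig_less [simp]: "dig w i < 3"
  using dig by blast

lemma digits_eqI: "(\<And>i. dig w i = dig w' i) \<Longrightarrow> w = w'"
  by transfer auto

lift_definition upd :: "digits \<Rightarrow> nat \<Rightarrow> nat \<Rightarrow> digits" is "\<lambda>w n c i. if i = n then c mod 3 else w i"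
  by auto

lift_definition constw :: "nat \<Rightarrow> digits" is "\<lambda>c i. c mod 3"
  by auto

lemma dig_upd: "dig (upd w n c) i = (if i = n then c mod 3 else dig w i)"
  by transfer simp

lemma dig_constw: "c < 3 \<Longrightarrow> dig (constw c) i = c"
  by transfer simp

text \<open>The row index of the prefix of length \<open>n\<close>, earliest letter leading, in
  agreement with the order of Kronecker factors.\<close>

primrec pre :: "digits \<Rightarrow> nat \<Rightarrow> nat" where
  "pre w 0 = 0"
| "pre w (Suc n) = 3 * pre w n + dig w n"

text \<open>Writes the base 3 digits of \<open>s\<close> over the first \<open>n\<close> letters and
  keeps the tail. For \<open>s < 3 ^ n\<close> it enumerates the words sharing the tail of
  \<open>w\<close>.\<close>

primrec rep :: "nat \<Rightarrow> nat \<Rightarrow> digits \<Rightarrow> digits" where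
  "rep 0 s w = w"
| "rep (Suc n) s w = rep n (s div 3) (upd w n (s mod 3))"

lemma pre_less: "pre w n < 3 ^ n"
proof (induction n)
  case (Suc n)
  then show ?case using dig_less[of w n] by (simp del: dig_less)
qed simp

lemma dig_rep: "n \<le> i \<Longrightarrow> dig (rep n s w) i = dig w i"
  by (induction n arbitrary: s w) (auto simp: dig_upd)

lemma pre_rep: "s < 3 ^ n \<Longrightarrow> pre (rep n s w) n = s"
proof (induction n arbitrary: s w)
  case (Suc n)
  then have "pre (rep n (s div 3) (upd w n (s mod 3))) n = s div 3" by (intro Suc.IH) auto
  then show ?case by (simp add: dig_rep dig_upd)
qed simp

lemma rep_cong: "(\<And>i. n \<le> i \<Longrightarrow> dig w i = dig w' i) \<Longrightarrow> rep n s w = rep n s w'"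
proof (induction n arbitrary: s w w')
  case (Suc n)
  then show ?case by (auto simp: dig_upd intro!: Suc.IH)
qed (auto intro: digits_eqI)

lemma rep_rep [simp]: "rep n s (rep n t w) = rep n s w"
  by (rule rep_cong) (simp add: dig_rep)

lemma upd_dig [simp]: "upd w n (dig w n) = w"
  by (rule digits_eqI) (simp add: dig_upd)

lemma rep_pre [simp]: "rep n (pre w n) w = w"
  by (induction n) auto

lemma rep_Suc_digit: "c < 3 \<Longrightarrow> rep (Suc n) (3 * s + c) w = rep n s (upd w n c)"
  by simp

lemma rep_eq_iff:
  assumes "s < 3 ^ n"
  shows "rep n s w = w' \<longleftrightarrow> s = pre w' n \<and> (\<forall>i\<ge>n. dig w i = dig w' i)"
proof
  assume *: "s = pre w' n \<and> (\<forall>i\<ge>n. dig w i = dig w' i)"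
  then have "rep n s w = rep n s w'" by (intro rep_cong) auto
  with * show "rep n s w = w'" by simp
qed (use assms in \<open>auto simp: pre_rep dig_rep\<close>)

section \<open>The action of the UHF algebra on square summable functions of infinite words\<close>

definition opf :: "nat \<Rightarrow> complex mat \<Rightarrow> digits ell2 \<Rightarrow> digits \<Rightarrow> complex" where
  "opf n x v w = (\<Sum>s<3 ^ n. x $$ (pre w n, s) * ell2_fun v (rep n s w))"

definition op :: "nat \<Rightarrow> complex mat \<Rightarrow> digits ell2 \<Rightarrow> digits ell2" where
  "op n x v = Abs_ell2 (opf n x v)"

text \<open>The letter at position \<open>n\<close> is the last tensor digit at level
  \<open>n + 1\<close>. A block diagonal matrix preserves it, and it selects the block that
  acts.\<close>

lemma opf_dsum:
  assumes "\<And>c. c < 3 \<Longrightarrow> z c \<in> M3 n"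
  shows "opf (Suc n) (dsum n z) v w = opf n (z (dig w n)) v w"
proof -
  let ?c = "dig w n"
  define f where "f q = (if q < 3 ^ Suc n then dsum n z $$ (pre w (Suc n), q) * ell2_fun v (rep (Suc n) q w) else 0)" for q
  have p: "pre w (Suc n) < 3 ^ Suc n" by (rule pre_less)
  have pm: "pre w (Suc n) mod 3 = ?c" "pre w (Suc n) div 3 = pre w n" by simp_all
  have "opf (Suc n) (dsum n z) v w = (\<Sum>q<3 * 3 ^ n. f q)"
    unfolding opf_def by (rule sum.cong) (auto simp: f_def)
  also have "\<dots> = (\<Sum>s<3 ^ n. f (3 * s + ?c))"
    by (rule sum_residue_class) (use p in \<open>auto simp: f_def dsum_entry pm simp del: pre.simps\<close>)
  also have "\<dots> = (\<Sum>s<3 ^ n. z ?c $$ (pre w n, s) * ell2_fun v (rep n s w))"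
  proof (rule sum.cong)
    fix s assume "s \<in> {..<(3 :: nat) ^ n}"
    then have b: "3 * s + ?c < 3 ^ Suc n" by (intro digit_bound) auto
    have "dsum n z $$ (pre w (Suc n), 3 * s + ?c) = z ?c $$ (pre w n, s)"
      unfolding dsum_entry[OF p b] pm by simp
    then show "f (3 * s + ?c) = z ?c $$ (pre w n, s) * ell2_fun v (rep n s w)"
      using b by (simp add: f_def rep_Suc_digit del: rep.simps)
  qed simp
  finally show ?thesis unfolding opf_def .
qed

lemma opf_mult:
  assumes "x \<in> M3 n" "y \<in> M3 n" and u: "\<And>w. ell2_fun u w = opf n y v w"
  shows "opf n x u w = opf n (x * y) v w"
proof -
  have "opf n x u w = (\<Sum>s<3 ^ n. \<Sum>t<3 ^ n. x $$ (pre w n, s) * y $$ (s, t) * ell2_fun v (rep n t w))"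
    unfolding opf_def u by (rule sum.cong) (auto simp: sum_distrib_left pre_rep mult.assoc)
  also have "\<dots> = (\<Sum>t<3 ^ n. \<Sum>s<3 ^ n. x $$ (pre w n, s) * y $$ (s, t) * ell2_fun v (rep n t w))"
    by (rule sum.swap)
  also have "\<dots> = opf n (x * y) v w"
    unfolding opf_def
    by (rule sum.cong) (auto simp: mat_mult_entry[OF assms(1,2) pre_less] sum_distrib_right)
  finally show ?thesis .
qed

lemma opf_basis_vec:
  "opf n x (basis_vec w') w = (if \<forall>i\<ge>n. dig w i = dig w' i then x $$ (pre w n, pre w' n) else 0)"
proof -
  have "opf n x (basis_vec w') w = (\<Sum>s<3 ^ n. if s = pre w' n then
      (if \<forall>i\<ge>n. dig w i = dig w' i then x $$ (pre w n, pre w' n) else 0) else 0)"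
    unfolding opf_def by (rule sum.cong) (auto simp: basis_vec_fun rep_eq_iff)
  then show ?thesis using pre_less[of w' n] by simp
qed

text \<open>The matrix bound holds for each tail separately and adds up over tails. The free
  constant \<open>M\<close> makes the lemma applicable both to matrices and to slices of arbitrary
  elements.\<close>

lemma op_bound:
  assumes "0 \<le> M" and M: "\<And>v. (\<Sum>r<3 ^ n. (cmod (\<Sum>s<3 ^ n. x $$ (r, s) * v s))\<^sup>2) \<le> M\<^sup>2 * (\<Sum>s<3 ^ n. (cmod (v s))\<^sup>2)"
  obtains u where "op n x v = u" "\<And>w. ell2_fun u w = opf n x v w" "norm u \<le> M * norm v"
proof -
  let ?N = "(3 :: nat) ^ n"
  have "(\<Sum>w\<in>F. (cmod (opf n x v w))\<^sup>2) \<le> (M * norm v)\<^sup>2" if F: "finite F" for F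
  proof -
    \<comment> \<open>\<open>W\<close> has one representative for each tail occurring in
      \<open>F\<close>, and \<open>F'\<close> is the saturation of \<open>F\<close> under changes of
      the first \<open>n\<close> letters. On each tail \<open>opf\<close> is a matrix times a vector
      of length \<open>3 ^ n\<close>.\<close>
    define W where "W = rep n 0 ` F"
    define F' where "F' = (\<lambda>(w, r). rep n r w) ` (W \<times> {..<?N})"
    have W: "finite W" unfolding W_def using F by simp
    have fin: "finite F'" unfolding F'_def using W by simp
    have fixed: "rep n 0 w = w" if "w \<in> W" for w using that unfolding W_def by auto
    have inj: "inj_on (\<lambda>(w, r). rep n r w) (W \<times> {..<?N})"
    proof (rule inj_onI, clarify)
      fix w r w' r' assume *: "w \<in> W" "w' \<in> W" "r < ?N" "r' < ?N" "rep n r w = rep n r' w'"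
      then have "r = r'" by (metis pre_rep)
      moreover have "w = w'" using * fixed by (metis rep_rep)
      ultimately show "w = w' \<and> r = r'" by simp
    qed
    have "F \<subseteq> F'"
    proof
      fix w assume "w \<in> F"
      then have "w = (\<lambda>(w, r). rep n r w) (rep n 0 w, pre w n)" "(rep n 0 w, pre w n) \<in> W \<times> {..<?N}"
        by (auto simp: W_def pre_less)
      then show "w \<in> F'" unfolding F'_def by (rule image_eqI)
    qed
    then have "(\<Sum>w\<in>F. (cmod (opf n x v w))\<^sup>2) \<le> (\<Sum>w\<in>F'. (cmod (opf n x v w))\<^sup>2)"
      by (intro sum_mono2 fin) auto
    also have "\<dots> = (\<Sum>w\<in>W. \<Sum>r<?N. (cmod (opf n x v (rep n r w)))\<^sup>2)"
      unfolding F'_def by (subst sum.reindex[OF inj]) (simp add: sum.cartesian_product o_def split_def)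
    also have "\<dots> \<le> (\<Sum>w\<in>W. M\<^sup>2 * (\<Sum>r<?N. (cmod (ell2_fun v (rep n r w)))\<^sup>2))"
      by (rule sum_mono) (use M[of "\<lambda>s. ell2_fun v (rep n s _)"] in \<open>simp add: opf_def pre_rep\<close>)
    also have "\<dots> = M\<^sup>2 * (\<Sum>w\<in>F'. (cmod (ell2_fun v w))\<^sup>2)"
      unfolding F'_def by (subst sum.reindex[OF inj]) (simp add: sum.cartesian_product o_def split_def sum_distrib_left)
    also have "\<dots> \<le> M\<^sup>2 * (norm v)\<^sup>2"
      by (intro mult_left_mono ell2_norm_sum_le fin) auto
    finally show ?thesis by (simp add: power_mult_distrib)
  qed
  then obtain u where u: "\<And>w. ell2_fun u w = opf n x v w" "norm u \<le> M * norm v"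
    using ell2_bounded_sums[of "opf n x v" "M * norm v"] assms(1) by (metis mult_nonneg_nonneg norm_ge_zero)
  have "opf n x v = ell2_fun u" using u by auto
  then have "op n x v = u" unfolding op_def by (simp add: ell2_fun_inverse)
  with u that show ?thesis by blast
qed

section \<open>Norm estimates for the matrix action and its continuous extension\<close>

context uhf_three_infty
begin

lemma \<iota>_zero: "\<iota> n (0\<^sub>m (3 ^ n) (3 ^ n)) = 0"
proof -
  have "\<iota> n (0\<^sub>m (3 ^ n) (3 ^ n)) = \<iota> n (0 \<cdot>\<^sub>m 0\<^sub>m (3 ^ n) (3 ^ n))" by simp
  also have "\<dots> = 0" by (subst \<iota>_smult) auto
  finally show ?thesis .
qed

lemma \<iota>_minus: "x \<in> M3 n \<Longrightarrow> y \<in> M3 n \<Longrightarrow> \<iota> n (x + (-1) \<cdot>\<^sub>m y) = \<iota> n x - \<iota> n y"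
  using \<iota>_add[of x n "(-1) \<cdot>\<^sub>m y"] \<iota>_smult[of y n "-1"] by (simp add: scaleC_minus1)

lemma \<iota>_dsum_const: "x \<in> M3 n \<Longrightarrow> \<iota> (Suc n) (dsum n (\<lambda>_. x)) = \<iota> n x"
  using \<iota>_compatible[of x n] by (simp add: kron_one_3)

text \<open>For a matrix with the single column \<open>v\<close>, \<open>mat_adjoint z * z\<close>
  is the squared Euclidean norm of \<open>v\<close> times a nonzero projection. That projection has
  norm 1, so the C*-identity gives the claim.\<close>

lemma first_column_norm:
  assumes "z = mat (3 ^ n) (3 ^ n) (\<lambda>(i, j). if j = 0 then v i else 0)"
  shows "(norm (\<iota> n z))\<^sup>2 = (\<Sum>s<3 ^ n. (cmod (v s))\<^sup>2)"
proof -
  let ?N = "(3 :: nat) ^ n"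
  define E where "E = mat ?N ?N (\<lambda>(i, j). if i = 0 \<and> j = 0 then 1 else (0 :: complex))"
  have E: "E \<in> M3 n" by (simp add: E_def)
  have z: "z \<in> M3 n" by (simp add: assms)
  have EE: "mat_adjoint E = E"
  proof (rule M3_eqI[OF mat_adjoint_carrier[OF E] E])
    fix r s assume rs: "r < ?N" "s < ?N"
    then show "mat_adjoint E $$ (r, s) = E $$ (r, s)"
      unfolding mat_adjoint_entry[OF E rs] by (auto simp: E_def)
  qed
  have E2: "E * E = E"
  proof (rule M3_eqI[OF _ E])
    fix r s assume "r < ?N" "s < ?N"
    then have "(E * E) $$ (r, s) = (\<Sum>k<?N. if k = 0 then E $$ (r, s) else 0)"
      unfolding mat_mult_entry[OF E E \<open>r < ?N\<close> \<open>s < ?N\<close>] by (intro sum.cong) (auto simp: E_def)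
    then show "(E * E) $$ (r, s) = E $$ (r, s)" by simp
  qed (use E in auto)
  have zz: "mat_adjoint z * z = (\<Sum>s<?N. complex_of_real ((cmod (v s))\<^sup>2)) \<cdot>\<^sub>m E"
  proof (rule M3_eqI)
    fix r s assume rs: "r < ?N" "s < ?N"
    then have "(mat_adjoint z * z) $$ (r, s) = (\<Sum>k<?N. if r = 0 \<and> s = 0 then cnj (v k) * v k else 0)"
      unfolding mat_mult_entry[OF mat_adjoint_carrier[OF z] z rs]
      by (intro sum.cong) (auto simp: assms mat_adjoint_entry[of _ ?N ?N])
    then show "(mat_adjoint z * z) $$ (r, s) = ((\<Sum>s<?N. complex_of_real ((cmod (v s))\<^sup>2)) \<cdot>\<^sub>m E) $$ (r, s)"
      using rs by (simp add: E_def complex_norm_square mult.commute del: of_real_power)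
  qed (rule mult_carrier_mat[OF mat_adjoint_carrier[OF z] z], use E in simp)
  have "\<iota> n E \<noteq> \<iota> n (0\<^sub>m ?N ?N)"
  proof
    assume "\<iota> n E = \<iota> n (0\<^sub>m ?N ?N)"
    then have "E = 0\<^sub>m ?N ?N" using \<iota>_inj[of n] E by (auto dest: inj_onD)
    then have "E $$ (0, 0) = 0" by simp
    then show False by (simp add: E_def)
  qed
  then have "norm (\<iota> n E) \<noteq> 0" by (simp add: \<iota>_zero)
  moreover have "(norm (\<iota> n E))\<^sup>2 = norm (\<iota> n E)"
    using cstar_identity[of "\<iota> n E"] \<iota>_adjoint[OF E] \<iota>_mult[OF E E] EE E2 by simp
  ultimately have "norm (\<iota> n E) = 1" by (simp add: power2_eq_square)
  moreover have "(norm (\<iota> n z))\<^sup>2 = norm (\<iota> n (mat_adjoint z * z))"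
    using cstar_identity[of "\<iota> n z"] \<iota>_adjoint[OF z] \<iota>_mult[OF _ z, of "mat_adjoint z"] z by simp
  moreover have "cmod (\<Sum>s<?N. complex_of_real ((cmod (v s))\<^sup>2)) = (\<Sum>s<?N. (cmod (v s))\<^sup>2)"
    unfolding of_real_sum[symmetric] norm_of_real by (simp add: sum_nonneg)
  ultimately show ?thesis unfolding zz \<iota>_smult[OF E] norm_scaleC by simp
qed

text \<open>A vector is stored as the first column of a matrix; submultiplicativity of the C*-norm
  then becomes an operator bound.\<close>

lemma mat_vec_bound:
  assumes x: "x \<in> M3 n"
  shows "(\<Sum>r<3 ^ n. (cmod (\<Sum>s<3 ^ n. x $$ (r, s) * v s))\<^sup>2) \<le> (norm (\<iota> n x))\<^sup>2 * (\<Sum>s<3 ^ n. (cmod (v s))\<^sup>2)"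
proof -
  let ?N = "(3 :: nat) ^ n"
  define z where "z = mat ?N ?N (\<lambda>(i, j). if j = 0 then v i else 0)"
  have z: "z \<in> M3 n" by (simp add: z_def)
  have "x * z = mat ?N ?N (\<lambda>(i, j). if j = 0 then (\<Sum>s<?N. x $$ (i, s) * v s) else 0)"
  proof (rule M3_eqI)
    fix r s assume rs: "r < ?N" "s < ?N"
    then show "(x * z) $$ (r, s) = mat ?N ?N (\<lambda>(i, j). if j = 0 then (\<Sum>s<?N. x $$ (i, s) * v s) else 0) $$ (r, s)"
      unfolding mat_mult_entry[OF x z rs] by (auto simp: z_def)
  qed (use x z in auto)
  then have "(\<Sum>r<?N. (cmod (\<Sum>s<?N. x $$ (r, s) * v s))\<^sup>2) = (norm (\<iota> n (x * z)))\<^sup>2"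
    by (rule first_column_norm[symmetric])
  also have "\<dots> \<le> (norm (\<iota> n x) * norm (\<iota> n z))\<^sup>2"
    unfolding \<iota>_mult[OF x z] by (intro power_mono norm_mult_ineq) auto
  also have "\<dots> = (norm (\<iota> n x))\<^sup>2 * (\<Sum>s<?N. (cmod (v s))\<^sup>2)"
    unfolding power_mult_distrib first_column_norm[OF z_def] ..
  finally show ?thesis .
qed

lemma op_fun: "x \<in> M3 n \<Longrightarrow> ell2_fun (op n x v) w = opf n x v w"
  by (rule op_bound[OF norm_ge_zero mat_vec_bound, of x n v]) auto

lemma op_norm: "x \<in> M3 n \<Longrightarrow> norm (op n x v) \<le> norm (\<iota> n x) * norm v"
  by (rule op_bound[OF norm_ge_zero mat_vec_bound, of x n v]) auto

lemma op_add:
  assumes "x \<in> M3 n" "y \<in> M3 n"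
  shows "op n (x + y) v = op n x v + op n y v"
proof (rule ell2_eqI)
  fix w
  have "opf n (x + y) v w = opf n x v w + opf n y v w"
    unfolding opf_def sum.distrib[symmetric]
    by (rule sum.cong) (use assms pre_less[of w n] in \<open>auto simp: distrib_right\<close>)
  then show "ell2_fun (op n (x + y) v) w = ell2_fun (op n x v + op n y v) w"
    using assms by (simp add: op_fun)
qed

lemma op_smult:
  assumes "x \<in> M3 n"
  shows "op n (c \<cdot>\<^sub>m x) v = cscale c (op n x v)"
proof (rule ell2_eqI)
  fix w
  have "opf n (c \<cdot>\<^sub>m x) v w = c * opf n x v w"
    unfolding opf_def sum_distrib_left
    by (rule sum.cong) (use assms pre_less[of w n] in auto)
  then show "ell2_fun (op n (c \<cdot>\<^sub>m x) v) w = ell2_fun (cscale c (op n x v)) w"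
    using assms by (simp add: op_fun)
qed

lemma op_mult: "x \<in> M3 n \<Longrightarrow> y \<in> M3 n \<Longrightarrow> op n (x * y) v = op n x (op n y v)"
  by (rule ell2_eqI) (simp only: op_fun mult_carrier_mat opf_mult[OF _ _ op_fun])

lemma op_vadd: "x \<in> M3 n \<Longrightarrow> op n x (u + v) = op n x u + op n x v"
  by (rule ell2_eqI) (simp add: op_fun opf_def sum.distrib distrib_left)

lemma op_vscale: "x \<in> M3 n \<Longrightarrow> op n x (cscale c v) = cscale c (op n x v)"
  by (rule ell2_eqI) (simp add: op_fun opf_def sum_distrib_left mult.left_commute)

lemma op_one: "op n (1\<^sub>m (3 ^ n)) v = v"
proof (rule ell2_eqI)
  fix w
  have "ell2_fun (op n (1\<^sub>m (3 ^ n)) v) w = (\<Sum>s<3 ^ n. if s = pre w n then ell2_fun v w else 0)"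
    unfolding op_fun[OF one_carrier_mat] opf_def by (rule sum.cong) (auto simp: pre_less)
  then show "ell2_fun (op n (1\<^sub>m (3 ^ n)) v) w = ell2_fun v w" by (simp add: pre_less)
qed

lemma op_dsum_const: "x \<in> M3 n \<Longrightarrow> op (Suc n) (dsum n (\<lambda>_. x)) v = op n x v"
  by (rule ell2_eqI) (simp add: op_fun op_fun[OF dsum_carrier] opf_dsum del: power_Suc)

lemma lift_level:
  assumes "x \<in> M3 n" "n \<le> N"
  obtains y where "y \<in> M3 N" "\<iota> N y = \<iota> n x" "\<And>v. op N y v = op n x v"
proof -
  have "\<exists>y. y \<in> M3 N \<and> \<iota> N y = \<iota> n x \<and> (\<forall>v. op N y v = op n x v)"
    using assms(2)
  proof (induction N rule: dec_induct)
    case base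
    then show ?case using assms by blast
  next
    case (step m)
    then obtain y where "y \<in> M3 m" "\<iota> m y = \<iota> n x" "\<And>v. op m y v = op n x v" by blast
    then show ?case
      by (intro exI[of _ "dsum m (\<lambda>_. y)"] conjI dsum_carrier) (simp_all add: \<iota>_dsum_const op_dsum_const)
  qed
  then show ?thesis using that by blast
qed

lemma common_level:
  assumes "x \<in> M3 n" "y \<in> M3 m"
  obtains N x' y' where "x' \<in> M3 N" "y' \<in> M3 N" "\<iota> N x' = \<iota> n x" "\<iota> N y' = \<iota> m y"
    "\<And>v. op N x' v = op n x v" "\<And>v. op N y' v = op m y v"
  using lift_level[OF assms(1), of "max n m"] lift_level[OF assms(2), of "max n m"]
  by (metis max.cobounded1 max.cobounded2)

text \<open>Both matrices are moved to a common level by tensoring with identities. Thus the action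
  depends only on the element of the UHF algebra, in a Lipschitz way.\<close>

lemma op_dist:
  assumes "x \<in> M3 n" "y \<in> M3 m"
  shows "norm (op n x v - op m y v) \<le> norm (\<iota> n x - \<iota> m y) * norm v"
proof -
  obtain N x' y' where *: "x' \<in> M3 N" "y' \<in> M3 N" "\<iota> N x' = \<iota> n x" "\<iota> N y' = \<iota> m y"
    "\<And>v. op N x' v = op n x v" "\<And>v. op N y' v = op m y v"
    using common_level[OF assms] by metis
  have "op N (x' + (-1) \<cdot>\<^sub>m y') v = op N x' v - op N y' v"
    by (rule ell2_eqI) (simp add: op_add op_smult *(1,2))
  then show ?thesis
    using op_norm[of "x' + (-1) \<cdot>\<^sub>m y'" N v] * by (simp add: \<iota>_minus)
qed

lemma approx:
  obtains n x where "\<And>k. x k \<in> M3 (n k)" "(\<lambda>k. \<iota> (n k) (x k)) \<longlonglongrightarrow> a"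
proof -
  have "a \<in> closure (\<Union>n. \<iota> n ` M3 n)" using \<iota>_dense by simp
  then obtain f where f: "\<And>k. f k \<in> (\<Union>n. \<iota> n ` M3 n)" "f \<longlonglongrightarrow> a"
    unfolding closure_sequential by blast
  then have "\<forall>k. \<exists>n x. x \<in> M3 n \<and> f k = \<iota> n x" by blast
  then obtain n x where "\<And>k. x k \<in> M3 (n k) \<and> f k = \<iota> (n k) (x k)" by metis
  moreover from this have "f = (\<lambda>k. \<iota> (n k) (x k))" by auto
  ultimately show ?thesis using that[of x n] f(2) by simp
qed

text \<open>Extension by continuity: the inequalities single out the limit of
  \<open>op n x v\<close> as \<open>\<iota> n x\<close> tends to \<open>a\<close>, without fixing an
  approximating sequence.\<close>

definition T :: "'u \<Rightarrow> digits ell2 \<Rightarrow> digits ell2" where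
  "T a v = (THE u. \<forall>n. \<forall>x\<in>M3 n. norm (u - op n x v) \<le> norm (a - \<iota> n x) * norm v)"

lemma T_op_dist:
  assumes "y \<in> M3 m"
  shows "norm (T a v - op m y v) \<le> norm (a - \<iota> m y) * norm v"
proof -
  obtain n x where x: "\<And>k. x k \<in> M3 (n k)" "(\<lambda>k. \<iota> (n k) (x k)) \<longlonglongrightarrow> a" using approx by metis
  have "Cauchy (\<lambda>k. op (n k) (x k) v)"
  proof (rule CauchyI)
    fix r :: real assume "r > 0"
    then have "r / (norm v + 1) > 0" by (simp add: add_nonneg_pos)
    then obtain K where K: "\<And>k l. k \<ge> K \<Longrightarrow> l \<ge> K \<Longrightarrow> norm (\<iota> (n k) (x k) - \<iota> (n l) (x l)) < r / (norm v + 1)"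
      using CauchyD[OF LIMSEQ_imp_Cauchy[OF x(2)]] by blast
    have "norm (op (n k) (x k) v - op (n l) (x l) v) < r" if "k \<ge> K" "l \<ge> K" for k l
    proof -
      have "norm (op (n k) (x k) v - op (n l) (x l) v) \<le> norm (\<iota> (n k) (x k) - \<iota> (n l) (x l)) * norm v"
        by (rule op_dist) (rule x)+
      also have "\<dots> \<le> norm (\<iota> (n k) (x k) - \<iota> (n l) (x l)) * (norm v + 1)" by (intro mult_left_mono) auto
      also have "\<dots> < r / (norm v + 1) * (norm v + 1)"
        using K[OF that] by (intro mult_strict_right_mono) (auto simp: add_nonneg_pos)
      also have "\<dots> = r" by (simp add: add_nonneg_eq_0_iff)
      finally show ?thesis .
    qed
    then show "\<exists>K. \<forall>k\<ge>K. \<forall>l\<ge>K. norm (op (n k) (x k) v - op (n l) (x l) v) < r" by blast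
  qed
  then obtain u where u: "(\<lambda>k. op (n k) (x k) v) \<longlonglongrightarrow> u" using Cauchy_convergent convergent_def by blast
  \<comment> \<open>The limit \<open>u\<close> along one approximating sequence satisfies the
    inequalities in the definition of \<open>T\<close>, and the next step shows that nothing else
    does.\<close>
  have ub: "norm (u - op m y v) \<le> norm (a - \<iota> m y) * norm v" if "y \<in> M3 m" for m y
    by (rule LIMSEQ_le[OF tendsto_norm[OF tendsto_diff[OF u tendsto_const]]
          tendsto_mult_right[OF tendsto_norm[OF tendsto_diff[OF x(2) tendsto_const]]]])
      (use op_dist[OF x(1) that] in blast)
  have uniq: "u' = u" if "\<forall>n. \<forall>x\<in>M3 n. norm (u' - op n x v) \<le> norm (a - \<iota> n x) * norm v" for u'
  proof -
    have "(\<lambda>k. norm (a - \<iota> (n k) (x k)) * norm v) \<longlonglongrightarrow> norm (a - a) * norm v"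
      by (intro tendsto_intros x)
    then have "(\<lambda>k. norm (a - \<iota> (n k) (x k)) * norm v) \<longlonglongrightarrow> 0" by simp
    then have "(\<lambda>k. u' - op (n k) (x k) v) \<longlonglongrightarrow> 0"
      by (rule Lim_null_comparison[rotated]) (use that x(1) in \<open>auto intro!: always_eventually\<close>)
    then have "(\<lambda>k. op (n k) (x k) v) \<longlonglongrightarrow> u'" by (rule tendsto_of_diff)
    then show ?thesis using u LIMSEQ_unique by blast
  qed
  have "T a v = u" unfolding T_def by (rule the_equality) (use ub uniq in auto)
  then show ?thesis using ub[OF assms] by simp
qed

lemma T_\<iota>: "x \<in> M3 n \<Longrightarrow> T (\<iota> n x) v = op n x v"
  using T_op_dist[of x n "\<iota> n x" v] by simp

lemma T_dist: "norm (T a v - T b v) \<le> norm (a - b) * norm v"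
proof -
  obtain n x where x: "\<And>k. x k \<in> M3 (n k)" "(\<lambda>k. \<iota> (n k) (x k)) \<longlonglongrightarrow> b" using approx by metis
  have 1: "(\<lambda>k. op (n k) (x k) v) \<longlonglongrightarrow> T b v"
  proof -
    have "(\<lambda>k. norm (b - \<iota> (n k) (x k)) * norm v) \<longlonglongrightarrow> norm (b - b) * norm v"
      by (intro tendsto_intros x)
    then have "(\<lambda>k. norm (b - \<iota> (n k) (x k)) * norm v) \<longlonglongrightarrow> 0" by simp
    then have "(\<lambda>k. T b v - op (n k) (x k) v) \<longlonglongrightarrow> 0"
      by (rule Lim_null_comparison[rotated]) (use T_op_dist[OF x(1)] in \<open>auto intro!: always_eventually\<close>)
    then show ?thesis by (rule tendsto_of_diff)
  qed
  show ?thesis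
    by (rule LIMSEQ_le[OF tendsto_norm[OF tendsto_diff[OF tendsto_const 1]]
          tendsto_mult_right[OF tendsto_norm[OF tendsto_diff[OF tendsto_const x(2)]]]])
      (use T_op_dist[OF x(1)] in blast)
qed

lemma T_tendsto: "a \<longlonglongrightarrow> b \<Longrightarrow> (\<lambda>k. T (a k) v) \<longlonglongrightarrow> T b v"
proof -
  assume "a \<longlonglongrightarrow> b"
  then have "(\<lambda>k. norm (a k - b) * norm v) \<longlonglongrightarrow> norm (b - b) * norm v" by (intro tendsto_intros)
  then have "(\<lambda>k. norm (a k - b) * norm v) \<longlonglongrightarrow> 0" by simp
  then have "(\<lambda>k. T (a k) v - T b v) \<longlonglongrightarrow> 0"
    by (rule Lim_null_comparison[rotated]) (use T_dist in \<open>auto intro!: always_eventually\<close>)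
  then show ?thesis by (rule LIM_zero_cancel)
qed

lemma T_zero: "T 0 v = 0"
proof -
  have "T (\<iota> 0 (0\<^sub>m (3 ^ 0) (3 ^ 0))) v = op 0 (0 \<cdot>\<^sub>m 0\<^sub>m (3 ^ 0) (3 ^ 0)) v"
    by (subst T_\<iota>) auto
  also have "\<dots> = 0" by (subst op_smult) (auto intro: ell2_eqI)
  finally show ?thesis by (simp only: \<iota>_zero)
qed

lemma T_norm: "norm (T a v) \<le> norm a * norm v"
  using T_dist[of a v 0] by (simp add: T_zero)

text \<open>Density in two arguments at once: identities are checked on pairs of matrices of the
  same level, where products and sums of matrices make sense.\<close>

lemma T_approx2:
  assumes "\<And>N x y. x \<in> M3 N \<Longrightarrow> y \<in> M3 N \<Longrightarrow> P (\<iota> N x) (\<iota> N y)"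
    and "\<And>a b a' b'. (\<And>k. P (a k) (b k)) \<Longrightarrow> a \<longlonglongrightarrow> a' \<Longrightarrow> b \<longlonglongrightarrow> b' \<Longrightarrow> P a' b'"
  shows "P a b"
proof -
  obtain n x where x: "\<And>k. x k \<in> M3 (n k)" "(\<lambda>k. \<iota> (n k) (x k)) \<longlonglongrightarrow> a" using approx by metis
  obtain m y where y: "\<And>k. y k \<in> M3 (m k)" "(\<lambda>k. \<iota> (m k) (y k)) \<longlonglongrightarrow> b" using approx by metis
  have "P (\<iota> (n k) (x k)) (\<iota> (m k) (y k))" for k
    using common_level[OF x(1) y(1), of k k] assms(1) by metis
  then show ?thesis by (rule assms(2)[OF _ x(2) y(2)])
qed

lemma T_add: "T (a + b) v = T a v + T b v"
proof (rule T_approx2[where P = "\<lambda>a b. T (a + b) v = T a v + T b v"])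
  fix N x y assume "x \<in> M3 N" "y \<in> M3 N"
  then show "T (\<iota> N x + \<iota> N y) v = T (\<iota> N x) v + T (\<iota> N y) v"
    by (simp add: T_\<iota> op_add flip: \<iota>_add)
next
  fix a b :: "nat \<Rightarrow> 'u" and a' b' assume *: "\<And>k. T (a k + b k) v = T (a k) v + T (b k) v" "a \<longlonglongrightarrow> a'" "b \<longlonglongrightarrow> b'"
  have "(\<lambda>k. T (a k + b k) v) \<longlonglongrightarrow> T (a' + b') v" by (intro T_tendsto tendsto_add *)
  moreover have "(\<lambda>k. T (a k + b k) v) \<longlonglongrightarrow> T a' v + T b' v" unfolding *(1) by (intro T_tendsto tendsto_add *)
  ultimately show "T (a' + b') v = T a' v + T b' v" by (rule LIMSEQ_unique)
qed

lemma tendsto_cscale: "u \<longlonglongrightarrow> v \<Longrightarrow> (\<lambda>k. cscale c (u k)) \<longlonglongrightarrow> cscale c v"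
proof -
  assume "u \<longlonglongrightarrow> v"
  then have "(\<lambda>k. cmod c * norm (u k - v)) \<longlonglongrightarrow> cmod c * norm (v - v)" by (intro tendsto_intros)
  moreover have "norm (cscale c (u k) - cscale c v) = cmod c * norm (u k - v)" for k
    by (subst ell2_norm_cscale[symmetric]) (rule arg_cong[of _ _ norm], rule ell2_eqI, simp add: algebra_simps)
  ultimately have "(\<lambda>k. cscale c (u k) - cscale c v) \<longlonglongrightarrow> 0" by (simp add: tendsto_norm_zero_cancel)
  then show ?thesis by (rule LIM_zero_cancel)
qed

lemma T_scaleC: "T (c *\<^sub>C a) v = cscale c (T a v)"
proof -
  obtain n x where x: "\<And>k. x k \<in> M3 (n k)" "(\<lambda>k. \<iota> (n k) (x k)) \<longlonglongrightarrow> a" using approx by metis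
  have "(\<lambda>k. T (c *\<^sub>C \<iota> (n k) (x k)) v) \<longlonglongrightarrow> T (c *\<^sub>C a) v" by (intro T_tendsto tendsto_scaleC x)
  moreover have "T (c *\<^sub>C \<iota> (n k) (x k)) v = cscale c (T (\<iota> (n k) (x k)) v)" for k
    using x(1)[of k] by (simp add: T_\<iota> op_smult flip: \<iota>_smult)
  moreover have "(\<lambda>k. cscale c (T (\<iota> (n k) (x k)) v)) \<longlonglongrightarrow> cscale c (T a v)" by (intro T_tendsto tendsto_cscale x)
  ultimately show ?thesis using LIMSEQ_unique by simp
qed

lemma T_vadd: "T a (u + v) = T a u + T a v"
proof -
  obtain n x where x: "\<And>k. x k \<in> M3 (n k)" "(\<lambda>k. \<iota> (n k) (x k)) \<longlonglongrightarrow> a" using approx by metis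
  have "(\<lambda>k. T (\<iota> (n k) (x k)) (u + v)) \<longlonglongrightarrow> T a (u + v)" by (intro T_tendsto x)
  moreover have "T (\<iota> (n k) (x k)) (u + v) = T (\<iota> (n k) (x k)) u + T (\<iota> (n k) (x k)) v" for k
    using x(1)[of k] by (simp add: T_\<iota> op_vadd)
  moreover have "(\<lambda>k. T (\<iota> (n k) (x k)) u + T (\<iota> (n k) (x k)) v) \<longlonglongrightarrow> T a u + T a v" by (intro tendsto_add T_tendsto x)
  ultimately show ?thesis using LIMSEQ_unique by simp
qed

lemma T_vscale: "T a (cscale c v) = cscale c (T a v)"
proof -
  obtain n x where x: "\<And>k. x k \<in> M3 (n k)" "(\<lambda>k. \<iota> (n k) (x k)) \<longlonglongrightarrow> a" using approx by metis
  have "(\<lambda>k. T (\<iota> (n k) (x k)) (cscale c v)) \<longlonglongrightarrow> T a (cscale c v)" by (intro T_tendsto x)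
  moreover have "T (\<iota> (n k) (x k)) (cscale c v) = cscale c (T (\<iota> (n k) (x k)) v)" for k
    using x(1)[of k] by (simp add: T_\<iota> op_vscale)
  moreover have "(\<lambda>k. cscale c (T (\<iota> (n k) (x k)) v)) \<longlonglongrightarrow> cscale c (T a v)" by (intro tendsto_cscale T_tendsto x)
  ultimately show ?thesis using LIMSEQ_unique by simp
qed

lemma T_vminus: "T a (u - v) = T a u - T a v"
  using T_vadd[of a "u - v" v] by (simp add: eq_diff_eq)

lemma T_one: "T 1 v = v"
  using T_\<iota>[of "1\<^sub>m (3 ^ 0)" 0 v] \<iota>_one[of 0] op_one[of 0 v] by simp

lemma T_mult: "T (a * b) v = T a (T b v)"
proof (rule T_approx2[where P = "\<lambda>a b. T (a * b) v = T a (T b v)"])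
  fix N x y assume "x \<in> M3 N" "y \<in> M3 N"
  then show "T (\<iota> N x * \<iota> N y) v = T (\<iota> N x) (T (\<iota> N y) v)"
    by (simp add: T_\<iota> op_mult flip: \<iota>_mult)
next
  fix a b :: "nat \<Rightarrow> 'u" and a' b' assume *: "\<And>k. T (a k * b k) v = T (a k) (T (b k) v)" "a \<longlonglongrightarrow> a'" "b \<longlonglongrightarrow> b'"
  have "(\<lambda>k. T (a k * b k) v) \<longlonglongrightarrow> T (a' * b') v" by (intro T_tendsto tendsto_mult *)
  \<comment> \<open>Operator and vector vary simultaneously. The convergent, hence bounded, factor
    \<open>norm (a k)\<close> absorbs the change of the vector.\<close>
  moreover have "(\<lambda>k. T (a k) (T (b k) v)) \<longlonglongrightarrow> T a' (T b' v)"
  proof -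
    have "(\<lambda>k. norm (a k) * norm (T (b k) v - T b' v)) \<longlonglongrightarrow> norm a' * norm (T b' v - T b' v)"
      by (intro tendsto_intros T_tendsto *)
    then have "(\<lambda>k. norm (a k) * norm (T (b k) v - T b' v)) \<longlonglongrightarrow> 0" by simp
    then have "(\<lambda>k. T (a k) (T (b k) v - T b' v)) \<longlonglongrightarrow> 0"
      by (rule Lim_null_comparison[rotated]) (use T_norm in \<open>auto intro!: always_eventually\<close>)
    then have "(\<lambda>k. T (a k) (T (b k) v - T b' v) + T (a k) (T b' v)) \<longlonglongrightarrow> 0 + T a' (T b' v)"
      by (intro tendsto_add T_tendsto *)
    then show ?thesis by (simp add: T_vminus)
  qed
  ultimately show "T (a' * b') v = T a' (T b' v)" unfolding *(1) by (rule LIMSEQ_unique)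
qed

lemma tendsto_cip: "u \<longlonglongrightarrow> u' \<Longrightarrow> (\<lambda>k. cip (u k) v) \<longlonglongrightarrow> cip u' v"
proof -
  assume "u \<longlonglongrightarrow> u'"
  then have "(\<lambda>k. norm (u k - u') * norm v) \<longlonglongrightarrow> norm (u' - u') * norm v" by (intro tendsto_intros)
  then have "(\<lambda>k. norm (u k - u') * norm v) \<longlonglongrightarrow> 0" by simp
  then have "(\<lambda>k. cip (u k - u') v) \<longlonglongrightarrow> 0"
    by (rule Lim_null_comparison[rotated]) (use cip_bound in \<open>auto intro!: always_eventually\<close>)
  moreover have "cip (u k - u') v = cip (u k) v - cip u' v" for k
    using cip_add_left[of "u k - u'" u' v] by simp
  ultimately show ?thesis by (simp add: LIM_zero_iff)
qed

lemma tendsto_cip_right: "u \<longlonglongrightarrow> u' \<Longrightarrow> (\<lambda>k. cip v (u k)) \<longlonglongrightarrow> cip v u'"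
  using tendsto_cnj[OF tendsto_cip, of u u' v] by (simp add: cip_commute[of v])

text \<open>For fixed \<open>v\<close> the vectors \<open>u\<close> satisfying the identity form a
  closed subspace. On basis vectors it only expresses that the adjoint has the conjugate transposed
  entries.\<close>

lemma op_adjoint:
  assumes x: "x \<in> M3 n"
  shows "cip (op n x v) u = cip v (op n (mat_adjoint x) u)"
proof -
  let ?y = "mat_adjoint x"
  have y: "?y \<in> M3 n" using x by simp
  define W where "W = {u. cip (op n x v) u = cip v (op n ?y u)}"
  have "u \<in> W"
  proof (rule ell2_closed_subspace_eqI[where X = UNIV])
    show "0 \<in> W"
    proof -
      have "cip (op n x v) (cscale 0 0) = cip v (op n ?y (cscale 0 0))" by (simp add: op_vscale[OF y] cip_scale_right)
      moreover have "cscale 0 0 = (0 :: digits ell2)" by (rule ell2_eqI) simp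
      ultimately show ?thesis by (simp add: W_def)
    qed
    show "closed W"
      unfolding closed_sequential_limits
    proof (intro allI impI)
      fix f l assume *: "(\<forall>k. f k \<in> W) \<and> f \<longlonglongrightarrow> l"
      have "(\<lambda>k. T (\<iota> n ?y) (f k)) \<longlonglongrightarrow> T (\<iota> n ?y) l"
      proof -
        have "(\<lambda>k. norm (\<iota> n ?y) * norm (f k - l)) \<longlonglongrightarrow> norm (\<iota> n ?y) * norm (l - l)"
          using * by (intro tendsto_intros) auto
        then have "(\<lambda>k. norm (\<iota> n ?y) * norm (f k - l)) \<longlonglongrightarrow> 0" by simp
        then have "(\<lambda>k. T (\<iota> n ?y) (f k - l)) \<longlonglongrightarrow> 0"
          by (rule Lim_null_comparison[rotated]) (use T_norm in \<open>auto intro!: always_eventually\<close>)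
        then show ?thesis by (simp add: T_vminus LIM_zero_iff)
      qed
      then have "(\<lambda>k. cip v (op n ?y (f k))) \<longlonglongrightarrow> cip v (op n ?y l)"
        unfolding T_\<iota>[OF y] by (rule tendsto_cip_right)
      moreover have "(\<lambda>k. cip (op n x v) (f k)) \<longlonglongrightarrow> cip (op n x v) l" using * by (intro tendsto_cip_right) auto
      moreover have "cip (op n x v) (f k) = cip v (op n ?y (f k))" for k using * by (auto simp: W_def)
      ultimately show "l \<in> W" using LIMSEQ_unique by (auto simp: W_def)
    qed
    show "basis_vec w \<in> W" for w
    proof -
      have "op n ?y (basis_vec w) = (\<Sum>r<3 ^ n. cscale (?y $$ (r, pre w n)) (basis_vec (rep n r w)))"
      proof (rule ell2_eqI)
        fix w'
        have "ell2_fun (\<Sum>r<3 ^ n. cscale (?y $$ (r, pre w n)) (basis_vec (rep n r w))) w' =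
            (\<Sum>r<3 ^ n. if r = pre w' n then (if \<forall>i\<ge>n. dig w' i = dig w i then ?y $$ (pre w' n, pre w n) else 0) else 0)"
          unfolding ell2_fun_sum by (rule sum.cong) (auto simp: basis_vec_fun rep_eq_iff eq_commute[of w'])
        then show "ell2_fun (op n ?y (basis_vec w)) w' =
            ell2_fun (\<Sum>r<3 ^ n. cscale (?y $$ (r, pre w n)) (basis_vec (rep n r w))) w'"
          using pre_less[of w' n] by (simp add: op_fun[OF y] opf_basis_vec)
      qed
      moreover have "cip v (\<Sum>r\<in>K. f r) = (\<Sum>r\<in>K. cip v (f r))" if "finite K" for K :: "nat set" and f
        using that by (induction K rule: finite_induct) (auto simp: cip_add_right cip_def[of _ 0])
      ultimately have "cip v (op n ?y (basis_vec w)) = (\<Sum>r<3 ^ n. x $$ (pre w n, r) * ell2_fun v (rep n r w))"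
        by (simp add: cip_scale_right cip_basis_vec mat_adjoint_entry[OF x] pre_less)
      then show ?thesis by (simp add: W_def cip_basis_vec op_fun[OF x] opf_def)
    qed
  qed (auto simp: W_def cip_add_right op_vadd[OF y] op_vscale[OF y] cip_scale_right)
  then show ?thesis by (simp add: W_def)
qed

lemma T_adjoint: "cip (T a v) u = cip v (T (star a) u)"
proof -
  obtain n x where x: "\<And>k. x k \<in> M3 (n k)" "(\<lambda>k. \<iota> (n k) (x k)) \<longlonglongrightarrow> a" using approx by metis
  have "(\<lambda>k. cip (T (\<iota> (n k) (x k)) v) u) \<longlonglongrightarrow> cip (T a v) u" by (intro tendsto_cip T_tendsto x)
  moreover have "cip (T (\<iota> (n k) (x k)) v) u = cip v (T (star (\<iota> (n k) (x k))) u)" for k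
    using x(1)[of k] op_adjoint[OF x(1)[of k]] by (simp add: T_\<iota> flip: \<iota>_adjoint)
  moreover have "(\<lambda>k. cip v (T (star (\<iota> (n k) (x k))) u)) \<longlonglongrightarrow> cip v (T (star a) u)"
    by (intro tendsto_cip_right T_tendsto tendsto_star x)
  ultimately show ?thesis using LIMSEQ_unique by simp
qed

end

section \<open>Matrix units and norms\<close>

definition munit :: "nat \<Rightarrow> nat \<Rightarrow> nat \<Rightarrow> complex mat" where
  "munit N i j = mat N N (\<lambda>(r, s). if r = i \<and> s = j then 1 else 0)"

lemma munit_carrier [simp]: "munit N i j \<in> carrier_mat N N"
  by (simp add: munit_def)

lemma munit_entry: "r < N \<Longrightarrow> s < N \<Longrightarrow> munit N i j $$ (r, s) = (if r = i \<and> s = j then 1 else 0)"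
  by (simp add: munit_def)

lemma munit_mult_left_entry:
  assumes "x \<in> carrier_mat N N" "q < N" "r < N" "s < N"
  shows "(munit N i q * x) $$ (r, s) = (if r = i then x $$ (q, s) else 0)"
proof -
  have "(munit N i q * x) $$ (r, s) = (\<Sum>k<N. if k = q then (if r = i then x $$ (q, s) else 0) else 0)"
    unfolding mat_mult_entry[OF munit_carrier assms(1,3,4)] by (rule sum.cong) (use assms in \<open>auto simp: munit_entry\<close>)
  then show ?thesis using assms by simp
qed

lemma munit_mult_right_entry:
  assumes "x \<in> carrier_mat N N" "q < N" "r < N" "s < N"
  shows "(x * munit N q j) $$ (r, s) = (if s = j then x $$ (r, q) else 0)"
proof -
  have "(x * munit N q j) $$ (r, s) = (\<Sum>k<N. if k = q then (if s = j then x $$ (r, q) else 0) else 0)"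
    unfolding mat_mult_entry[OF assms(1) munit_carrier assms(3,4)] by (rule sum.cong) (use assms in \<open>auto simp: munit_entry\<close>)
  then show ?thesis using assms by simp
qed

lemma munit_dim [simp]: "dim_row (munit N i j) = N" "dim_col (munit N i j) = N"
  by (simp_all add: munit_def)

lemma munit_mult:
  assumes "q < N"
  shows "munit N i q * munit N q j = munit N i j"
proof (rule eq_matI)
  fix r s assume "r < dim_row (munit N i j)" "s < dim_col (munit N i j)"
  then have rs: "r < N" "s < N" by simp_all
  show "(munit N i q * munit N q j) $$ (r, s) = munit N i j $$ (r, s)"
    unfolding munit_mult_left_entry[OF munit_carrier assms rs] using rs assms by (simp add: munit_entry)
qed simp_all

lemma munit_compress:
  assumes "x \<in> carrier_mat N N" "r < N" "s < N"
  shows "munit N r r * x * munit N s s = x $$ (r, s) \<cdot>\<^sub>m munit N r s"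
proof (rule eq_matI)
  fix i j assume "i < dim_row (x $$ (r, s) \<cdot>\<^sub>m munit N r s)" "j < dim_col (x $$ (r, s) \<cdot>\<^sub>m munit N r s)"
  then have ij: "i < N" "j < N" by (auto simp: munit_def)
  have c: "munit N r r * x \<in> carrier_mat N N" using assms by (intro mult_carrier_mat[OF munit_carrier])
  show "(munit N r r * x * munit N s s) $$ (i, j) = (x $$ (r, s) \<cdot>\<^sub>m munit N r s) $$ (i, j)"
    unfolding munit_mult_right_entry[OF c assms(3) ij]
    using munit_mult_left_entry[OF assms(1,2) ij(1) assms(3)] ij carrier_matD[OF munit_carrier[of N r s]]
    by (auto simp: munit_entry)
qed (use assms in \<open>auto simp: munit_def\<close>)

lemma munit_adjoint: "mat_adjoint (munit N i j) = munit N j i"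
proof (rule eq_matI)
  fix r s assume "r < dim_row (munit N j i)" "s < dim_col (munit N j i)"
  then have rs: "r < N" "s < N" by simp_all
  show "mat_adjoint (munit N i j) $$ (r, s) = munit N j i $$ (r, s)"
    unfolding mat_adjoint_entry[OF munit_carrier rs] using rs by (simp add: munit_entry)
qed (use carrier_matD[OF mat_adjoint_carrier[OF munit_carrier[of N i j]]] in simp_all)

lemma munit_kron:
  assumes "r < 3 ^ Suc n" "s < 3 ^ Suc n"
  shows "munit (3 ^ Suc n) r s = munit (3 ^ n) (r div 3) (s div 3) \<otimes>\<^sub>K munit 3 (r mod 3) (s mod 3)"
proof (rule M3_eqI)
  show "munit (3 ^ n) (r div 3) (s div 3) \<otimes>\<^sub>K munit 3 (r mod 3) (s mod 3) \<in> M3 (Suc n)"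
    by (intro kron_M3 munit_carrier)
  fix i j :: nat assume ij: "i < 3 ^ Suc n" "j < 3 ^ Suc n"
  have eq: "i = r \<longleftrightarrow> i div 3 = r div 3 \<and> i mod 3 = r mod 3" for i r :: nat by (metis div_mult_mod_eq)
  show "munit (3 ^ Suc n) r s $$ (i, j) = (munit (3 ^ n) (r div 3) (s div 3) \<otimes>\<^sub>K munit 3 (r mod 3) (s mod 3)) $$ (i, j)"
    unfolding kron_digit[OF munit_carrier munit_carrier ij] munit_entry[OF ij]
    using div_bound[OF ij(1)] div_bound[OF ij(2)] eq[of i r] eq[of j s] by (simp add: munit_entry)
qed simp

text \<open>A constant factor disappears after taking roots of order \<open>2 ^ k\<close>.\<close>

lemma power_domination:
  fixes a b C :: real
  assumes "\<And>k. a ^ (2 ^ k) \<le> C * b ^ (2 ^ k)" "0 \<le> b"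
  shows "a \<le> b"
proof (rule ccontr)
  assume "\<not> a \<le> b"
  then have ab: "b < a" by simp
  show False
  proof (cases "b = 0")
    case True
    then show ?thesis using assms(1)[of 0] ab by simp
  next
    case False
    then have b: "b > 0" using assms by simp
    then have q: "a / b > 1" using ab by simp
    obtain k where k: "C < (a / b) ^ k" using real_arch_pow[OF q] by blast
    also have "\<dots> \<le> (a / b) ^ (2 ^ k)" using q by (intro power_increasing) (auto intro: less_imp_le less_exp)
    also have "\<dots> \<le> C" using assms(1)[of k] b by (simp add: power_divide divide_le_eq)
    finally show False by simp
  qed
qed

lemma norm_basis_vec: "norm (basis_vec i) = 1"
proof -
  have "of_real ((norm (basis_vec i))\<^sup>2) = (1 :: complex)"
    unfolding cip_self_norm[symmetric] cip_basis_vec by (simp add: basis_vec_fun)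
  then have "(norm (basis_vec i))\<^sup>2 = 1" using of_real_eq_1_iff by blast
  then show ?thesis using norm_ge_zero[of "basis_vec i"] by (simp add: power2_eq_1_iff)
qed

lemma cip_sum_right: "cip v (\<Sum>i\<in>I. f i) = (\<Sum>i\<in>I. cip v (f i))"
proof (induction I rule: infinite_finite_induct)
  case empty
  show ?case by (simp add: cip_def)
qed (auto simp: cip_add_right cip_def[of _ 0])

context uhf_three_infty
begin

lemma \<iota>_munit_sum: "(\<Sum>r<3 ^ n. \<iota> n (munit (3 ^ n) r r)) = 1"
proof -
  let ?N = "(3 :: nat) ^ n"
  define P where "P k = mat ?N ?N (\<lambda>(r, s). if r = s \<and> r < k then 1 else (0 :: complex))" for k
  have "\<iota> n (P k) = (\<Sum>r<k. \<iota> n (munit ?N r r))" for k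
  proof (induction k)
    case 0
    have "P 0 = 0\<^sub>m ?N ?N" by (rule eq_matI) (auto simp: P_def)
    then show ?case by (simp add: \<iota>_zero)
  next
    case (Suc k)
    have "P (Suc k) = P k + munit ?N k k" by (rule eq_matI) (auto simp: P_def munit_def)
    then show ?case using Suc by (simp add: \<iota>_add P_def)
  qed
  moreover have "P ?N = 1\<^sub>m ?N" by (rule eq_matI) (auto simp: P_def)
  ultimately show ?thesis using \<iota>_one[of n] by metis
qed

lemma \<iota>_expand:
  assumes "x \<in> M3 n"
  shows "\<iota> n x = (\<Sum>r<3 ^ n. \<Sum>s<3 ^ n. x $$ (r, s) *\<^sub>C \<iota> n (munit (3 ^ n) r s))"
proof -
  let ?N = "(3 :: nat) ^ n"
  have "\<iota> n x = (\<Sum>r<?N. \<iota> n (munit ?N r r)) * \<iota> n x * (\<Sum>s<?N. \<iota> n (munit ?N s s))"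
    unfolding \<iota>_munit_sum by simp
  also have "\<dots> = (\<Sum>r<?N. \<Sum>s<?N. \<iota> n (munit ?N r r) * \<iota> n x * \<iota> n (munit ?N s s))"
    by (simp only: sum_distrib_right sum_distrib_left) (rule sum.swap)
  also have "\<dots> = (\<Sum>r<?N. \<Sum>s<?N. x $$ (r, s) *\<^sub>C \<iota> n (munit ?N r s))"
  proof (intro sum.cong refl)
    fix r s assume "r \<in> {..<?N}" "s \<in> {..<?N}"
    then show "\<iota> n (munit ?N r r) * \<iota> n x * \<iota> n (munit ?N s s) = x $$ (r, s) *\<^sub>C \<iota> n (munit ?N r s)"
      using munit_compress[OF assms, of r s] assms
      by (metis \<iota>_mult \<iota>_smult lessThan_iff mult_carrier_mat munit_carrier)
  qed
  finally show ?thesis .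
qed

text \<open>The constant comes from the expansion in matrix units and depends on \<open>n\<close>.
  It may be crude, since \<open>power_domination\<close> removes it.\<close>

lemma \<iota>_entry_bound:
  obtains C where "\<And>x B. x \<in> M3 n \<Longrightarrow> (\<And>r s. r < 3 ^ n \<Longrightarrow> s < 3 ^ n \<Longrightarrow> cmod (x $$ (r, s)) \<le> B) \<Longrightarrow>
    norm (\<iota> n x) \<le> C * B"
proof
  let ?N = "(3 :: nat) ^ n"
  fix x B assume x: "x \<in> M3 n" and B: "\<And>r s. r < ?N \<Longrightarrow> s < ?N \<Longrightarrow> cmod (x $$ (r, s)) \<le> B"
  have "norm (\<iota> n x) \<le> (\<Sum>r<?N. \<Sum>s<?N. norm (x $$ (r, s) *\<^sub>C \<iota> n (munit ?N r s)))"
    unfolding \<iota>_expand[OF x] by (intro order_trans[OF norm_sum] sum_mono norm_sum)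
  also have "\<dots> \<le> (\<Sum>r<?N. \<Sum>s<?N. norm (\<iota> n (munit ?N r s)) * B)"
    unfolding norm_scaleC by (subst mult.commute) (intro sum_mono mult_left_mono B, auto)
  also have "\<dots> = (\<Sum>r<?N. \<Sum>s<?N. norm (\<iota> n (munit ?N r s))) * B"
    by (simp add: sum_distrib_right)
  finally show "norm (\<iota> n x) \<le> (\<Sum>r<?N. \<Sum>s<?N. norm (\<iota> n (munit ?N r s))) * B" .
qed

text \<open>The norm of a C*-algebra is determined by its algebraic structure, so on matrices it is the
  operator norm.\<close>

lemma norm_\<iota>_le:
  assumes x: "x \<in> M3 n" and M: "0 \<le> M" "\<And>v. norm (op n x v) \<le> M * norm v"
  shows "norm (\<iota> n x) \<le> M"
proof -
  let ?a = "\<iota> n x" and ?N = "(3 :: nat) ^ n"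
  define h where "h = star ?a * ?a"
  have Ta: "norm (T ?a v) \<le> M * norm v" for v using M(2) by (simp add: T_\<iota>[OF x])
  \<comment> \<open>The adjoint inherits the bound: the squared norm of its value at
    \<open>v\<close> is an inner product of \<open>v\<close> with \<open>T ?a\<close> applied to
    that value.\<close>
  have Ts: "norm (T (star ?a) v) \<le> M * norm v" for v
  proof (cases "T (star ?a) v = 0")
    case False
    let ?u = "T (star ?a) v"
    have "complex_of_real ((norm ?u)\<^sup>2) = cip v (T ?a ?u)"
      unfolding cip_self_norm[symmetric] by (simp add: T_adjoint star_star)
    then have "(norm ?u)\<^sup>2 \<le> norm v * norm (T ?a ?u)"
      using cip_bound[of v "T ?a ?u"] by (metis abs_of_nonneg norm_of_real zero_le_power2)
    also have "\<dots> \<le> norm v * (M * norm ?u)" by (intro mult_left_mono Ta) auto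
    finally show ?thesis using False by (simp add: power2_eq_square mult.assoc[symmetric] mult.commute)
  qed (use M in simp)
  have Th: "norm (T (h ^ j) v) \<le> (M\<^sup>2) ^ j * norm v" for j v
  proof (induction j)
    case (Suc j)
    have "norm (T (h ^ Suc j) v) \<le> M * (M * norm (T (h ^ j) v))"
      using Ts[of "T ?a (T (h ^ j) v)"] Ta[of "T (h ^ j) v"] M(1)
      by (simp add: h_def T_mult) (meson mult_left_mono order_trans)
    also have "\<dots> \<le> M * (M * ((M\<^sup>2) ^ j * norm v))" using Suc M(1) by (intro mult_left_mono)
    finally show ?case by (simp add: power2_eq_square mult_ac)
  qed (simp add: T_one)
  have "\<exists>H\<in>M3 n. h ^ j = \<iota> n H" for j
  proof (induction j)
    case 0
    show ?case using \<iota>_one[of n] by (intro bexI[of _ "1\<^sub>m ?N"]) auto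
  next
    case (Suc j)
    then obtain H where H: "H \<in> M3 n" "h ^ j = \<iota> n H" by blast
    have "mat_adjoint x * x * H \<in> M3 n" using x H by (intro mult_carrier_mat mat_adjoint_carrier)
    moreover have "h ^ Suc j = \<iota> n (mat_adjoint x * x * H)"
      using x H by (simp add: h_def \<iota>_mult[OF mult_carrier_mat[OF mat_adjoint_carrier[OF x] x] H(1)]
          \<iota>_mult[OF mat_adjoint_carrier[OF x] x] \<iota>_adjoint)
    ultimately show ?case by blast
  qed
  then obtain H where H: "\<And>j. H j \<in> M3 n" "\<And>j. h ^ j = \<iota> n (H j)" by metis
  \<comment> \<open>Entries of the matrix of \<open>h ^ j\<close> are coefficients of the operator
    \<open>T (h ^ j)\<close> between basis vectors with a common tail, hence bounded by its operator
    norm.\<close>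
  have entry: "cmod (H j $$ (r, s)) \<le> (M\<^sup>2) ^ j" if "r < ?N" "s < ?N" for j r s
  proof -
    let ?w = "\<lambda>r. rep n r (constw 1)"
    have "H j $$ (r, s) = ell2_fun (T (h ^ j) (basis_vec (?w s))) (?w r)"
      using that by (simp add: H T_\<iota> op_fun opf_basis_vec dig_rep pre_rep)
    also have "cmod \<dots> \<le> (M\<^sup>2) ^ j * norm (basis_vec (?w s))"
      by (rule order_trans[OF ell2_coord_le Th])
    finally show ?thesis by (simp add: norm_basis_vec)
  qed
  obtain C where C: "\<And>x B. x \<in> M3 n \<Longrightarrow> (\<And>r s. r < ?N \<Longrightarrow> s < ?N \<Longrightarrow> cmod (x $$ (r, s)) \<le> B) \<Longrightarrow> norm (\<iota> n x) \<le> C * B"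
    using \<iota>_entry_bound by blast
  have "norm h ^ (2 ^ k) \<le> C * (M\<^sup>2) ^ (2 ^ k)" for k
  proof -
    have "norm h ^ (2 ^ k) = norm (h ^ (2 ^ k))"
      by (rule norm_selfadjoint_power[symmetric]) (simp add: h_def star_mult star_star)
    also have "\<dots> \<le> C * (M\<^sup>2) ^ (2 ^ k)" unfolding H(2) by (rule C[OF H(1) entry])
    finally show ?thesis .
  qed
  then have "norm h \<le> M\<^sup>2" by (rule power_domination) simp
  then have "(norm ?a)\<^sup>2 \<le> M\<^sup>2" by (simp add: h_def cstar_identity)
  then show ?thesis using M(1) by (simp add: power2_le_iff_abs_le)
qed

text \<open>A block diagonal matrix preserves the letter at position \<open>n\<close>. A vector
  splits accordingly into three orthogonal parts \<open>V c\<close>, on which the matrix acts by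
  \<open>z c\<close>, and squared norms add up.\<close>

lemma norm_dsum_le:
  assumes z: "\<And>c. c < 3 \<Longrightarrow> z c \<in> M3 n" "\<And>c. c < 3 \<Longrightarrow> norm (\<iota> n (z c)) \<le> M"
  shows "norm (\<iota> (Suc n) (dsum n z)) \<le> M"
proof (rule norm_\<iota>_le[OF dsum_carrier])
  show M0: "0 \<le> M" by (rule order_trans[OF norm_ge_zero z(2)[of 0]]) simp
  fix v :: "digits ell2"
  have "\<exists>u. \<forall>w. ell2_fun u w = (if dig w n = c then ell2_fun v w else 0)" for c
  proof -
    obtain u where "\<And>w. ell2_fun u w = (if w \<in> {w. dig w n = c} then ell2_fun v w else 0)"
      by (rule ell2_restrict[of "{w. dig w n = c}" v]) blast
    then show ?thesis by (intro exI[of _ u]) simp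
  qed
  then obtain V where V: "\<And>c w. ell2_fun (V c) w = (if dig w n = c then ell2_fun v w else 0)" by metis
  have opV: "opf (Suc n) (dsum n z) v w = opf n (z (dig w n)) (V (dig w n)) w" for w
    by (subst opf_dsum[of z n]) (simp_all add: z opf_def V dig_rep)
  have "(\<Sum>w\<in>F. (cmod (opf (Suc n) (dsum n z) v w))\<^sup>2) \<le> (M * norm v)\<^sup>2" if F: "finite F" for F
  proof -
    have "(\<Sum>w\<in>F. (cmod (opf (Suc n) (dsum n z) v w))\<^sup>2)
        = (\<Sum>c<3. \<Sum>w\<in>{w\<in>F. dig w n = c}. (cmod (opf (Suc n) (dsum n z) v w))\<^sup>2)"
      by (rule sum.group[symmetric]) (use F in auto)
    also have "\<dots> = (\<Sum>c<3. \<Sum>w\<in>{w\<in>F. dig w n = c}. (cmod (ell2_fun (op n (z c) (V c)) w))\<^sup>2)"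
      by (intro sum.cong refl) (auto simp: opV op_fun z)
    also have "\<dots> \<le> (\<Sum>c<3. (norm (op n (z c) (V c)))\<^sup>2)"
      by (intro sum_mono ell2_norm_sum_le) (use F in auto)
    also have "\<dots> \<le> (\<Sum>c<3. (M * norm (V c))\<^sup>2)"
      by (intro sum_mono power_mono order_trans[OF op_norm] mult_right_mono z) auto
    also have "\<dots> = M\<^sup>2 * (\<Sum>c<3. (norm (V c))\<^sup>2)" by (simp add: power_mult_distrib sum_distrib_left)
    also have "(\<Sum>c<3. (norm (V c))\<^sup>2) = (\<Sum>\<^sub>\<infinity>w. \<Sum>c<3. (cmod (ell2_fun (V c) w))\<^sup>2)"
      unfolding ell2_norm_power2 numeral_3_eq_3 sum.lessThan_Suc
      by (simp add: infsum_add summable_on_add ell2_summable)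
    also have "\<dots> = (norm v)\<^sup>2"
      unfolding ell2_norm_power2
    proof (rule infsum_cong)
      fix w
      have "(\<Sum>c<3. (cmod (ell2_fun (V c) w))\<^sup>2) = (\<Sum>c<3. if c = dig w n then (cmod (ell2_fun v w))\<^sup>2 else 0)"
        by (rule sum.cong) (auto simp: V)
      then show "(\<Sum>c<3. (cmod (ell2_fun (V c) w))\<^sup>2) = (cmod (ell2_fun v w))\<^sup>2" by simp
    qed
    finally show ?thesis by (simp add: power_mult_distrib)
  qed
  then obtain u where "\<And>w. ell2_fun u w = opf (Suc n) (dsum n z) v w" "norm u \<le> M * norm v"
    by (rule ell2_bounded_sums) (use M0 in auto)
  moreover from this have "op (Suc n) (dsum n z) v = u"
    by (intro ell2_eqI) (simp only: op_fun[OF dsum_carrier])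
  ultimately show "norm (op (Suc n) (dsum n z) v) \<le> M * norm v" by simp
qed

lemma norm_dsum_diff_le:
  assumes "\<And>c. c < 3 \<Longrightarrow> u c \<in> M3 n" "\<And>c. c < 3 \<Longrightarrow> z c \<in> M3 n"
    "\<And>c. c < 3 \<Longrightarrow> norm (\<iota> n (u c) - \<iota> n (z c)) \<le> M"
  shows "norm (\<iota> (Suc n) (dsum n u) - \<iota> (Suc n) (dsum n z)) \<le> M"
proof -
  have "dsum n u + (-1) \<cdot>\<^sub>m dsum n z = dsum n (\<lambda>c. u c + (-1) \<cdot>\<^sub>m z c)"
    using assms by (simp add: dsum_add dsum_smult)
  then have "\<iota> (Suc n) (dsum n u) - \<iota> (Suc n) (dsum n z) = \<iota> (Suc n) (dsum n (\<lambda>c. u c + (-1) \<cdot>\<^sub>m z c))"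
    using \<iota>_minus[OF dsum_carrier dsum_carrier] by metis
  then show ?thesis using assms by (auto intro!: norm_dsum_le simp: \<iota>_minus)
qed

section \<open>The slice maps\<close>

text \<open>The prefix with index \<open>r\<close>, followed by the letter 1 forever. Letter 1 is
  the zero-based name of index 2, the vector at which the slice state evaluates.\<close>

definition wd :: "nat \<Rightarrow> nat \<Rightarrow> digits" where
  "wd n r = rep n r (constw 1)"

lemma dig_wd: "n \<le> i \<Longrightarrow> dig (wd n r) i = 1"
  by (simp add: wd_def dig_rep dig_constw)

lemma pre_wd: "r < 3 ^ n \<Longrightarrow> pre (wd n r) n = r"
  by (simp add: wd_def pre_rep)

lemma wd_pre: "n \<le> m \<Longrightarrow> wd m (pre (wd n r) m) = wd n r"
proof -
  assume "n \<le> m"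
  have "wd m (pre (wd n r) m) = rep m (pre (wd n r) m) (wd n r)"
    unfolding wd_def[of m] by (rule rep_cong) (use \<open>n \<le> m\<close> in \<open>simp add: dig_constw dig_wd\<close>)
  then show ?thesis by simp
qed

lemma inj_on_wd: "inj_on (wd n) {..<3 ^ n}"
  by (rule inj_onI) (metis lessThan_iff pre_wd)

text \<open>The compression of \<open>T a\<close> to the span of the words with tail 1 from position
  \<open>m + 1\<close> on: a concrete candidate for the slice map.\<close>

definition rho :: "nat \<Rightarrow> 'u \<Rightarrow> complex mat" where
  "rho m a = mat (3 ^ Suc m) (3 ^ Suc m) (\<lambda>(r, s). ell2_fun (T a (basis_vec (wd (Suc m) s))) (wd (Suc m) r))"

lemma rho_carrier: "rho m a \<in> M3 (Suc m)"
  unfolding rho_def by (rule mat_carrier)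

lemma rho_entry:
  "r < 3 ^ Suc m \<Longrightarrow> s < 3 ^ Suc m \<Longrightarrow> rho m a $$ (r, s) = ell2_fun (T a (basis_vec (wd (Suc m) s))) (wd (Suc m) r)"
  by (simp add: rho_def)

lemma rho_entry_le: "r < 3 ^ Suc m \<Longrightarrow> s < 3 ^ Suc m \<Longrightarrow> cmod (rho m a $$ (r, s)) \<le> norm a"
  using order_trans[OF ell2_coord_le T_norm, of a "basis_vec (wd (Suc m) s)" "wd (Suc m) r"]
  by (simp add: rho_entry norm_basis_vec del: power_Suc)

lemma rho_add: "rho m (a + b) = rho m a + rho m b"
  by (rule M3_eqI[OF rho_carrier add_carrier_mat[OF rho_carrier]])
     (simp add: rho_entry T_add carrier_matD[OF rho_carrier] del: power_Suc)

lemma rho_scaleC: "rho m (c *\<^sub>C a) = c \<cdot>\<^sub>m rho m a"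
  by (rule M3_eqI[OF rho_carrier smult_carrier_mat[OF rho_carrier]])
     (simp add: rho_entry T_scaleC carrier_matD[OF rho_carrier] del: power_Suc)

lemma rho_minus: "rho m (a - b) = rho m a + (-1) \<cdot>\<^sub>m rho m b"
  using rho_add[of m a "- b"] rho_scaleC[of m "-1" b] by (simp add: scaleC_minus1)

lemma rho_\<iota>:
  assumes "x \<in> M3 n" "m < n" "r < 3 ^ Suc m" "s < 3 ^ Suc m"
  shows "rho m (\<iota> n x) $$ (r, s) = x $$ (pre (wd (Suc m) r) n, pre (wd (Suc m) s) n)"
  using assms by (simp add: rho_entry T_\<iota> op_fun opf_basis_vec dig_wd del: power_Suc)

lemma rho_\<iota>_Suc: "x \<in> M3 (Suc m) \<Longrightarrow> rho m (\<iota> (Suc m) x) = x"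
  by (rule M3_eqI[OF rho_carrier]) (simp_all add: rho_\<iota> pre_wd del: power_Suc pre.simps)

lemma rho_tendsto:
  assumes "a \<longlonglongrightarrow> b" "r < 3 ^ Suc m" "s < 3 ^ Suc m"
  shows "(\<lambda>k. rho m (a k) $$ (r, s)) \<longlonglongrightarrow> rho m b $$ (r, s)"
proof -
  have "(\<lambda>k. norm (a k - b)) \<longlonglongrightarrow> 0" using assms(1) by (simp add: LIM_zero tendsto_norm_zero)
  then have "(\<lambda>k. rho m (a k - b) $$ (r, s)) \<longlonglongrightarrow> 0"
    by (rule Lim_null_comparison[rotated]) (use rho_entry_le[OF assms(2,3)] in \<open>auto intro!: always_eventually\<close>)
  moreover have "rho m (a k - b) $$ (r, s) = rho m (a k) $$ (r, s) - rho m b $$ (r, s)" for k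
    using assms(2,3) by (simp add: rho_minus carrier_matD[OF rho_carrier] del: power_Suc)
  ultimately show ?thesis by (simp add: LIM_zero_iff)
qed

lemma rho_eq_limit:
  assumes "a \<longlonglongrightarrow> b" "\<forall>\<^sub>F k in sequentially. rho m (a k) = x" "x \<in> M3 (Suc m)"
  shows "rho m b = x"
proof (rule M3_eqI[OF rho_carrier assms(3)])
  fix r s :: nat assume rs: "r < 3 ^ Suc m" "s < 3 ^ Suc m"
  have "(\<lambda>k. rho m (a k) $$ (r, s)) \<longlonglongrightarrow> x $$ (r, s)"
    by (rule tendsto_eventually, rule eventually_mono[OF assms(2)]) simp
  with rho_tendsto[OF assms(1) rs] show "rho m b $$ (r, s) = x $$ (r, s)" by (rule LIMSEQ_unique)
qed

lemma is_slice_map_rho: "is_slice_map \<iota> m (rho m)"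
  unfolding is_slice_map_def Suc_eq_plus1[symmetric]
proof (intro conjI allI ballI impI)
  show "range (rho m) \<subseteq> M3 (Suc m)" using rho_carrier by blast
  show "rho m (a + b) = rho m a + rho m b" for a b by (rule rho_add)
  show "rho m (c *\<^sub>C a) = c \<cdot>\<^sub>m rho m a" for c a by (rule rho_scaleC)
  show "rho m (\<iota> (Suc m) x) = x" if "x \<in> M3 (Suc m)" for x using that by (rule rho_\<iota>_Suc)
  show "continuous_on UNIV (\<lambda>a. rho m a $$ (r, s))" if "r < 3 ^ Suc m" "s < 3 ^ Suc m" for r s
    unfolding continuous_on_sequentially using rho_tendsto[OF _ that] by (auto simp: o_def)
  fix n x and y :: "complex mat" assume nxy: "Suc m \<le> n" "x \<in> M3 n" "y \<in> carrier_mat 3 3"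
  have xy: "x \<otimes>\<^sub>K y \<in> M3 (Suc n)" by (rule kron_M3) (use nxy in auto)
  show "rho m (\<iota> (Suc n) (x \<otimes>\<^sub>K y)) = y $$ (1, 1) \<cdot>\<^sub>m rho m (\<iota> n x)"
  proof (rule M3_eqI[OF rho_carrier smult_carrier_mat[OF rho_carrier]])
    fix r s :: nat assume rs: "r < 3 ^ Suc m" "s < 3 ^ Suc m"
    let ?r = "pre (wd (Suc m) r) (Suc n)" and ?s = "pre (wd (Suc m) s) (Suc n)"
    have d: "?r div 3 = pre (wd (Suc m) r) n" "?s div 3 = pre (wd (Suc m) s) n" "?r mod 3 = 1" "?s mod 3 = 1"
      using nxy(1) by (simp_all add: dig_wd)
    have "rho m (\<iota> (Suc n) (x \<otimes>\<^sub>K y)) $$ (r, s) = (x \<otimes>\<^sub>K y) $$ (?r, ?s)"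
      by (rule rho_\<iota>[OF xy _ rs]) (use nxy in auto)
    also have "\<dots> = x $$ (pre (wd (Suc m) r) n, pre (wd (Suc m) s) n) * y $$ (1, 1)"
      unfolding kron_digit[OF nxy(2,3) pre_less pre_less] d ..
    also have "\<dots> = (y $$ (1, 1) \<cdot>\<^sub>m rho m (\<iota> n x)) $$ (r, s)"
      using rs nxy by (simp add: rho_\<iota> carrier_matD[OF rho_carrier] del: power_Suc)
    finally show "rho m (\<iota> (Suc n) (x \<otimes>\<^sub>K y)) $$ (r, s) = (y $$ (1, 1) \<cdot>\<^sub>m rho m (\<iota> n x)) $$ (r, s)" .
  qed
qed

lemma slice_map_sum:
  assumes R: "is_slice_map \<iota> m R" and rs: "r < 3 ^ Suc m" "s < 3 ^ Suc m"
  shows "R (\<Sum>i\<in>I. f i) $$ (r, s) = (\<Sum>i\<in>I. R (f i) $$ (r, s))"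
proof -
  have R': "range R \<subseteq> M3 (Suc m)" "\<And>a b. R (a + b) = R a + R b" "\<And>c a. R (c *\<^sub>C a) = c \<cdot>\<^sub>m R a"
    using R unfolding is_slice_map_def Suc_eq_plus1[symmetric] by auto
  have c: "R a \<in> M3 (Suc m)" for a using R'(1) by blast
  have 0: "R 0 $$ (r, s) = 0"
    using R'(3)[of 0 0] rs carrier_matD[OF c[of 0]] by (metis index_smult_mat(1) mult_zero_left scaleC_zero_left)
  show ?thesis
    by (induction I rule: infinite_finite_induct)
       (use rs carrier_matD[OF c] in \<open>simp_all add: 0 R'(2) del: power_Suc\<close>)
qed

text \<open>A matrix unit of level \<open>n + 1\<close> is the tensor product of a matrix unit of
  level \<open>n\<close> with one of size 3, so the slice rule determines the map there. Linearity
  and continuity settle the rest.\<close>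

lemma slice_map_unique:
  assumes R: "is_slice_map \<iota> m R" and R': "is_slice_map \<iota> m R'"
  shows "R = R'"
proof -
  have lin: "S a \<in> M3 (Suc m)" "S (c *\<^sub>C a) = c \<cdot>\<^sub>m S a" "x \<in> M3 (Suc m) \<Longrightarrow> S (\<iota> (Suc m) x) = x"
    "r < 3 ^ Suc m \<Longrightarrow> s < 3 ^ Suc m \<Longrightarrow> continuous_on UNIV (\<lambda>a. S a $$ (r, s))"
    "n \<ge> Suc m \<Longrightarrow> x \<in> M3 n \<Longrightarrow> y \<in> carrier_mat 3 3 \<Longrightarrow> S (\<iota> (Suc n) (x \<otimes>\<^sub>K y)) = y $$ (1, 1) \<cdot>\<^sub>m S (\<iota> n x)"
    if "is_slice_map \<iota> m S" for S a c r s n x y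
    using that unfolding is_slice_map_def Suc_eq_plus1[symmetric] by auto
  have level: "R (\<iota> n x) = R' (\<iota> n x)" if "Suc m \<le> n" "x \<in> M3 n" for n x
    using that
  proof (induction n arbitrary: x rule: dec_induct)
    case base
    then show ?case using lin(3)[OF R] lin(3)[OF R'] by simp
  next
    case (step n)
    show ?case
    proof (rule M3_eqI[OF lin(1)[OF R] lin(1)[OF R']])
      fix r s :: nat assume rs: "r < 3 ^ Suc m" "s < 3 ^ Suc m"
      have "R (\<iota> (Suc n) (munit (3 ^ Suc n) p q)) = R' (\<iota> (Suc n) (munit (3 ^ Suc n) p q))"
        if pq: "p < 3 ^ Suc n" "q < 3 ^ Suc n" for p q
        unfolding munit_kron[OF pq] using lin(5)[OF R step(1)] lin(5)[OF R' step(1)] step.IH by simp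
      then show "R (\<iota> (Suc n) x) $$ (r, s) = R' (\<iota> (Suc n) x) $$ (r, s)"
        unfolding \<iota>_expand[OF step(4)] slice_map_sum[OF R rs] slice_map_sum[OF R' rs] lin(2)[OF R] lin(2)[OF R']
        by (intro sum.cong refl) simp
    qed
  qed
  show ?thesis
  proof (rule ext, rule M3_eqI[OF lin(1)[OF R] lin(1)[OF R']])
    fix a and r s :: nat assume rs: "r < 3 ^ Suc m" "s < 3 ^ Suc m"
    have "closed {a. R a $$ (r, s) = R' a $$ (r, s)}"
      by (rule closed_Collect_eq[OF lin(4)[OF R rs] lin(4)[OF R' rs]])
    moreover have "(\<Union>n. \<iota> n ` M3 n) \<subseteq> {a. R a $$ (r, s) = R' a $$ (r, s)}"
    proof clarify
      fix n x assume "x \<in> M3 n"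
      then obtain y where "y \<in> M3 (max n (Suc m))" "\<iota> (max n (Suc m)) y = \<iota> n x"
        by (rule lift_level[of x n "max n (Suc m)"]) auto
      then show "R (\<iota> n x) $$ (r, s) = R' (\<iota> n x) $$ (r, s)" using level[of "max n (Suc m)" y] by simp
    qed
    ultimately have "closure (\<Union>n. \<iota> n ` M3 n) \<subseteq> {a. R a $$ (r, s) = R' a $$ (r, s)}" by (rule closure_minimal[rotated])
    then show "R a $$ (r, s) = R' a $$ (r, s)" using \<iota>_dense by auto
  qed
qed

lemma \<rho>_eq_rho: "\<rho> \<iota> m = rho m"
  unfolding \<rho>_def using is_slice_map_rho slice_map_unique by (intro the_equality) auto

text \<open>Placing a coefficient vector on the words with tail 1 preserves its norm, and
  restricting \<open>T a u\<close> to those words does not increase its norm.\<close>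

lemma rho_norm: "norm (\<iota> (Suc m) (rho m a)) \<le> norm a"
proof (rule norm_\<iota>_le[OF rho_carrier norm_ge_zero])
  fix v
  let ?N = "(3 :: nat) ^ Suc m"
  have "(\<Sum>r<?N. (cmod (\<Sum>s<?N. rho m a $$ (r, s) * v s))\<^sup>2) \<le> (norm a)\<^sup>2 * (\<Sum>s<?N. (cmod (v s))\<^sup>2)" for v
  proof -
    define u where "u = (\<Sum>s<?N. cscale (v s) (basis_vec (wd (Suc m) s)))"
    have uw: "ell2_fun u (wd (Suc m) s) = v s" if "s < ?N" for s
    proof -
      have "ell2_fun u (wd (Suc m) s) = (\<Sum>t<?N. if t = s then v s else 0)"
        unfolding u_def ell2_fun_sum
        by (rule sum.cong) (use that inj_onD[OF inj_on_wd[of "Suc m"]] in \<open>auto simp: basis_vec_fun simp del: power_Suc\<close>)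
      then show ?thesis using that by (simp del: power_Suc)
    qed
    have "complex_of_real ((norm u)\<^sup>2) = (\<Sum>s<?N. cnj (v s) * ell2_fun u (wd (Suc m) s))"
      unfolding cip_self_norm[symmetric]
      by (subst (2) u_def) (simp add: cip_sum_right cip_scale_right cip_basis_vec del: power_Suc)
    also have "\<dots> = complex_of_real (\<Sum>s<?N. (cmod (v s))\<^sup>2)"
      unfolding of_real_sum by (rule sum.cong) (auto simp: uw complex_norm_square mult.commute simp del: power_Suc of_real_power)
    finally have nu: "(norm u)\<^sup>2 = (\<Sum>s<?N. (cmod (v s))\<^sup>2)" using of_real_eq_iff by blast
    have "T a (\<Sum>s\<in>K. cscale (v s) (basis_vec (f s))) = (\<Sum>s\<in>K. cscale (v s) (T a (basis_vec (f s))))" if "finite K"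
      for K :: "nat set" and f
      using that by (induction K rule: finite_induct) (auto simp: T_vadd T_vscale T_vminus[of a 0 0, simplified])
    then have "(\<Sum>s<?N. rho m a $$ (r, s) * v s) = ell2_fun (T a u) (wd (Suc m) r)" if "r < ?N" for r
      using that by (simp add: u_def ell2_fun_sum rho_entry mult.commute del: power_Suc)
    then have "(\<Sum>r<?N. (cmod (\<Sum>s<?N. rho m a $$ (r, s) * v s))\<^sup>2) = (\<Sum>r<?N. (cmod (ell2_fun (T a u) (wd (Suc m) r)))\<^sup>2)"
      by (intro sum.cong) auto
    also have "\<dots> = (\<Sum>w\<in>wd (Suc m) ` {..<?N}. (cmod (ell2_fun (T a u) w))\<^sup>2)"
      by (simp only: sum.reindex[OF inj_on_wd] o_def)
    also have "\<dots> \<le> (norm (T a u))\<^sup>2" by (rule ell2_norm_sum_le) simp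
    also have "\<dots> \<le> (norm a * norm u)\<^sup>2" by (intro power_mono T_norm) auto
    finally show ?thesis by (simp only: power_mult_distrib nu)
  qed
  then show "norm (op (Suc m) (rho m a) v) \<le> norm a * norm v"
    by (rule op_bound[where M = "norm a" and n = "Suc m" and x = "rho m a" and v = v, OF norm_ge_zero]) auto
qed

text \<open>\<open>rho m\<close> is contractive and fixes all matrices of level at most
  \<open>m + 1\<close>. Hence every element is the limit of its own slices and is determined by
  them.\<close>

lemma \<iota>_rho_tendsto: "(\<lambda>m. \<iota> (Suc m) (rho m a)) \<longlonglongrightarrow> a"
proof (rule metric_LIMSEQ_I)
  fix r :: real assume r: "r > 0"
  obtain n x where x: "\<And>k. x k \<in> M3 (n k)" "(\<lambda>k. \<iota> (n k) (x k)) \<longlonglongrightarrow> a" using approx by metis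
  obtain k where k: "dist (\<iota> (n k) (x k)) a < r / 2"
    using metric_LIMSEQ_D[OF x(2), of "r / 2"] r by auto
  have "dist (\<iota> (Suc m) (rho m a)) a < r" if m: "n k \<le> m" for m
  proof -
    obtain y where y: "y \<in> M3 (Suc m)" "\<iota> (Suc m) y = \<iota> (n k) (x k)"
      by (rule lift_level[OF x(1), of k "Suc m"]) (use m in auto)
    have "\<iota> (Suc m) (rho m (a - \<iota> (Suc m) y)) = \<iota> (Suc m) (rho m a) - \<iota> (Suc m) y"
      unfolding rho_minus rho_\<iota>_Suc[OF y(1)] by (rule \<iota>_minus[OF rho_carrier y(1)])
    then have "norm (\<iota> (Suc m) (rho m a) - \<iota> (Suc m) y) \<le> norm (a - \<iota> (Suc m) y)" using rho_norm by metis
    then have "dist (\<iota> (Suc m) (rho m a)) (\<iota> (Suc m) y) < r / 2" using k y by (simp add: dist_norm norm_minus_commute)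
    then show ?thesis using k dist_triangle_half_r[of "\<iota> (Suc m) y"] y by (metis dist_commute)
  qed
  then show "\<exists>M. \<forall>m\<ge>M. dist (\<iota> (Suc m) (rho m a)) a < r" by blast
qed

end

section \<open>The algebra \<open>\<A>_infty\<close>\<close>

text \<open>Membership is expressed through the blocks of \<open>b\<close> itself, without
  existentially bound coefficients; such equations between entries persist under limits.\<close>

lemma Aset_Suc_iff:
  "b \<in> Aset (Suc n) \<longleftrightarrow> cut 1 b \<in> Aset n \<and> b = join n (\<lambda>c. cut c (cut 0 b)) (cut 1 b) \<and> b \<in> M3 (Suc (Suc n))"
proof
  assume "b \<in> Aset (Suc n)"
  then obtain y a where ya: "b = join n y a" "\<And>c. c < 3 \<Longrightarrow> y c \<in> M3 n" "a \<in> Aset n" by auto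
  have "cut c (cut 0 b) = y c" if "c < 3" for c
    using that ya Aset_carrier[OF ya(3)] by (simp add: cut_join(2) cut_dsum)
  then have "join n (\<lambda>c. cut c (cut 0 b)) a = join n y a" by (intro join_cong)
  moreover have "cut 1 b = a" unfolding ya(1) by (rule cut_join(1)[OF Aset_carrier[OF ya(3)]])
  ultimately show "cut 1 b \<in> Aset n \<and> b = join n (\<lambda>c. cut c (cut 0 b)) (cut 1 b) \<and> b \<in> M3 (Suc (Suc n))"
    using ya join_carrier[of n y a] by metis
next
  assume *: "cut 1 b \<in> Aset n \<and> b = join n (\<lambda>c. cut c (cut 0 b)) (cut 1 b) \<and> b \<in> M3 (Suc (Suc n))"
  have "cut c (cut 0 b) \<in> M3 n" for c using * cut_carrier by blast
  then have "join n (\<lambda>c. cut c (cut 0 b)) (cut 1 b) \<in> Aset (Suc n)" using * by (intro join_in_Aset) auto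
  then show "b \<in> Aset (Suc n)" using * by metis
qed

lemma Aset_0_iff: "b \<in> Aset 0 \<longleftrightarrow> b = dsum 0 (\<lambda>c. cut c b) \<and> b \<in> M3 (Suc 0)"
proof
  assume "b \<in> Aset 0"
  then obtain z where z: "b = dsum 0 z" "\<And>c. c < 3 \<Longrightarrow> z c \<in> M3 0" by auto
  have "dsum 0 (\<lambda>c. cut c b) = dsum 0 z" by (rule dsum_cong) (simp only: z cut_dsum)
  then show "b = dsum 0 (\<lambda>c. cut c b) \<and> b \<in> M3 (Suc 0)" using z dsum_carrier[of 0 z] by simp
next
  assume *: "b = dsum 0 (\<lambda>c. cut c b) \<and> b \<in> M3 (Suc 0)"
  have "\<forall>c<3. cut c b \<in> M3 0" using * cut_carrier by blast
  then show "b \<in> Aset 0" unfolding Aset.simps using * by blast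
qed

lemma cut_tendsto:
  fixes b :: "nat \<Rightarrow> complex mat"
  assumes "\<And>k. b k \<in> M3 (Suc n)" "a \<in> M3 (Suc n)" "c < 3"
    and "\<And>r s. r < 3 ^ Suc n \<Longrightarrow> s < 3 ^ Suc n \<Longrightarrow> (\<lambda>k. b k $$ (r, s)) \<longlonglongrightarrow> a $$ (r, s)"
    and "r < 3 ^ n" "s < 3 ^ n"
  shows "(\<lambda>k. cut c (b k) $$ (r, s)) \<longlonglongrightarrow> cut c a $$ (r, s)"
  unfolding cut_entry[OF assms(1) assms(5,6)] cut_entry[OF assms(2) assms(5,6)]
  by (intro assms digit_bound)

lemma Aset_closed:
  assumes "\<And>k. b k \<in> Aset n" "a \<in> M3 (Suc n)"
    "\<And>r s. r < 3 ^ Suc n \<Longrightarrow> s < 3 ^ Suc n \<Longrightarrow> (\<lambda>k. b k $$ (r, s)) \<longlonglongrightarrow> a $$ (r, s)"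
  shows "a \<in> Aset n"
  using assms
proof (induction n arbitrary: a b)
  case 0
  have "a = dsum 0 (\<lambda>c. cut c a)"
  proof (rule M3_eqI[OF 0(2) dsum_carrier])
    fix r s :: nat assume rs: "r < 3 ^ Suc 0" "s < 3 ^ Suc 0"
    note c = cut_tendsto[OF Aset_carrier[OF 0(1)] 0(2) _ 0(3) div_bound[OF rs(1)] div_bound[OF rs(2)], of "r mod 3", simplified]
    have "(\<lambda>k. dsum 0 (\<lambda>c. cut c (b k)) $$ (r, s)) \<longlonglongrightarrow> dsum 0 (\<lambda>c. cut c a) $$ (r, s)"
      unfolding dsum_entry[OF rs] using c by auto
    moreover have "dsum 0 (\<lambda>c. cut c (b k)) = b k" for k using 0(1)[of k] Aset_0_iff by metis
    ultimately show "a $$ (r, s) = dsum 0 (\<lambda>c. cut c a) $$ (r, s)" using 0(3)[OF rs] LIMSEQ_unique by simp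
  qed
  then show ?case using 0(2) Aset_0_iff by blast
next
  case (Suc n)
  have b: "b k \<in> M3 (Suc (Suc n))" for k using Aset_carrier[OF Suc(2)] .
  have c1: "(\<lambda>k. cut c (b k) $$ (r, s)) \<longlonglongrightarrow> cut c a $$ (r, s)" if "c < 3" "r < 3 ^ Suc n" "s < 3 ^ Suc n" for c r s
    by (rule cut_tendsto[OF b Suc(3) that(1) Suc(4) that(2,3)])
  have c2: "(\<lambda>k. cut d (cut c (b k)) $$ (r, s)) \<longlonglongrightarrow> cut d (cut c a) $$ (r, s)" if "c < 3" "d < 3" "r < 3 ^ n" "s < 3 ^ n" for c d r s
    by (rule cut_tendsto[OF cut_carrier[OF b] cut_carrier[OF Suc(3)] that(2) c1 that(3,4)]) (rule that(1))
  have "cut 1 a \<in> Aset n"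
    by (rule Suc.IH[of "\<lambda>k. cut 1 (b k)"]) (use Suc(2) Suc(3) c1[of 1] in \<open>auto intro: Aset_cut_1 cut_carrier simp del: power_Suc One_nat_def\<close>)
  moreover have "a = join n (\<lambda>c. cut c (cut 0 a)) (cut 1 a)"
  proof (rule M3_eqI[OF Suc(3) join_carrier])
    fix r s :: nat assume rs: "r < 3 ^ Suc (Suc n)" "s < 3 ^ Suc (Suc n)"
    note d1 = div_bound[OF rs(1)] div_bound[OF rs(2)]
    note d2 = div_bound[OF d1(1)] div_bound[OF d1(2)]
    have "(\<lambda>k. join n (\<lambda>c. cut c (cut 0 (b k))) (cut 1 (b k)) $$ (r, s)) \<longlonglongrightarrow> join n (\<lambda>c. cut c (cut 0 a)) (cut 1 a) $$ (r, s)"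
      unfolding join_entry[OF rs] using c1[OF _ d1, of 1] c2[OF _ _ d2, of 0]
      by (cases "r mod 3 = s mod 3"; cases "r div 3 mod 3 = s div 3 mod 3") (simp_all del: power_Suc)
    moreover have "join n (\<lambda>c. cut c (cut 0 (b k))) (cut 1 (b k)) = b k" for k
      using Suc(2)[of k] unfolding Aset_Suc_iff by metis
    ultimately show "a $$ (r, s) = join n (\<lambda>c. cut c (cut 0 a)) (cut 1 a) $$ (r, s)"
      using Suc(4)[OF rs] LIMSEQ_unique by simp
  qed
  ultimately show ?case using Suc(3) Aset_Suc_iff by blast
qed

context uhf_three_infty
begin

lemma \<iota>_dsum_nested: "x \<in> M3 n \<Longrightarrow> \<iota> (Suc (Suc n)) (dsum (Suc n) (\<lambda>_. dsum n (\<lambda>_. x))) = \<iota> n x"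
  using \<iota>_dsum_const[OF dsum_carrier, of n "\<lambda>_. x"] \<iota>_dsum_const[of x n] by simp

text \<open>Words with tail 1 have letter 1 at the last position, so they see only the middle
  block.\<close>

lemma rho_step:
  assumes "m \<le> n" "b \<in> M3 (Suc (Suc n))"
  shows "rho m (\<iota> (Suc (Suc n)) b) = rho m (\<iota> (Suc n) (cut 1 b))"
proof (rule M3_eqI[OF rho_carrier rho_carrier])
  fix r s :: nat assume rs: "r < 3 ^ Suc m" "s < 3 ^ Suc m"
  have d: "dig (wd (Suc m) q) (Suc n) = 1" for q by (rule dig_wd) (use assms in simp)
  have "rho m (\<iota> (Suc (Suc n)) b) $$ (r, s) = b $$ (pre (wd (Suc m) r) (Suc (Suc n)), pre (wd (Suc m) s) (Suc (Suc n)))"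
    by (rule rho_\<iota>[OF assms(2) _ rs]) (use assms in simp)
  also have "\<dots> = b $$ (3 * pre (wd (Suc m) r) (Suc n) + 1, 3 * pre (wd (Suc m) s) (Suc n) + 1)"
    unfolding pre.simps(2)[of _ "Suc n"] d ..
  also have "\<dots> = cut 1 b $$ (pre (wd (Suc m) r) (Suc n), pre (wd (Suc m) s) (Suc n))"
    by (rule cut_entry[OF assms(2) pre_less pre_less, symmetric])
  also have "\<dots> = rho m (\<iota> (Suc n) (cut 1 b)) $$ (r, s)"
    by (rule rho_\<iota>[OF cut_carrier[OF assms(2)] _ rs, symmetric]) (use assms in simp)
  finally show "rho m (\<iota> (Suc (Suc n)) b) $$ (r, s) = rho m (\<iota> (Suc n) (cut 1 b)) $$ (r, s)" .
qed

lemma rho_rho: "m \<le> n \<Longrightarrow> rho m (\<iota> (Suc n) (rho n a)) = rho m a"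
proof (rule M3_eqI[OF rho_carrier rho_carrier])
  fix r s :: nat assume mn: "m \<le> n" and rs: "r < 3 ^ Suc m" "s < 3 ^ Suc m"
  have w: "wd (Suc n) (pre (wd (Suc m) q) (Suc n)) = wd (Suc m) q" for q by (rule wd_pre) (use mn in simp)
  have "rho m (\<iota> (Suc n) (rho n a)) $$ (r, s) = rho n a $$ (pre (wd (Suc m) r) (Suc n), pre (wd (Suc m) s) (Suc n))"
    by (rule rho_\<iota>[OF rho_carrier _ rs]) (use mn in simp)
  also have "\<dots> = rho m a $$ (r, s)"
    unfolding rho_entry[OF pre_less pre_less] rho_entry[OF rs] w ..
  finally show "rho m (\<iota> (Suc n) (rho n a)) $$ (r, s) = rho m a $$ (r, s)" .
qed

lemma rho_Aset:
  assumes "m \<le> n" "b \<in> Aset n"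
  shows "rho m (\<iota> (Suc n) b) \<in> Aset m"
  using assms
proof (induction n arbitrary: b rule: dec_induct)
  case base
  then show ?case by (simp only: rho_\<iota>_Suc Aset_carrier)
next
  case (step n)
  have "rho m (\<iota> (Suc (Suc n)) b) = rho m (\<iota> (Suc n) (cut 1 b))"
    using step(1) Aset_carrier[OF step(4)] by (rule rho_step)
  then show ?case using step.IH[OF Aset_cut_1[OF step(4)]] by simp
qed

text \<open>Slicing off one factor replaces a matrix by its middle block, and on these block
  diagonal matrices this respects products.\<close>

lemma rho_mult_Aset:
  assumes "m \<le> n" "a \<in> Aset n" "b \<in> Aset n"
  shows "rho m (\<iota> (Suc n) a * \<iota> (Suc n) b) = rho m (\<iota> (Suc n) a) * rho m (\<iota> (Suc n) b)"
  using assms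
proof (induction n arbitrary: a b rule: dec_induct)
  case base
  have "rho m (\<iota> (Suc m) (a * b)) = a * b" by (rule rho_\<iota>_Suc) (rule Aset_carrier[OF Aset_mult[OF base]])
  then show ?case using base by (simp only: rho_\<iota>_Suc Aset_carrier \<iota>_mult)
next
  case (step n)
  note c = Aset_carrier[OF step(4)] Aset_carrier[OF step(5)]
  have "rho m (\<iota> (Suc (Suc n)) a * \<iota> (Suc (Suc n)) b) = rho m (\<iota> (Suc (Suc n)) (a * b))"
    by (simp only: \<iota>_mult[OF c])
  also have "\<dots> = rho m (\<iota> (Suc n) (cut 1 (a * b)))"
    by (rule rho_step[OF step(1) Aset_carrier[OF Aset_mult[OF step(4,5)]]])
  also have "cut 1 (a * b) = cut 1 a * cut 1 b" by (rule cut_mult_Aset[OF step(4,5)]) simp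
  also have "\<iota> (Suc n) (cut 1 a * cut 1 b) = \<iota> (Suc n) (cut 1 a) * \<iota> (Suc n) (cut 1 b)"
    by (rule \<iota>_mult[OF cut_carrier[OF c(1)] cut_carrier[OF c(2)]])
  also have "rho m \<dots> = rho m (\<iota> (Suc n) (cut 1 a)) * rho m (\<iota> (Suc n) (cut 1 b))"
    by (rule step.IH[OF Aset_cut_1[OF step(4)] Aset_cut_1[OF step(5)]])
  finally show ?case by (simp only: rho_step[OF step(1) c(1)] rho_step[OF step(1) c(2)])
qed

text \<open>A condition on every single slice replaces the existence of an approximating sequence;
  the slices themselves form such a sequence. The algebra properties of \<open>\<A>_infty\<close>
  can then be checked slice by slice.\<close>

lemma A_infty_iff: "a \<in> \<A>_infty \<iota> \<longleftrightarrow> (\<forall>m. rho m a \<in> Aset m)"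
proof
  assume "\<forall>m. rho m a \<in> Aset m"
  then show "a \<in> \<A>_infty \<iota>"
    unfolding \<A>_infty_def \<A>_eq_Aset Suc_eq_plus1[symmetric] using \<iota>_rho_tendsto[of a]
    by (intro CollectI exI[of _ "\<lambda>m. rho m a"]) blast
next
  assume "a \<in> \<A>_infty \<iota>"
  then obtain b where b: "\<And>n. b n \<in> Aset n" "(\<lambda>n. \<iota> (Suc n) (b n)) \<longlonglongrightarrow> a"
    unfolding \<A>_infty_def \<A>_eq_Aset Suc_eq_plus1[symmetric] by blast
  show "\<forall>m. rho m a \<in> Aset m"
  proof
    fix m
    have "(\<lambda>k. \<iota> (Suc (k + m)) (b (k + m))) \<longlonglongrightarrow> a" by (rule LIMSEQ_ignore_initial_segment[OF b(2)])
    note lim = rho_tendsto[OF this]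
    show "rho m a \<in> Aset m"
    proof (rule Aset_closed[of "\<lambda>k. rho m (\<iota> (Suc (k + m)) (b (k + m)))"])
      show "rho m (\<iota> (Suc (k + m)) (b (k + m))) \<in> Aset m" for k
        by (rule rho_Aset[OF le_add2 b(1)])
    qed (fact rho_carrier lim)+
  qed
qed

abbreviation "A \<equiv> \<A>_infty \<iota>"

lemma rho_A: "a \<in> A \<Longrightarrow> rho m a \<in> Aset m"
  by (simp add: A_infty_iff)

lemma A_closed: "closed A"
  unfolding closed_sequential_limits
proof (intro allI impI)
  fix f l assume *: "(\<forall>k. f k \<in> A) \<and> f \<longlonglongrightarrow> l"
  show "l \<in> A"
    unfolding A_infty_iff
  proof
    fix m
    show "rho m l \<in> Aset m"
      by (rule Aset_closed[of "\<lambda>k. rho m (f k)"]) (use * rho_A rho_carrier rho_tendsto in blast)+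
  qed
qed

lemma A_add: "a \<in> A \<Longrightarrow> b \<in> A \<Longrightarrow> a + b \<in> A"
  by (simp add: A_infty_iff rho_add Aset_add)

lemma A_scaleC: "a \<in> A \<Longrightarrow> c *\<^sub>C a \<in> A"
  by (simp add: A_infty_iff rho_scaleC Aset_smult)

lemma A_scaleR: "a \<in> A \<Longrightarrow> r *\<^sub>R a \<in> A"
  using A_scaleC[of a "of_real r"] by (simp add: scaleC_of_real)

lemma A_uminus: "a \<in> A \<Longrightarrow> - a \<in> A"
  using A_scaleC[of a "-1"] by (simp add: scaleC_minus1)

lemma A_minus: "a \<in> A \<Longrightarrow> b \<in> A \<Longrightarrow> a - b \<in> A"
  using A_add[of a "- b"] A_uminus[of b] by simp

lemma rho_one: "rho m 1 = 1\<^sub>m (3 ^ Suc m)"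
  using rho_\<iota>_Suc[of "1\<^sub>m (3 ^ Suc m)" m] \<iota>_one[of "Suc m"] by simp

lemma A_one: "1 \<in> A"
  unfolding A_infty_iff rho_one using Aset_one by blast

lemma rho_zero: "rho m 0 = 0\<^sub>m (3 ^ Suc m) (3 ^ Suc m)"
  using rho_\<iota>_Suc[of "0\<^sub>m (3 ^ Suc m) (3 ^ Suc m)" m] \<iota>_zero[of "Suc m"] by simp

lemma A_zero: "0 \<in> A"
  unfolding A_infty_iff rho_zero using Aset_zero by blast

lemma rho_mult:
  assumes "a \<in> A" "b \<in> A"
  shows "rho m (a * b) = rho m a * rho m b"
proof (rule rho_eq_limit)
  show "(\<lambda>n. \<iota> (Suc n) (rho n a) * \<iota> (Suc n) (rho n b)) \<longlonglongrightarrow> a * b"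
    by (intro tendsto_mult \<iota>_rho_tendsto)
  show "\<forall>\<^sub>F n in sequentially. rho m (\<iota> (Suc n) (rho n a) * \<iota> (Suc n) (rho n b)) = rho m a * rho m b"
    using eventually_ge_at_top[of m]
    by eventually_elim (simp add: rho_mult_Aset rho_A assms rho_rho)
qed (rule mult_carrier_mat[OF rho_carrier rho_carrier])

lemma A_mult: "a \<in> A \<Longrightarrow> b \<in> A \<Longrightarrow> a * b \<in> A"
  by (subst A_infty_iff) (simp add: rho_mult rho_A Aset_mult)

lemma rho_star: "rho m (star a) = mat_adjoint (rho m a)"
proof (rule M3_eqI[OF rho_carrier mat_adjoint_carrier[OF rho_carrier]])
  fix r s :: nat assume rs: "r < 3 ^ Suc m" "s < 3 ^ Suc m"
  have "ell2_fun (T (star a) (basis_vec v)) w = cnj (ell2_fun (T a (basis_vec w)) v)" for v w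
  proof -
    have "ell2_fun (T (star a) (basis_vec v)) w = cip (basis_vec v) (T a (basis_vec w))"
      unfolding cip_basis_vec[symmetric] by (simp add: T_adjoint star_star)
    then show ?thesis by (metis cip_basis_vec cip_commute)
  qed
  then show "rho m (star a) $$ (r, s) = mat_adjoint (rho m a) $$ (r, s)"
    unfolding mat_adjoint_entry[OF rho_carrier rs] rho_entry[OF rs] rho_entry[OF rs(2) rs(1)] .
qed

lemma A_star: "a \<in> A \<Longrightarrow> star a \<in> A"
  by (simp add: A_infty_iff rho_star Aset_adjoint)

definition J :: "nat \<Rightarrow> 'u set" where
  "J m = {a \<in> A. rho m a = 0\<^sub>m (3 ^ Suc m) (3 ^ Suc m)}"

lemma J_A: "a \<in> J m \<Longrightarrow> a \<in> A"
  by (simp add: J_def)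

lemma J_add: "a \<in> J m \<Longrightarrow> b \<in> J m \<Longrightarrow> a + b \<in> J m"
  by (auto simp: J_def rho_add A_add simp del: power_Suc)

lemma J_scaleC: "a \<in> J m \<Longrightarrow> c *\<^sub>C a \<in> J m"
  by (auto simp: J_def rho_scaleC A_scaleC simp del: power_Suc)

lemma J_mult_left: "a \<in> A \<Longrightarrow> b \<in> J m \<Longrightarrow> a * b \<in> J m"
  using right_mult_zero_mat[OF rho_carrier] by (auto simp: J_def rho_mult A_mult simp del: power_Suc)

lemma J_minus_iff:
  assumes "a \<in> A" "b \<in> A"
  shows "a - b \<in> J m \<longleftrightarrow> rho m a = rho m b"
proof
  assume "rho m a = rho m b"
  then have "rho m (a - b) = 0\<^sub>m (3 ^ Suc m) (3 ^ Suc m)"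
    unfolding rho_minus by (intro M3_eqI) (auto simp: carrier_matD[OF rho_carrier] simp del: power_Suc intro!: add_carrier_mat smult_carrier_mat rho_carrier)
  then show "a - b \<in> J m" using assms A_minus by (simp add: J_def del: power_Suc)
next
  assume "a - b \<in> J m"
  then have 0: "rho m a + (-1) \<cdot>\<^sub>m rho m b = 0\<^sub>m (3 ^ Suc m) (3 ^ Suc m)" by (simp add: J_def rho_minus del: power_Suc)
  show "rho m a = rho m b"
  proof (rule M3_eqI[OF rho_carrier rho_carrier])
    fix r s :: nat assume rs: "r < 3 ^ Suc m" "s < 3 ^ Suc m"
    then have "(rho m a + (-1) \<cdot>\<^sub>m rho m b) $$ (r, s) = rho m a $$ (r, s) - rho m b $$ (r, s)"
      by (simp add: carrier_matD[OF rho_carrier] del: power_Suc)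
    then show "rho m a $$ (r, s) = rho m b $$ (r, s)" using rs unfolding 0 by (simp del: power_Suc)
  qed
qed

lemma J_closed: "closed (J m)"
  unfolding closed_sequential_limits
proof (intro allI impI)
  fix f l assume *: "(\<forall>k. f k \<in> J m) \<and> f \<longlonglongrightarrow> l"
  have "l \<in> A" using * J_A A_closed unfolding closed_sequential_limits by blast
  moreover have "rho m l = 0\<^sub>m (3 ^ Suc m) (3 ^ Suc m)"
    by (rule rho_eq_limit[of f]) (use * in \<open>auto simp: J_def simp del: power_Suc\<close>)
  ultimately show "l \<in> J m" by (simp add: J_def del: power_Suc)
qed

text \<open>Induction on the level: the middle block is again in the kernel, and the new
  coefficients lie in \<open>M3 n\<close> with \<open>n \<ge> m\<close>, where \<open>x\<close> may
  be multiplied in. At the lowest level the kernel is zero.\<close>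

lemma M3_mult_kernel:
  assumes "m \<le> n" "b \<in> Aset n" "rho m (\<iota> (Suc n) b) = 0\<^sub>m (3 ^ Suc m) (3 ^ Suc m)" "x \<in> M3 m"
  shows "\<exists>c\<in>Aset n. rho m (\<iota> (Suc n) c) = 0\<^sub>m (3 ^ Suc m) (3 ^ Suc m) \<and> \<iota> m x * \<iota> (Suc n) b = \<iota> (Suc n) c"
  using assms(1-3)
proof (induction n arbitrary: b rule: dec_induct)
  case base
  then have "b = 0\<^sub>m (3 ^ Suc m) (3 ^ Suc m)" using rho_\<iota>_Suc Aset_carrier by metis
  then show ?case using base by (intro bexI[of _ b]) (simp_all only: \<iota>_zero mult_zero_right rho_zero simp_thms)
next
  case (step n)
  obtain y a where ya: "b = join n y a" "\<And>c. c < 3 \<Longrightarrow> y c \<in> M3 n" "a \<in> Aset n" using step(4) by auto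
  note ac = Aset_carrier[OF ya(3)]
  have "rho m (\<iota> (Suc n) a) = rho m (\<iota> (Suc (Suc n)) b)"
    using rho_step[OF step(1) Aset_carrier[OF step(4)]] cut_join(1)[OF ac, of y] ya(1) by simp
  then obtain c where c: "c \<in> Aset n" "rho m (\<iota> (Suc n) c) = 0\<^sub>m (3 ^ Suc m) (3 ^ Suc m)" "\<iota> m x * \<iota> (Suc n) a = \<iota> (Suc n) c"
    using step.IH[OF ya(3)] step(5) by metis
  note cc = Aset_carrier[OF c(1)]
  obtain x' where x': "x' \<in> M3 n" "\<iota> n x' = \<iota> m x" by (rule lift_level[OF assms(4) step(1)]) auto
  let ?D = "dsum n (\<lambda>_. x')"
  have "\<iota> (Suc n) (?D * a) = \<iota> (Suc n) c"
    using \<iota>_mult[OF dsum_carrier ac] \<iota>_dsum_const[OF x'(1)] x'(2) c(3) by simp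
  then have Da: "?D * a = c"
    using \<iota>_inj[of "Suc n"] mult_carrier_mat[OF dsum_carrier ac] cc by (auto dest: inj_onD)
  \<comment> \<open>The multiplier has the same block \<open>?D\<close> everywhere and
    \<open>?D\<close> has the same block \<open>x'\<close> everywhere, so it respects the repetition
    of the coefficients in the outer blocks.\<close>
  have "dsum (Suc n) (\<lambda>_. ?D) * join n y a = join n (\<lambda>i. x' * y i) c"
    unfolding join_def
  proof (subst dsum_mult)
    show "dsum (Suc n) (\<lambda>c. ?D * (if c = 1 then a else if c = 0 then dsum n y else dsum n (\<lambda>a. y ((a + 1) mod 3)))) =
        dsum (Suc n) (\<lambda>i. if i = 1 then c else if i = 0 then dsum n (\<lambda>i. x' * y i) else dsum n (\<lambda>a. x' * y ((a + 1) mod 3)))"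
      by (rule dsum_cong) (use Da ya(2) x'(1) in \<open>auto simp: dsum_mult\<close>)
  qed (use ac dsum_carrier in \<open>auto simp del: power_Suc\<close>)
  then have "\<iota> m x * \<iota> (Suc (Suc n)) b = \<iota> (Suc (Suc n)) (join n (\<lambda>i. x' * y i) c)"
    using \<iota>_mult[OF dsum_carrier[of "Suc n" "\<lambda>_. ?D"] join_carrier[of n y a]] \<iota>_dsum_nested[OF x'(1)] x'(2) ya(1) by simp
  moreover have j: "join n (\<lambda>i. x' * y i) c \<in> Aset (Suc n)"
    by (rule join_in_Aset[OF _ c(1)]) (use ya(2) x'(1) in auto)
  moreover have "rho m (\<iota> (Suc (Suc n)) (join n (\<lambda>i. x' * y i) c)) = 0\<^sub>m (3 ^ Suc m) (3 ^ Suc m)"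
    unfolding rho_step[OF step(1) Aset_carrier[OF j]] cut_join(1)[OF cc] by (rule c(2))
  ultimately show ?case by blast
qed

lemma J_mult_M3:
  assumes "x \<in> M3 m" "a \<in> J m"
  shows "\<iota> m x * a \<in> J m"
proof -
  \<comment> \<open>The element chosen for \<open>n < m\<close> is a dummy; only the limit in
    \<open>n\<close> counts.\<close>
  have "\<exists>c. c \<in> Aset n \<and> (m \<le> n \<longrightarrow> rho m (\<iota> (Suc n) c) = 0\<^sub>m (3 ^ Suc m) (3 ^ Suc m) \<and>
      \<iota> m x * \<iota> (Suc n) (rho n a) = \<iota> (Suc n) c)" for n
  proof (cases "m \<le> n")
    case True
    have "rho m (\<iota> (Suc n) (rho n a)) = 0\<^sub>m (3 ^ Suc m) (3 ^ Suc m)"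
      using assms(2) rho_rho[OF True] by (simp add: J_def del: power_Suc)
    then show ?thesis using M3_mult_kernel[OF True rho_A[OF J_A[OF assms(2)]] _ assms(1)] by blast
  next
    case False
    then show ?thesis using Aset_zero by blast
  qed
  then obtain c where c: "\<And>n. c n \<in> Aset n" "\<And>n. m \<le> n \<Longrightarrow> rho m (\<iota> (Suc n) (c n)) = 0\<^sub>m (3 ^ Suc m) (3 ^ Suc m)"
      "\<And>n. m \<le> n \<Longrightarrow> \<iota> m x * \<iota> (Suc n) (rho n a) = \<iota> (Suc n) (c n)"
    by metis
  have "(\<lambda>n. \<iota> m x * \<iota> (Suc n) (rho n a)) \<longlonglongrightarrow> \<iota> m x * a"
    by (intro tendsto_mult tendsto_const \<iota>_rho_tendsto)
  then have lim: "(\<lambda>n. \<iota> (Suc n) (c n)) \<longlonglongrightarrow> \<iota> m x * a"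
    by (rule Lim_transform_eventually) (use c(3) in \<open>auto simp: eventually_sequentially intro!: exI[of _ m]\<close>)
  then have "\<iota> m x * a \<in> A"
    unfolding \<A>_infty_def \<A>_eq_Aset Suc_eq_plus1[symmetric] using c(1) by blast
  moreover have "rho m (\<iota> m x * a) = 0\<^sub>m (3 ^ Suc m) (3 ^ Suc m)"
    by (rule rho_eq_limit[OF lim]) (use c(2) in \<open>auto simp: eventually_sequentially simp del: power_Suc intro!: exI[of _ m]\<close>)
  ultimately show ?thesis by (simp add: J_def del: power_Suc)
qed

end

section \<open>Lifting elements of the finite-dimensional algebras\<close>

text \<open>Diagonal matrices act as multiplication operators on functions of words. This form
  survives the passage to limits and gives control over explicit elements of
  \<open>J m\<close>.\<close>

definition diagm :: "nat \<Rightarrow> complex mat \<Rightarrow> bool" where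
  "diagm n x \<longleftrightarrow> (\<forall>r<3 ^ n. \<forall>s<3 ^ n. r \<noteq> s \<longrightarrow> x $$ (r, s) = 0)"

lemma opf_diagm:
  assumes "diagm n x"
  shows "opf n x v w = x $$ (pre w n, pre w n) * ell2_fun v w"
proof -
  have "opf n x v w = (\<Sum>s<3 ^ n. if s = pre w n then x $$ (pre w n, pre w n) * ell2_fun v w else 0)"
    unfolding opf_def by (rule sum.cong) (use assms pre_less[of w n] in \<open>auto simp: diagm_def\<close>)
  then show ?thesis using pre_less[of w n] by simp
qed

lemma diagm_cut: "diagm (Suc n) b \<Longrightarrow> b \<in> M3 (Suc n) \<Longrightarrow> c < 3 \<Longrightarrow> diagm n (cut c b)"
  unfolding diagm_def using digit_bound by (auto simp: cut_entry simp del: power_Suc)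

lemma diagm_dsum:
  assumes "\<And>c. c < 3 \<Longrightarrow> diagm n (z c)"
  shows "diagm (Suc n) (dsum n z)"
  unfolding diagm_def
proof (intro allI impI)
  fix r s :: nat assume rs: "r < 3 ^ Suc n" "s < 3 ^ Suc n" "r \<noteq> s"
  have "r div 3 \<noteq> s div 3" if "r mod 3 = s mod 3" using that rs(3) by (metis div_mult_mod_eq)
  then show "dsum n z $$ (r, s) = 0"
    using assms[of "r mod 3"] assms[of "s mod 3"] div_bound[OF rs(1)] div_bound[OF rs(2)]
    unfolding dsum_entry[OF rs(1,2)] diagm_def by simp
qed

lemma diagm_join: "(\<And>c. c < 3 \<Longrightarrow> diagm n (y c)) \<Longrightarrow> diagm (Suc n) b \<Longrightarrow> diagm (Suc (Suc n)) (join n y b)"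
  unfolding join_def by (intro diagm_dsum) (auto intro!: diagm_dsum)

text \<open>The element of \<open>\<A> (n + 1)\<close> over \<open>b \<in> \<A> n\<close> whose new coefficients average the two diagonal
  blocks of \<open>b\<close> that they have to approximate. Each step halves the distance between blocks.\<close>

definition interp :: "nat \<Rightarrow> complex mat \<Rightarrow> complex mat" where
  "interp n b = join n (\<lambda>c. (1 / 2) \<cdot>\<^sub>m (cut c b + cut ((c + 2) mod 3) b)) b"

lemma interp_Aset: "b \<in> Aset n \<Longrightarrow> interp n b \<in> Aset (Suc n)"
  unfolding interp_def
  by (rule join_in_Aset) (auto intro!: smult_carrier_mat add_carrier_mat cut_carrier Aset_carrier simp del: power_Suc)

lemma diagm_interp:
  assumes b: "b \<in> Aset n" "diagm (Suc n) b"
  shows "diagm (Suc (Suc n)) (interp n b)"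
  unfolding interp_def
proof (rule diagm_join[OF _ b(2)])
  fix c :: nat assume c: "c < 3"
  have d: "diagm n ((1 / 2) \<cdot>\<^sub>m (p + q))" if "p \<in> M3 n" "q \<in> M3 n" "diagm n p" "diagm n q" for p q
    using that unfolding diagm_def by auto
  have "cut c b \<in> M3 n" "diagm n (cut c b)" if "c < 3" for c
    using cut_carrier[OF Aset_carrier[OF b(1)]] diagm_cut[OF b(2) Aset_carrier[OF b(1)] that] by auto
  then show "diagm n ((1 / 2) \<cdot>\<^sub>m (cut c b + cut ((c + 2) mod 3) b))" using c by (intro d) auto
qed

context uhf_three_infty
begin

text \<open>Measures how far \<open>b\<close> is from a matrix \<open>x \<otimes> 1\<close>, whose
  three blocks coincide. It controls the distance between \<open>b\<close> and its lift.\<close>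

definition gap :: "nat \<Rightarrow> complex mat \<Rightarrow> real \<Rightarrow> bool" where
  "gap n b \<delta> \<longleftrightarrow> (\<forall>c<3. \<forall>d<3. norm (\<iota> n (cut c b) - \<iota> n (cut d b)) \<le> \<delta>)"

lemma gap_exists: "\<exists>\<delta>. gap n b \<delta>"
proof -
  let ?g = "\<lambda>c d. norm (\<iota> n (cut c b) - \<iota> n (cut d b))"
  have "?g c d \<le> (\<Sum>c<3. \<Sum>d<3. ?g c d)" if "c < 3" "d < 3" for c d
  proof -
    have "?g c d \<le> (\<Sum>d<3. ?g c d)" by (rule member_le_sum) (use that in auto)
    also have "\<dots> \<le> (\<Sum>c<3. \<Sum>d<3. ?g c d)"
      by (rule member_le_sum[where f = "\<lambda>c. \<Sum>d<3. ?g c d"]) (use that in \<open>auto intro: sum_nonneg\<close>)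
    finally show ?thesis .
  qed
  then show ?thesis unfolding gap_def by blast
qed

text \<open>Let \<open>z c\<close> be the blocks of \<open>b\<close>. For \<open>join n Y b\<close>
  to be close to \<open>b \<otimes> 1\<close>, the coefficient \<open>Y c\<close> must be close to
  \<open>z c\<close> because of block 0 and to \<open>z ((c + 2) mod 3)\<close> because of block 2.
  With the average, each difference between blocks of the new element is, component by component,
  half a difference of two blocks of \<open>b\<close>.\<close>

lemma interp_gap:
  assumes b: "b \<in> Aset n" and gap: "gap n b \<delta>"
  shows "gap (Suc n) (interp n b) (\<delta> / 2)"
    and "norm (\<iota> (Suc (Suc n)) (interp n b) - \<iota> (Suc n) b) \<le> \<delta> / 2"
proof -
  define z where "z c = cut c b" for c
  define Y where "Y c = (1 / 2) \<cdot>\<^sub>m (z c + z ((c + 2) mod 3))" for c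
  note bc = Aset_carrier[OF b]
  have z: "z c \<in> M3 n" for c unfolding z_def by (rule cut_carrier[OF bc])
  have Y: "Y c \<in> M3 n" for c unfolding Y_def by (intro smult_carrier_mat add_carrier_mat z)
  obtain z' where z': "b = dsum n z'" "\<And>c. c < 3 \<Longrightarrow> z' c \<in> M3 n" by (rule Aset_dsum[OF b]) auto
  have bz: "b = dsum n z" unfolding z'(1) by (rule dsum_cong) (simp add: z_def z' cut_dsum)
  have \<iota>Y: "\<iota> n (Y c) = (1 / 2) *\<^sub>R (\<iota> n (z c) + \<iota> n (z ((c + 2) mod 3)))" for c
  proof -
    have "\<iota> n (Y c) = complex_of_real (1 / 2) *\<^sub>C (\<iota> n (z c) + \<iota> n (z ((c + 2) mod 3)))"
      unfolding Y_def \<iota>_smult[OF add_carrier_mat[OF z]] \<iota>_add[OF z z] by simp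
    then show ?thesis by (simp only: scaleC_of_real)
  qed
  have half: "norm ((1 / 2) *\<^sub>R (\<iota> n (z c) - \<iota> n (z d))) \<le> \<delta> / 2" if "c < 3" "d < 3" for c d
    using gap that unfolding gap_def z_def by simp
  let ?Y' = "\<lambda>a. Y ((a + 1) mod 3)"
  have A: "norm (\<iota> (Suc n) (dsum n Y) - \<iota> (Suc n) b) \<le> \<delta> / 2"
    unfolding bz
  proof (rule norm_dsum_diff_le[OF Y z])
    fix c :: nat assume c: "c < 3"
    have "\<iota> n (Y c) - \<iota> n (z c) = (1 / 2) *\<^sub>R (\<iota> n (z ((c + 2) mod 3)) - \<iota> n (z c))"
      unfolding \<iota>Y by (simp add: algebra_simps) (simp add: scaleR_add_left[symmetric])
    then show "norm (\<iota> n (Y c) - \<iota> n (z c)) \<le> \<delta> / 2" using half[of "(c + 2) mod 3" c] c by simp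
  qed
  have cyc: "((c + 1) mod 3 + 2) mod 3 = c" if "c < 3" for c :: nat
    using less_3_cases[OF that] by auto
  have B: "norm (\<iota> (Suc n) (dsum n ?Y') - \<iota> (Suc n) b) \<le> \<delta> / 2"
    unfolding bz
  proof (rule norm_dsum_diff_le[OF Y z])
    fix c :: nat assume c: "c < 3"
    have "\<iota> n (?Y' c) - \<iota> n (z c) = (1 / 2) *\<^sub>R (\<iota> n (z ((c + 1) mod 3)) - \<iota> n (z c))"
      unfolding \<iota>Y cyc[OF c] by (simp add: algebra_simps) (simp add: scaleR_add_left[symmetric])
    then show "norm (\<iota> n (?Y' c) - \<iota> n (z c)) \<le> \<delta> / 2" using half[of "(c + 1) mod 3" c] c by simp
  qed
  have C: "norm (\<iota> (Suc n) (dsum n Y) - \<iota> (Suc n) (dsum n ?Y')) \<le> \<delta> / 2"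
  proof (rule norm_dsum_diff_le[OF Y Y])
    fix c :: nat assume c: "c < 3"
    have "\<iota> n (Y c) - \<iota> n (?Y' c) = (1 / 2) *\<^sub>R (\<iota> n (z ((c + 2) mod 3)) - \<iota> n (z ((c + 1) mod 3)))"
      unfolding \<iota>Y cyc[OF c] by (simp add: algebra_simps)
    then show "norm (\<iota> n (Y c) - \<iota> n (?Y' c)) \<le> \<delta> / 2" using half[of "(c + 2) mod 3" "(c + 1) mod 3"] by simp
  qed
  have int: "interp n b = join n Y b" unfolding interp_def Y_def z_def ..
  have \<delta>0: "0 \<le> \<delta> / 2" using half[of 0 0] by simp
  show "gap (Suc n) (interp n b) (\<delta> / 2)"
    unfolding gap_def
  proof (intro allI impI)
    fix c d :: nat assume "c < 3" "d < 3"
    note cd = less_3_cases[OF this(1)] less_3_cases[OF this(2)]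
    note cuts = cut_join[OF bc, of Y, folded int]
    show "norm (\<iota> (Suc n) (cut c (interp n b)) - \<iota> (Suc n) (cut d (interp n b))) \<le> \<delta> / 2"
      using cd by (elim disjE) (simp_all only: cuts A B C \<delta>0 diff_self norm_zero
          norm_minus_commute[of "\<iota> (Suc n) b"] norm_minus_commute[of "\<iota> (Suc n) (dsum n ?Y')" "\<iota> (Suc n) (dsum n Y)"])
  qed
  have "norm (\<iota> (Suc (Suc n)) (join n Y b) - \<iota> (Suc (Suc n)) (dsum (Suc n) (\<lambda>_. b))) \<le> \<delta> / 2"
    unfolding join_def
    by (rule norm_dsum_diff_le) (use A B \<delta>0 bc dsum_carrier in \<open>auto simp del: power_Suc\<close>)
  then show "norm (\<iota> (Suc (Suc n)) (interp n b) - \<iota> (Suc n) b) \<le> \<delta> / 2"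
    by (simp only: int \<iota>_dsum_const[OF bc])
qed

text \<open>Averaging is iterated. Step \<open>k\<close> moves by at most
  \<open>\<delta> / 2 ^ (k + 1)\<close>, which sums to \<delta>, while the slice at level
  \<open>n\<close> never changes because each step keeps the old element as its middle
  block.\<close>

lemma lift_near:
  assumes b: "b \<in> Aset n" and gap: "gap n b \<delta>"
  obtains a where "a \<in> A" "rho n a = b" "norm (a - \<iota> (Suc n) b) \<le> \<delta>"
    "diagm (Suc n) b \<Longrightarrow> \<exists>f. \<forall>v w. ell2_fun (T a v) w = f w * ell2_fun v w"
proof -
  define bs where "bs = rec_nat b (\<lambda>k. interp (n + k))"
  have bs_0: "bs 0 = b" and bs_Suc: "bs (Suc k) = interp (n + k) (bs k)" for k by (simp_all add: bs_def)
  have bsA: "bs k \<in> Aset (n + k)" for k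
    by (induction k) (use b interp_Aset in \<open>simp_all add: bs_0 bs_Suc del: Aset.simps\<close>)
  have bsg: "gap (n + k) (bs k) (\<delta> / 2 ^ k)" for k
  proof (induction k)
    case (Suc k)
    then show ?case using interp_gap(1)[OF bsA Suc] by (simp add: bs_Suc mult.commute)
  qed (simp add: bs_0 gap)
  define u where "u k = \<iota> (Suc (n + k)) (bs k)" for k
  have step: "norm (u (Suc k) - u k) \<le> \<delta> / 2 * (1 / 2) ^ k" for k
    using interp_gap(2)[OF bsA bsg, of k] by (simp add: u_def bs_Suc power_one_over field_simps)
  have "summable (\<lambda>k. u (Suc k) - u k)"
    by (rule summable_comparison_test[of _ "\<lambda>k. \<delta> / 2 * (1 / 2) ^ k"]) (use step in \<open>auto intro!: summable_mult\<close>)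
  then obtain s where "(\<lambda>k. u (Suc k) - u k) sums s" unfolding summable_def by blast
  then have "(\<lambda>K. u K - u 0) \<longlonglongrightarrow> s" unfolding sums_def by (simp add: sum_lessThan_telescope)
  then have "(\<lambda>K. (u K - u 0) + u 0) \<longlonglongrightarrow> s + u 0" by (intro tendsto_add tendsto_const)
  then obtain a where a: "u \<longlonglongrightarrow> a" by auto
  have bound: "norm (u K - u 0) \<le> \<delta> * (1 - (1 / 2) ^ K)" for K
  proof (induction K)
    case (Suc K)
    have "norm (u (Suc K) - u 0) \<le> norm (u (Suc K) - u K) + norm (u K - u 0)"
      using norm_triangle_ineq[of "u (Suc K) - u K" "u K - u 0"] by simp
    then show ?case using step[of K] Suc by (simp add: algebra_simps)
  qed simp
  have "0 \<le> \<delta> / 2 * (1 / 2) ^ 0" by (rule order_trans[OF norm_ge_zero step])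
  then have "0 \<le> \<delta>" by simp
  then have "norm (u K - u 0) \<le> \<delta>" for K
    by (rule order_trans[OF bound mult_right_le_one_le]) (auto simp: power_le_one)
  then have 3: "norm (a - \<iota> (Suc n) b) \<le> \<delta>"
    using LIMSEQ_le_const2[OF tendsto_norm[OF tendsto_diff[OF a tendsto_const[of "u 0"]]], of \<delta>]
    by (auto simp: u_def bs_0)
  have 1: "a \<in> A"
    unfolding A_infty_iff
  proof
    fix m
    have "(\<lambda>k. u (k + m)) \<longlonglongrightarrow> a" by (rule LIMSEQ_ignore_initial_segment[OF a])
    note lim = rho_tendsto[OF this]
    show "rho m a \<in> Aset m"
    proof (rule Aset_closed[of "\<lambda>k. rho m (u (k + m))"])
      show "rho m (u (k + m)) \<in> Aset m" for k
        unfolding u_def by (rule rho_Aset[OF _ bsA]) simp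
    qed (fact rho_carrier lim)+
  qed
  have "rho n (u k) = b" for k
  proof (induction k)
    case 0
    show ?case unfolding u_def bs_0 using rho_\<iota>_Suc[OF Aset_carrier[OF b]] by simp
  next
    case (Suc k)
    have "cut 1 (bs (Suc k)) = bs k"
      unfolding bs_Suc interp_def by (rule cut_join(1)[OF Aset_carrier[OF bsA]])
    then show ?case
      using rho_step[of n "n + k" "bs (Suc k)"] Aset_carrier[OF bsA[of "Suc k"]] Suc by (simp add: u_def)
  qed
  then have 2: "rho n a = b"
    by (intro rho_eq_limit[OF a _ Aset_carrier[OF b]]) simp
  have 4: "\<exists>f. \<forall>v w. ell2_fun (T a v) w = f w * ell2_fun v w" if d: "diagm (Suc n) b"
  proof (intro exI allI)
    fix v w
    have bsd: "diagm (Suc (n + k)) (bs k)" for k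
      by (induction k) (use d bsA diagm_interp in \<open>auto simp: bs_0 bs_Suc\<close>)
    define f where "f k = bs k $$ (pre w (Suc (n + k)), pre w (Suc (n + k)))" for k
    have Tu: "ell2_fun (T (u k) v) w = f k * ell2_fun v w" for k v
      unfolding u_def T_\<iota>[OF Aset_carrier[OF bsA]] op_fun[OF Aset_carrier[OF bsA]] f_def by (rule opf_diagm[OF bsd])
    \<comment> \<open>Convergence of the diagonal entries is read off from the basis vector at
      \<open>w\<close>, so the limit does not depend on \<open>v\<close>.\<close>
    have "(\<lambda>k. f k * 1) \<longlonglongrightarrow> ell2_fun (T a (basis_vec w)) w"
      using ell2_fun_tendsto[OF T_tendsto[OF a], of "basis_vec w" w] unfolding Tu by (simp add: basis_vec_fun)
    then have "(\<lambda>k. f k * ell2_fun v w) \<longlonglongrightarrow> ell2_fun (T a (basis_vec w)) w * ell2_fun v w"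
      by (intro tendsto_mult tendsto_const) simp
    moreover have "(\<lambda>k. f k * ell2_fun v w) \<longlonglongrightarrow> ell2_fun (T a v) w"
      using ell2_fun_tendsto[OF T_tendsto[OF a], of v w] unfolding Tu .
    ultimately show "ell2_fun (T a v) w = ell2_fun (T a (basis_vec w)) w * ell2_fun v w" by (rule LIMSEQ_unique[rotated])
  qed
  show ?thesis by (rule that[OF 1 2 3 4])
qed

lemma lift:
  assumes "b \<in> Aset n"
  obtains a where "a \<in> A" "rho n a = b"
proof -
  obtain \<delta> where "gap n b \<delta>" using gap_exists by blast
  then show ?thesis by (rule lift_near[OF assms]) (rule that)
qed

end

section \<open>The simple summands\<close>

text \<open>The \<open>j\<close>-th block (\<open>j < 3\<close>) of \<open>\<A> m\<close> that is not a block of \<open>\<A> (m - 1)\<close>: the character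
  \<open>\<xi>\<^sub>j\<close> for \<open>m = 0\<close>, and \<open>\<eta>\<^sub>m\<^sub>-\<^sub>1\<^sub>,\<^sub>j\<close> for \<open>m > 0\<close>. Its values are matrices of size \<open>3 ^ (m - 1)\<close>,
  where \<open>0 - 1 = 0\<close>.\<close>

definition blk :: "nat \<Rightarrow> nat \<Rightarrow> complex mat \<Rightarrow> complex mat" where
  "blk m j b = (if m = 0 then cut j b else cut j (cut 0 b))"

text \<open>A section of \<open>blk m j\<close> with all other coefficients zero. Its range is an
  ideal of \<open>\<A> m\<close>, one of the simple summands.\<close>

definition emb :: "nat \<Rightarrow> nat \<Rightarrow> complex mat \<Rightarrow> complex mat" where
  "emb m j z = (let y = (\<lambda>c. if c = j then z else 0\<^sub>m (3 ^ (m - 1)) (3 ^ (m - 1))) in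
     if m = 0 then dsum 0 y else join (m - 1) y (0\<^sub>m (3 ^ m) (3 ^ m)))"

lemma emb_0: "emb 0 j z = dsum 0 (\<lambda>c. if c = j then z else 0\<^sub>m (3 ^ 0) (3 ^ 0))"
  by (simp add: emb_def cong: if_cong)

lemma emb_Suc: "emb (Suc n) j z = join n (\<lambda>c. if c = j then z else 0\<^sub>m (3 ^ n) (3 ^ n)) (0\<^sub>m (3 ^ Suc n) (3 ^ Suc n))"
  by (simp add: emb_def cong: if_cong)

lemma emb_Aset: "z \<in> M3 (m - 1) \<Longrightarrow> emb m j z \<in> Aset m"
proof (cases m)
  case (Suc n)
  assume "z \<in> M3 (m - 1)"
  then show ?thesis unfolding Suc emb_Suc by (intro join_in_Aset Aset_zero) auto
qed (auto simp: emb_0)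

lemma blk_carrier:
  assumes "b \<in> Aset m"
  shows "blk m j b \<in> M3 (m - 1)"
proof (cases m)
  case 0
  then show ?thesis using cut_carrier[OF Aset_carrier[of b 0], of j] assms by (simp add: blk_def del: Aset.simps)
next
  case (Suc n)
  then have "cut j (cut 0 b) \<in> M3 n" by (intro cut_carrier Aset_carrier) (use assms in simp)
  then show ?thesis using Suc by (simp add: blk_def)
qed

lemma blk_emb: "j < 3 \<Longrightarrow> z \<in> M3 (m - 1) \<Longrightarrow> blk m j (emb m j z) = z"
proof (cases m)
  case (Suc n)
  assume "j < 3" "z \<in> M3 (m - 1)"
  then show ?thesis
    unfolding Suc emb_Suc blk_def cut_join(2)[OF zero_carrier_mat] by (simp add: cut_dsum)
qed (simp add: emb_0 blk_def cut_dsum)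

lemma emb_mult:
  assumes b: "b \<in> Aset m" and j: "j < 3" and z: "z \<in> M3 (m - 1)"
  shows "b * emb m j z = emb m j (blk m j b * z)" and "emb m j z * b = emb m j (z * blk m j b)"
proof -
  have "b * emb m j z = emb m j (blk m j b * z) \<and> emb m j z * b = emb m j (z * blk m j b)"
  proof (cases m)
    case 0
    then obtain x where x: "b = dsum 0 x" "\<And>c. c < 3 \<Longrightarrow> x c \<in> M3 0" using b by auto
    have "blk m j b = x j" using 0 j x by (simp add: blk_def cut_dsum)
    then show ?thesis
      unfolding 0 emb_0 x(1)
      by (subst dsum_mult dsum_mult) (use x(2) z j 0 in \<open>auto simp: dsum_mult intro!: dsum_cong right_mult_zero_mat left_mult_zero_mat\<close>)
  next
    case (Suc n)
    then obtain y a where y: "b = join n y a" "\<And>c. c < 3 \<Longrightarrow> y c \<in> M3 n" "a \<in> Aset n" using b by auto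
    have yj: "blk m j b = y j"
      using Suc j y by (simp add: blk_def cut_join(2)[OF Aset_carrier[OF y(3)]] cut_dsum)
    have zn: "z \<in> M3 n" using z Suc by simp
    let ?z = "\<lambda>c. if c = j then z else 0\<^sub>m (3 ^ n) (3 ^ n)" and ?O = "0\<^sub>m (3 ^ Suc n) (3 ^ Suc n) :: complex mat"
    have zc: "?z c \<in> M3 n" for c using zn by simp
    have "join n y a * join n ?z ?O = join n (\<lambda>c. y c * ?z c) (a * ?O)"
      by (rule join_mult[OF y(2) zc Aset_carrier[OF y(3)] zero_carrier_mat])
    also have "\<dots> = join n (\<lambda>c. if c = j then y j * z else 0\<^sub>m (3 ^ n) (3 ^ n)) ?O"
      unfolding right_mult_zero_mat[OF Aset_carrier[OF y(3)]] by (rule join_cong) (use y(2) in \<open>auto intro!: right_mult_zero_mat\<close>)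
    finally have s: "join n y a * join n ?z ?O = join n (\<lambda>c. if c = j then y j * z else 0\<^sub>m (3 ^ n) (3 ^ n)) ?O" .
    have 1: "b * emb m j z = emb m j (blk m j b * z)" by (simp only: yj) (simp only: y(1) Suc emb_Suc s)
    have "join n ?z ?O * join n y a = join n (\<lambda>c. ?z c * y c) (?O * a)"
      by (rule join_mult[OF zc y(2) zero_carrier_mat Aset_carrier[OF y(3)]])
    also have "\<dots> = join n (\<lambda>c. if c = j then z * y j else 0\<^sub>m (3 ^ n) (3 ^ n)) ?O"
      unfolding left_mult_zero_mat[OF Aset_carrier[OF y(3)]] by (rule join_cong) (use y(2) in \<open>auto intro!: left_mult_zero_mat\<close>)
    finally have s: "join n ?z ?O * join n y a = join n (\<lambda>c. if c = j then z * y j else 0\<^sub>m (3 ^ n) (3 ^ n)) ?O" .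
    have "emb m j z * b = emb m j (z * blk m j b)" by (simp only: yj) (simp only: y(1) Suc emb_Suc s)
    with 1 show ?thesis ..
  qed
  then show "b * emb m j z = emb m j (blk m j b * z)" "emb m j z * b = emb m j (z * blk m j b)" by auto
qed

lemma emb_add:
  assumes "z \<in> M3 (m - 1)" "z' \<in> M3 (m - 1)"
  shows "emb m j z + emb m j z' = emb m j (z + z')"
proof (cases m)
  case 0
  show ?thesis unfolding 0 emb_0
    by (subst dsum_add) (use assms 0 in \<open>auto intro!: dsum_cong\<close>)
next
  case (Suc n)
  show ?thesis unfolding Suc emb_Suc
    by (subst join_add) (use assms Suc in \<open>auto intro!: arg_cong2[where f = "join n"]\<close>)
qed

lemma emb_smult:
  assumes "z \<in> M3 (m - 1)"
  shows "k \<cdot>\<^sub>m emb m j z = emb m j (k \<cdot>\<^sub>m z)"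
proof (cases m)
  case 0
  show ?thesis unfolding 0 emb_0
    by (subst dsum_smult) (use assms 0 in \<open>auto intro!: dsum_cong\<close>)
next
  case (Suc n)
  show ?thesis unfolding Suc emb_Suc
    by (subst join_smult) (use assms Suc in \<open>auto intro!: arg_cong2[where f = "join n"]\<close>)
qed

text \<open>A vanishing middle block characterizes the kernel of
  \<open>\<A> m \<rightarrow> \<A> (m - 1)\<close>. For \<open>m = 0\<close> no condition remains,
  as three characters exhaust the algebra.\<close>

lemma emb_sum:
  assumes b: "b \<in> Aset m" and "m > 0 \<Longrightarrow> cut 1 b = 0\<^sub>m (3 ^ m) (3 ^ m)"
  shows "emb m 0 (blk m 0 b) + emb m 1 (blk m 1 b) + emb m 2 (blk m 2 b) = b"
proof (cases m)
  case 0
  then obtain x where x: "b = dsum 0 x" "\<And>c. c < 3 \<Longrightarrow> x c \<in> M3 0" using b by auto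
  have "blk m c b = x c" if "c < 3" for c using that 0 x by (simp add: blk_def cut_dsum)
  then show ?thesis
    unfolding 0 emb_0 x(1) using x(2)[of 0] x(2)[of 1] x(2)[of 2]
    by (subst dsum_add, simp, simp, subst dsum_add, simp, simp) (auto intro!: dsum_cong dest!: less_3_cases)
next
  case (Suc n)
  then obtain y a where y: "b = join n y a" "\<And>c. c < 3 \<Longrightarrow> y c \<in> M3 n" "a \<in> Aset n" using b by auto
  have yc: "blk m c b = y c" if "c < 3" for c
    using that Suc y by (simp add: blk_def cut_join(2)[OF Aset_carrier[OF y(3)]] cut_dsum)
  have a0: "a = 0\<^sub>m (3 ^ Suc n) (3 ^ Suc n)" using assms(2) cut_join(1)[OF Aset_carrier[OF y(3)], of y] y(1) Suc by simp
  let ?z = "\<lambda>j c. if c = j then y j else 0\<^sub>m (3 ^ n) (3 ^ n)" and ?O = "0\<^sub>m (3 ^ Suc n) (3 ^ Suc n) :: complex mat"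
  have zc: "?z j c \<in> M3 n" if "j < 3" for j c using y(2) that by simp
  have "join n (?z 0) ?O + join n (?z 1) ?O = join n (\<lambda>c. ?z 0 c + ?z 1 c) (?O + ?O)"
    by (rule join_add[OF zc zc zero_carrier_mat zero_carrier_mat]) simp_all
  moreover have "join n (\<lambda>c. ?z 0 c + ?z 1 c) (?O + ?O) + join n (?z 2) ?O =
      join n (\<lambda>c. ?z 0 c + ?z 1 c + ?z 2 c) (?O + ?O + ?O)"
    by (rule join_add[OF add_carrier_mat[OF zc] zc add_carrier_mat[OF zero_carrier_mat] zero_carrier_mat]) simp_all
  ultimately have "join n (?z 0) ?O + join n (?z 1) ?O + join n (?z 2) ?O = join n (\<lambda>c. ?z 0 c + ?z 1 c + ?z 2 c) (?O + ?O + ?O)"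
    by simp
  also have "\<dots> = join n y a"
  proof -
    have "join n (\<lambda>c. ?z 0 c + ?z 1 c + ?z 2 c) ?O = join n y ?O"
      by (rule join_cong) (use y(2)[of 0] y(2)[of 1] y(2)[of 2] in \<open>auto dest!: less_3_cases\<close>)
    then show ?thesis unfolding a0 by (simp del: power_Suc)
  qed
  finally have *: "join n (?z 0) ?O + join n (?z 1) ?O + join n (?z 2) ?O = b" unfolding y(1) .
  have e: "blk m 0 b = y 0" "blk m 1 b = y 1" "blk m 2 b = y 2" by (rule yc; simp)+
  show ?thesis by (simp only: e) (simp only: Suc emb_Suc *)
qed

context uhf_three_infty
begin

lemma op_dsum_support:
  assumes z: "\<And>c. c < 3 \<Longrightarrow> z c \<in> M3 n" and c: "c < 3" and v: "\<And>w. dig w n \<noteq> c \<Longrightarrow> ell2_fun v w = 0"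
  shows "op (Suc n) (dsum n z) v = op n (z c) v"
proof (rule ell2_eqI)
  fix w
  have 0: "opf n x v w = 0" if "dig w n \<noteq> c" for x
    unfolding opf_def using that by (simp add: v dig_rep)
  have o: "opf (Suc n) (dsum n z) v w = opf n (z (dig w n)) v w" by (rule opf_dsum) (rule z)
  show "ell2_fun (op (Suc n) (dsum n z) v) w = ell2_fun (op n (z c) v) w"
    unfolding op_fun[OF dsum_carrier] op_fun[OF z[OF c]] o
    by (cases "dig w n = c") (simp_all add: 0)
qed

lemma cut_rho_Suc: "cut 1 (rho (Suc n) a) = rho n a"
proof -
  have "rho n a = rho n (\<iota> (Suc (Suc n)) (rho (Suc n) a))" by (rule rho_rho[symmetric]) simp
  also have "\<dots> = rho n (\<iota> (Suc n) (cut 1 (rho (Suc n) a)))" by (rule rho_step[OF _ rho_carrier]) simp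
  also have "\<dots> = cut 1 (rho (Suc n) a)" by (rule rho_\<iota>_Suc[OF cut_carrier[OF rho_carrier]])
  finally show ?thesis ..
qed

text \<open>Vectors with tail 1 see only the middle block at every level beyond \<open>m\<close>, so
  the approximants \<open>\<iota> (Suc n) (rho n a)\<close> act on them in the same way for all
  \<open>n \<ge> m\<close>.\<close>

lemma T_tail:
  assumes a: "a \<in> A" and v: "\<And>w i. i > m \<Longrightarrow> dig w i \<noteq> 1 \<Longrightarrow> ell2_fun v w = 0"
  shows "T a v = op (Suc m) (rho m a) v"
proof -
  have step: "op (Suc n) (rho n a) v = op (Suc m) (rho m a) v" if "m \<le> n" for n
    using that
  proof (induction n rule: dec_induct)
    case (step n)
    obtain z where z: "rho (Suc n) a = dsum (Suc n) z" "\<And>c. c < 3 \<Longrightarrow> z c \<in> M3 (Suc n)"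
      by (rule Aset_dsum[OF rho_A[OF a, of "Suc n"]]) blast
    have "z 1 = rho n a" using cut_rho_Suc[of n a] cut_dsum[of 1 z "Suc n"] z by simp
    moreover have "op (Suc (Suc n)) (dsum (Suc n) z) v = op (Suc n) (z 1) v"
      by (rule op_dsum_support[OF z(2)]) (use v[of "Suc n"] step(1) in auto)
    ultimately show ?case using step.IH z(1) by simp
  qed simp
  have "(\<lambda>n. T (\<iota> (Suc n) (rho n a)) v) \<longlonglongrightarrow> T a v" by (rule T_tendsto[OF \<iota>_rho_tendsto])
  then have "(\<lambda>n. op (Suc n) (rho n a) v) \<longlonglongrightarrow> T a v" by (simp only: T_\<iota>[OF rho_carrier])
  moreover have "(\<lambda>n. op (Suc n) (rho n a) v) \<longlonglongrightarrow> op (Suc m) (rho m a) v"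
    by (rule tendsto_eventually, rule eventually_mono[OF eventually_ge_at_top[of m]], rule step)
  ultimately show ?thesis by (rule LIMSEQ_unique)
qed

text \<open>For \<open>m > 0\<close> the letters before position \<open>m - 1\<close> are free, then
  come \<open>j\<close>, 0 and 1 forever. For \<open>m = 0\<close> the word is \<open>j\<close>
  followed by 1 forever, since \<open>0 - 1 = 0\<close>.\<close>

definition X :: "nat \<Rightarrow> nat \<Rightarrow> digits set" where
  "X m j = {w. (\<forall>i>m. dig w i = 1) \<and> (m > 0 \<longrightarrow> dig w m = 0) \<and> dig w (m - 1) = j}"

text \<open>The tail selects \<open>rho m a\<close>. For \<open>m > 0\<close> the letter 0 at
  position \<open>m\<close> then selects an outer block and the letter \<open>j\<close> before it a
  coefficient; for \<open>m = 0\<close> the letter \<open>j\<close> selects the character.\<close>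

lemma T_block:
  assumes a: "a \<in> A" and j: "j < 3" and v: "\<And>w. w \<notin> X m j \<Longrightarrow> ell2_fun v w = 0"
  shows "T a v = op (m - 1) (blk m j (rho m a)) v"
proof -
  have T: "T a v = op (Suc m) (rho m a) v" by (rule T_tail[OF a]) (use v in \<open>auto simp: X_def\<close>)
  show ?thesis
  proof (cases m)
    case 0
    obtain z where z: "rho m a = dsum 0 z" "\<And>c. c < 3 \<Longrightarrow> z c \<in> M3 0" using rho_A[OF a, of m] 0 by auto
    have "op (Suc 0) (dsum 0 z) v = op 0 (z j) v"
      by (rule op_dsum_support[OF z(2) j]) (use v 0 in \<open>auto simp: X_def\<close>)
    then show ?thesis using T z j 0 by (simp add: blk_def cut_dsum)
  next
    case (Suc n)
    obtain y b where y: "rho m a = join n y b" "\<And>c. c < 3 \<Longrightarrow> y c \<in> M3 n" "b \<in> Aset n" using rho_A[OF a, of m] Suc by auto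
    have "op (Suc (Suc n)) (join n y b) v = op (Suc n) (dsum n y) v"
      unfolding join_def
      by (subst op_dsum_support[where c = 0]) (use v Suc Aset_carrier[OF y(3)] dsum_carrier in \<open>auto simp: X_def simp del: power_Suc\<close>)
    also have "\<dots> = op n (y j) v"
      by (rule op_dsum_support[OF y(2) j]) (use v Suc in \<open>auto simp: X_def\<close>)
    finally show ?thesis
      using T y Suc j by (simp add: blk_def cut_join(2)[OF Aset_carrier[OF y(3)]] cut_dsum)
  qed
qed

lemma op_munit_fun:
  assumes "r < 3 ^ n" "s < 3 ^ n"
  shows "ell2_fun (op n (munit (3 ^ n) r s) v) w = (if pre w n = r then ell2_fun v (rep n s w) else 0)"
proof -
  have "ell2_fun (op n (munit (3 ^ n) r s) v) w = (\<Sum>q<3 ^ n. if q = s then (if pre w n = r then ell2_fun v (rep n s w) else 0) else 0)"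
    unfolding op_fun[OF munit_carrier] opf_def by (rule sum.cong) (auto simp: munit_entry pre_less)
  then show ?thesis using assms by simp
qed

text \<open>Words of \<open>X m j\<close> differ only in their first \<open>m - 1\<close> letters,
  so one matrix unit on these letters carries \<open>w0\<close> to \<open>w\<close> and kills all
  other words of \<open>X m j\<close>.\<close>

lemma op_munit_X:
  assumes "w \<in> X m j" "w0 \<in> X m j" and v: "\<And>w. w \<notin> X m j \<Longrightarrow> ell2_fun v w = 0"
  shows "op (m - 1) (munit (3 ^ (m - 1)) (pre w (m - 1)) (pre w0 (m - 1))) v = cscale (ell2_fun v w0) (basis_vec w)"
proof (rule ell2_eqI)
  fix w'
  let ?k = "m - 1"
  have tail: "dig w1 i = dig w2 i" if "w1 \<in> X m j" "w2 \<in> X m j" "i \<ge> ?k" for w1 w2 i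
  proof -
    have "i > m \<or> i = m \<or> i = m - 1" using that(3) by auto
    then show ?thesis using that(1,2) unfolding X_def by (cases "m = 0") auto
  qed
  have inv: "rep ?k s w1 \<in> X m j \<longleftrightarrow> w1 \<in> X m j" for s w1
    unfolding X_def by (auto simp: dig_rep)
  have r: "rep ?k (pre w0 ?k) w' = w0" if "w' \<in> X m j"
    using rep_eq_iff[of "pre w0 ?k" ?k w' w0, OF pre_less] tail[OF that assms(2)] by simp
  have e: "w' = w \<longleftrightarrow> pre w' ?k = pre w ?k" if "w' \<in> X m j"
    using rep_eq_iff[of "pre w' ?k" ?k w' w, OF pre_less] tail[OF that assms(1)] by auto
  show "ell2_fun (op ?k (munit (3 ^ ?k) (pre w ?k) (pre w0 ?k)) v) w' = ell2_fun (cscale (ell2_fun v w0) (basis_vec w)) w'"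
  proof (cases "w' \<in> X m j")
    case True
    then show ?thesis by (simp add: op_munit_fun pre_less basis_vec_fun r e del: One_nat_def)
  next
    case False
    then have "ell2_fun v (rep ?k (pre w0 ?k) w') = 0" using v inv by blast
    then show ?thesis using False assms(1) by (auto simp: op_munit_fun pre_less basis_vec_fun)
  qed
qed

end

section \<open>Hilbert spaces with explicit carrier\<close>

context complex_hilbert_space
begin

interpretation VS: vectorspace class_ring V by (rule vectorspace)

lemma zero_closed': "\<zero> \<in> carrier V"
  by (rule VS.M.zero_closed)

lemma add_closed': "x \<in> carrier V \<Longrightarrow> y \<in> carrier V \<Longrightarrow> x \<oplus> y \<in> carrier V"
  by (rule VS.M.a_closed)

lemma smult_closed': "x \<in> carrier V \<Longrightarrow> c \<odot>\<^bsub>V\<^esub> x \<in> carrier V"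
  using VS.smult_closed[of c x] by (simp add: class_ring_simps)

lemma add_zero': "x \<in> carrier V \<Longrightarrow> x \<oplus> \<zero> = x"
  by (rule VS.M.r_zero)

lemma zero_smult': "x \<in> carrier V \<Longrightarrow> 0 \<odot>\<^bsub>V\<^esub> x = \<zero>"
  using VS.lmult_0[of x] by (simp add: class_ring_simps)

lemma minus_eq': "x \<in> carrier V \<Longrightarrow> y \<in> carrier V \<Longrightarrow> x \<ominus> y = x \<oplus> (-1) \<odot>\<^bsub>V\<^esub> y"
  using VS.smult_minus_1[of y] by (simp add: a_minus_def class_ring_simps)

lemma minus_closed': "x \<in> carrier V \<Longrightarrow> y \<in> carrier V \<Longrightarrow> x \<ominus> y \<in> carrier V"
  by (rule VS.M.minus_closed)

lemma minus_eq_zero': "x \<in> carrier V \<Longrightarrow> y \<in> carrier V \<Longrightarrow> x \<ominus> y = \<zero> \<longleftrightarrow> x = y"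
  by (metis VS.M.minus_closed VS.M.minus_eq VS.M.add.inv_comm VS.M.minus_equality VS.M.minus_minus VS.M.r_neg VS.M.a_inv_closed)

lemma minus_trans': "x \<in> carrier V \<Longrightarrow> y \<in> carrier V \<Longrightarrow> z \<in> carrier V \<Longrightarrow> x \<ominus> z = (x \<ominus> y) \<oplus> (y \<ominus> z)"
  by (simp add: a_minus_def VS.M.a_assoc) (simp add: VS.M.a_assoc[symmetric] VS.M.l_neg)

lemma ip_zero_left: "y \<in> carrier V \<Longrightarrow> ip \<zero> y = 0"
  using ip_smult[of \<zero> y 0] zero_closed' zero_smult'[of \<zero>] by simp

lemma ip_zero_right: "y \<in> carrier V \<Longrightarrow> ip y \<zero> = 0"
  using ip_commute[of y \<zero>] ip_zero_left zero_closed' by simp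

lemma ip_add_right: "x \<in> carrier V \<Longrightarrow> y \<in> carrier V \<Longrightarrow> z \<in> carrier V \<Longrightarrow> ip z (x \<oplus> y) = ip z x + ip z y"
  using ip_commute[of z "x \<oplus> y"] ip_commute[of z x] ip_commute[of z y] add_closed' by (simp add: ip_add)

lemma ip_smult_right: "x \<in> carrier V \<Longrightarrow> z \<in> carrier V \<Longrightarrow> ip z (c \<odot>\<^bsub>V\<^esub> x) = cnj c * ip z x"
  using ip_commute[of z "c \<odot>\<^bsub>V\<^esub> x"] ip_commute[of z x] smult_closed' by (simp add: ip_smult)

definition nrm :: "'h \<Rightarrow> real" where
  "nrm x = sqrt (Re (ip x x))"

lemma ip_self: "x \<in> carrier V \<Longrightarrow> ip x x = of_real ((nrm x)\<^sup>2)"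
  using ip_commute[of x x] ip_nonneg[of x] by (simp add: nrm_def complex_eq_iff)

lemma nrm_nonneg: "x \<in> carrier V \<Longrightarrow> 0 \<le> nrm x"
  using ip_nonneg by (simp add: nrm_def)

lemma nrm_eq_0: "x \<in> carrier V \<Longrightarrow> nrm x = 0 \<longleftrightarrow> x = \<zero>"
  using ip_self[of x] ip_definite[of x] ip_zero_left[OF zero_closed'] by (auto simp: nrm_def)

lemma nrm_smult: "x \<in> carrier V \<Longrightarrow> nrm (c \<odot>\<^bsub>V\<^esub> x) = cmod c * nrm x"
proof -
  assume x: "x \<in> carrier V"
  have "ip (c \<odot>\<^bsub>V\<^esub> x) (c \<odot>\<^bsub>V\<^esub> x) = c * cnj c * ip x x"
    using x smult_closed' by (simp add: ip_smult ip_smult_right)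
  also have "\<dots> = of_real ((cmod c)\<^sup>2 * (nrm x)\<^sup>2)" by (simp add: ip_self[OF x] complex_norm_square[symmetric])
  finally show ?thesis
    using nrm_nonneg[OF x] unfolding nrm_def[of "c \<odot>\<^bsub>V\<^esub> x"] by (simp add: real_sqrt_mult)
qed

lemma nrm_add2: "x \<in> carrier V \<Longrightarrow> y \<in> carrier V \<Longrightarrow> (nrm (x \<oplus> y))\<^sup>2 = (nrm x)\<^sup>2 + 2 * Re (ip x y) + (nrm y)\<^sup>2"
proof -
  assume x: "x \<in> carrier V" and y: "y \<in> carrier V"
  have "ip (x \<oplus> y) (x \<oplus> y) = ip x x + ip x y + (cnj (ip x y) + ip y y)"
    using x y add_closed' ip_commute[OF y x] by (simp add: ip_add ip_add_right)
  then have "Re (ip (x \<oplus> y) (x \<oplus> y)) = (nrm x)\<^sup>2 + 2 * Re (ip x y) + (nrm y)\<^sup>2"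
    by (simp add: ip_self[OF x] ip_self[OF y])
  then show ?thesis using ip_self[OF add_closed'[OF x y]] by simp
qed

lemma Re_ip_le: "x \<in> carrier V \<Longrightarrow> y \<in> carrier V \<Longrightarrow> Re (ip x y) \<le> nrm x * nrm y"
proof (cases "nrm y = 0")
  case True
  assume "x \<in> carrier V" "y \<in> carrier V"
  then show ?thesis using True nrm_eq_0[of y] by (simp add: ip_zero_right)
next
  case False
  assume x: "x \<in> carrier V" and y: "y \<in> carrier V"
  \<comment> \<open>The real parameter that minimizes the norm of
    \<open>x \<oplus> t y\<close>.\<close>
  define t where "t = - Re (ip x y) / (nrm y)\<^sup>2"
  have "0 \<le> (nrm (x \<oplus> of_real t \<odot>\<^bsub>V\<^esub> y))\<^sup>2" by simp
  also have "\<dots> = (nrm x)\<^sup>2 + 2 * (t * Re (ip x y)) + (\<bar>t\<bar> * nrm y)\<^sup>2"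
    using x y smult_closed' by (simp add: nrm_add2 ip_smult_right nrm_smult)
  also have "\<dots> = (nrm x)\<^sup>2 - (Re (ip x y))\<^sup>2 / (nrm y)\<^sup>2"
    using False by (simp add: t_def power_mult_distrib power_divide field_simps power2_eq_square)
  finally have "(Re (ip x y))\<^sup>2 \<le> (nrm x * nrm y)\<^sup>2"
    using False by (simp add: power_mult_distrib divide_le_eq)
  then show ?thesis by (rule power2_le_imp_le) (simp add: nrm_nonneg x y)
qed

lemma nrm_triangle: "x \<in> carrier V \<Longrightarrow> y \<in> carrier V \<Longrightarrow> nrm (x \<oplus> y) \<le> nrm x + nrm y"
proof -
  assume x: "x \<in> carrier V" and y: "y \<in> carrier V"
  have "(nrm (x \<oplus> y))\<^sup>2 \<le> (nrm x + nrm y)\<^sup>2"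
    using Re_ip_le[OF x y] unfolding nrm_add2[OF x y] power2_sum by simp
  then show ?thesis by (rule power2_le_imp_le) (simp add: nrm_nonneg x y)
qed

lemma ip_dist_eq: "x \<in> carrier V \<Longrightarrow> y \<in> carrier V \<Longrightarrow> ip_dist V ip x y = nrm (x \<ominus> y)"
  by (simp add: ip_dist_def nrm_def)

lemma nrm_minus_commute: "x \<in> carrier V \<Longrightarrow> y \<in> carrier V \<Longrightarrow> nrm (x \<ominus> y) = nrm (y \<ominus> x)"
proof -
  assume x: "x \<in> carrier V" and y: "y \<in> carrier V"
  have "x \<ominus> y = (-1) \<odot>\<^bsub>V\<^esub> (y \<ominus> x)"
    using x y VS.smult_minus_1[of "y \<ominus> x"] VS.M.minus_add[of y "\<ominus> x"]
    by (simp add: class_ring_simps a_minus_def VS.M.a_comm)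
  then show ?thesis using nrm_smult[OF minus_closed'[OF y x], of "-1"] by simp
qed

lemma metric: "Metric_space (carrier V) (ip_dist V ip)"
proof
  show "0 \<le> ip_dist V ip x y" for x y
    by (cases "x \<in> carrier V \<and> y \<in> carrier V") (auto simp: ip_dist_eq nrm_nonneg minus_closed', auto simp: ip_dist_def)
  show "ip_dist V ip x y = ip_dist V ip y x" for x y
    by (cases "x \<in> carrier V \<and> y \<in> carrier V") (auto simp: ip_dist_eq nrm_minus_commute[of x y], auto simp: ip_dist_def)
  show "ip_dist V ip x y = 0 \<longleftrightarrow> x = y" if "x \<in> carrier V" "y \<in> carrier V" for x y
    using that by (simp add: ip_dist_eq nrm_eq_0 minus_closed' minus_eq_zero')
  show "ip_dist V ip x z \<le> ip_dist V ip x y + ip_dist V ip y z"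
    if "x \<in> carrier V" "y \<in> carrier V" "z \<in> carrier V" for x y z
    using that nrm_triangle[of "x \<ominus> y" "y \<ominus> z"] minus_trans'[of x y z] by (simp add: ip_dist_eq minus_closed')
qed

text \<open>The range of an idempotent operator is its set of fixed points; in this form it becomes
  a closed invariant subspace to which irreducibility applies.\<close>

lemma closedin_fixed_points:
  assumes "bounded_operator V ip T"
  shows "closedin (Metric_space.mtopology (carrier V) (ip_dist V ip)) {x \<in> carrier V. T x = x}"
proof -
  interpret M: Metric_space "carrier V" "ip_dist V ip" by (rule metric)
  obtain K where T: "\<And>x. x \<in> carrier V \<Longrightarrow> T x \<in> carrier V"
    "\<And>x y. x \<in> carrier V \<Longrightarrow> y \<in> carrier V \<Longrightarrow> T (x \<oplus> y) = T x \<oplus> T y"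
    "\<And>c x. x \<in> carrier V \<Longrightarrow> T (c \<odot>\<^bsub>V\<^esub> x) = c \<odot>\<^bsub>V\<^esub> T x"
    "\<And>x. x \<in> carrier V \<Longrightarrow> nrm (T x) \<le> K * nrm x"
    using assms unfolding bounded_operator_def nrm_def by blast
  show ?thesis
    unfolding M.metric_closedin_iff_sequentially_closed
  proof (intro conjI allI impI)
    fix f l assume f: "range f \<subseteq> {x \<in> carrier V. T x = x} \<and> limitin M.mtopology f l sequentially"
    then have l: "l \<in> carrier V" and fc: "\<And>n. f n \<in> carrier V" "\<And>n. T (f n) = f n"
      by (auto simp: M.limit_metric_sequentially)
    have bound: "nrm (T l \<ominus> l) \<le> (\<bar>K\<bar> + 1) * nrm (l \<ominus> f n)" for n
    proof -
      have "T l \<ominus> f n = T (l \<ominus> f n)" using T l fc smult_closed'[OF fc(1)] by (simp add: minus_eq')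
      then have "nrm (T l \<ominus> f n) \<le> K * nrm (l \<ominus> f n)" using T(4) minus_closed' l fc by simp
      also have "\<dots> \<le> \<bar>K\<bar> * nrm (l \<ominus> f n)" by (intro mult_right_mono nrm_nonneg minus_closed' l fc) auto
      finally have "nrm (T l \<ominus> f n) \<le> \<bar>K\<bar> * nrm (l \<ominus> f n)" .
      moreover have "nrm (T l \<ominus> l) \<le> nrm (T l \<ominus> f n) + nrm (f n \<ominus> l)"
        using nrm_triangle[of "T l \<ominus> f n" "f n \<ominus> l"] minus_trans'[of "T l" "f n" l] T(1)[OF l] l fc minus_closed' by simp
      ultimately show ?thesis using nrm_minus_commute[OF l fc(1)] by (simp add: distrib_right)
    qed
    have "nrm (T l \<ominus> l) \<le> 0"
    proof (rule field_le_epsilon)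
      fix r :: real assume r: "r > 0"
      then have "0 < r / (\<bar>K\<bar> + 1)" by (simp add: add_nonneg_pos)
      then obtain n where "\<forall>k\<ge>n. f k \<in> carrier V \<and> ip_dist V ip (f k) l < r / (\<bar>K\<bar> + 1)"
        using f unfolding M.limit_metric_sequentially by blast
      then have "ip_dist V ip (f n) l < r / (\<bar>K\<bar> + 1)" by blast
      then have "nrm (l \<ominus> f n) < r / (\<bar>K\<bar> + 1)" using l fc ip_dist_eq nrm_minus_commute by metis
      then have "(\<bar>K\<bar> + 1) * nrm (l \<ominus> f n) \<le> r" by (simp add: field_simps)
      with bound[of n] show "nrm (T l \<ominus> l) \<le> 0 + r" by simp
    qed
    then have "T l = l" using nrm_nonneg nrm_eq_0 minus_closed' minus_eq_zero' T(1)[OF l] l by (metis antisym)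
    with l show "l \<in> {x \<in> carrier V. T x = x}" by simp
  qed auto
qed

end

section \<open>Irreducible representations of \<open>\<A>_infty\<close>\<close>

context uhf_three_infty
begin

text \<open>The kernels (2) and (3) of the theorem in one family, with \<open>j\<close> counted from
  0.\<close>

definition K :: "nat \<Rightarrow> nat \<Rightarrow> 'u set" where
  "K m j = {a \<in> A. blk m j (rho m a) = 0\<^sub>m (3 ^ (m - 1)) (3 ^ (m - 1))}"

text \<open>Left multipliers of \<open>J m\<close> inside the whole UHF algebra, in a form stable
  under adjoints. Both \<open>\<A>_infty\<close> and the matrices on the first \<open>m\<close>
  factors belong to it, hence also the difference of an element and its matrix
  approximation.\<close>

definition idealizer :: "nat \<Rightarrow> 'u set" where
  "idealizer m = {d. \<forall>j\<in>J m. d * j \<in> J m \<and> star d * j \<in> J m}"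

lemma idealizer_A: "d \<in> A \<Longrightarrow> d \<in> idealizer m"
  by (simp add: idealizer_def J_mult_left A_star)

lemma idealizer_M3: "x \<in> M3 m \<Longrightarrow> \<iota> m x \<in> idealizer m"
  using J_mult_M3[of x m] J_mult_M3[of "mat_adjoint x" m] by (simp add: idealizer_def \<iota>_adjoint[symmetric])

lemma idealizer_add: "d \<in> idealizer m \<Longrightarrow> d' \<in> idealizer m \<Longrightarrow> d + d' \<in> idealizer m"
  by (simp add: idealizer_def distrib_right star_add J_add)

lemma J_scaleR: "a \<in> J m \<Longrightarrow> r *\<^sub>R a \<in> J m"
  using J_scaleC[of a m "of_real r"] by (simp add: scaleC_of_real)

lemma idealizer_scaleR: "d \<in> idealizer m \<Longrightarrow> r *\<^sub>R d \<in> idealizer m"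
  by (simp add: idealizer_def star_scaleR J_scaleR)

lemma idealizer_minus: "d \<in> idealizer m \<Longrightarrow> d' \<in> idealizer m \<Longrightarrow> d - d' \<in> idealizer m"
  using idealizer_add[of d m "(-1) *\<^sub>R d'"] idealizer_scaleR[of d' m "-1"] by simp

lemma idealizer_mult: "d \<in> idealizer m \<Longrightarrow> d' \<in> idealizer m \<Longrightarrow> d * d' \<in> idealizer m"
  by (simp add: idealizer_def star_mult mult.assoc)

lemma idealizer_star: "d \<in> idealizer m \<Longrightarrow> star d \<in> idealizer m"
  by (simp add: idealizer_def star_star)

lemma idealizer_closed: "closed (idealizer m)"
  unfolding closed_sequential_limits
proof (intro allI impI)
  fix f l assume *: "(\<forall>k. f k \<in> idealizer m) \<and> f \<longlonglongrightarrow> l"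
  have "l * j \<in> J m \<and> star l * j \<in> J m" if j: "j \<in> J m" for j
  proof
    have "(\<lambda>k. f k * j) \<longlonglongrightarrow> l * j" using * by (intro tendsto_mult tendsto_const) auto
    then show "l * j \<in> J m" by (rule closed_sequentially[OF J_closed, rotated]) (use * j in \<open>auto simp: idealizer_def\<close>)
    have "(\<lambda>k. star (f k) * j) \<longlonglongrightarrow> star l * j" using * by (intro tendsto_mult tendsto_const tendsto_star) auto
    then show "star l * j \<in> J m" by (rule closed_sequentially[OF J_closed, rotated]) (use * j in \<open>auto simp: idealizer_def\<close>)
  qed
  then show "l \<in> idealizer m" by (simp add: idealizer_def)
qed

text \<open>A positive functional on \<open>\<A>_infty\<close> makes \<open>J m\<close> a pre-Hilbert space on which the idealizer of
  \<open>J m\<close> acts by contractions: \<open>\<parallel>d\<parallel>\<^sup>2 - d\<^sup>* d\<close> has a square root in the idealizer.\<close>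

lemma positive_bound:
  fixes F :: "'u \<Rightarrow> real"
  assumes F: "\<And>a b. a \<in> A \<Longrightarrow> b \<in> A \<Longrightarrow> F (a + b) = F a + F b" "\<And>r a. a \<in> A \<Longrightarrow> F (r *\<^sub>R a) = r * F a"
      "\<And>a. a \<in> A \<Longrightarrow> 0 \<le> F (star a * a)"
    and d: "d \<in> idealizer m" and j: "j \<in> J m"
  shows "F (star (d * j) * (d * j)) \<le> (norm d)\<^sup>2 * F (star j * j)"
proof -
  have dj: "d * j \<in> A" using d j J_A by (auto simp: idealizer_def)
  \<comment> \<open>For \<open>r\<close> strictly above \<open>norm d\<close> the element
    \<open>h\<close> has norm below 1, as the binomial series requires; at the end \<open>r\<close>
    tends to \<open>norm d\<close>.\<close>
  have less: "F (star (d * j) * (d * j)) \<le> r\<^sup>2 * F (star j * j)" if r: "r > norm d" for r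
  proof -
    have r0: "r > 0" using r norm_ge_zero[of d] by linarith
    define h where "h = (1 / r\<^sup>2) *\<^sub>R (star d * d)"
    have hD: "h \<in> idealizer m" unfolding h_def by (intro idealizer_scaleR idealizer_mult idealizer_star d)
    have hs: "star h = h" by (simp add: h_def star_scaleR star_mult star_star)
    have "(norm d)\<^sup>2 < r\<^sup>2" using r by (intro power_strict_mono) auto
    then have hn: "norm h < 1" using r0 by (simp add: h_def cstar_identity)
    obtain s where s: "s \<in> idealizer m" "star s = s" "s * s = 1 - h"
      by (rule selfadjoint_sqrt[OF hs hn idealizer_closed idealizer_A[OF A_one]])
         (use idealizer_add idealizer_scaleR idealizer_mult[OF hD] in blast)+
    have sj: "s * j \<in> A" using s j J_A by (auto simp: idealizer_def)
    have "star (s * j) * (s * j) = star j * (s * s) * j" by (simp add: star_mult s(2) mult.assoc)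
    also have "\<dots> = star j * j + (- (1 / r\<^sup>2)) *\<^sub>R (star (d * j) * (d * j))"
      by (simp add: s h_def star_mult mult.assoc algebra_simps)
    finally have "0 \<le> F (star j * j + (- (1 / r\<^sup>2)) *\<^sub>R (star (d * j) * (d * j)))" using F(3)[OF sj] by simp
    also have "\<dots> = F (star j * j) - 1 / r\<^sup>2 * F (star (d * j) * (d * j))"
      using F(1,2) A_mult A_star A_scaleR dj J_A[OF j] by (simp del: scaleR_minus_left)
    finally show ?thesis using r0 by (simp add: field_simps)
  qed
  have "((\<lambda>r. r\<^sup>2 * F (star j * j)) \<longlongrightarrow> (norm d)\<^sup>2 * F (star j * j)) (at_right (norm d))"
    by (intro tendsto_intros)
  then show ?thesis
    by (rule tendsto_lowerbound) (auto simp: eventually_at_right_less intro!: eventually_mono[OF eventually_at_right_less] less)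
qed

text \<open>A matrix unit is a partial isometry: its adjoint times itself is a projection.\<close>

lemma norm_munit_le: "norm (\<iota> m (munit (3 ^ m) r s)) \<le> 1" if "r < 3 ^ m" "s < 3 ^ m"
proof -
  let ?E = "\<lambda>r s. \<iota> m (munit (3 ^ m) r s)"
  have mult: "?E s r * ?E r s = ?E s s" "?E s s * ?E s s = ?E s s"
    using that by (simp_all add: munit_mult flip: \<iota>_mult)
  have st: "star (?E r s) = ?E s r" "star (?E s s) = ?E s s"
    by (simp_all add: munit_adjoint flip: \<iota>_adjoint)
  have "norm (?E s s) \<le> 1" by (rule norm_projection_le[OF st(2) mult(2)])
  then have "(norm (?E r s))\<^sup>2 \<le> 1" using cstar_identity[of "?E r s"] by (simp add: st mult)
  then show ?thesis by (simp add: power_le_one_iff abs_square_le_1)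
qed

section \<open>The kernel of a given representation\<close>

context
  fixes V :: "(complex, 'h) module" and ip and \<pi>
  assumes rep: "star_representation A V ip \<pi>"
begin

interpretation H: complex_hilbert_space V ip
  using rep by (simp add: star_representation_def)

lemma pi_closed: "a \<in> A \<Longrightarrow> v \<in> carrier V \<Longrightarrow> \<pi> a v \<in> carrier V"
  using rep by (auto simp: star_representation_def bounded_operator_def)

lemma pi_add: "a \<in> A \<Longrightarrow> b \<in> A \<Longrightarrow> v \<in> carrier V \<Longrightarrow> \<pi> (a + b) v = \<pi> a v \<oplus>\<^bsub>V\<^esub> \<pi> b v"
  using rep by (simp add: star_representation_def)

lemma pi_scaleC: "a \<in> A \<Longrightarrow> v \<in> carrier V \<Longrightarrow> \<pi> (c *\<^sub>C a) v = c \<odot>\<^bsub>V\<^esub> \<pi> a v"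
  using rep by (simp add: star_representation_def)

lemma pi_mult: "a \<in> A \<Longrightarrow> b \<in> A \<Longrightarrow> v \<in> carrier V \<Longrightarrow> \<pi> (a * b) v = \<pi> a (\<pi> b v)"
  using rep by (simp add: star_representation_def)

lemma pi_star: "a \<in> A \<Longrightarrow> v \<in> carrier V \<Longrightarrow> w \<in> carrier V \<Longrightarrow> ip (\<pi> a v) w = ip v (\<pi> (star a) w)"
  using rep by (simp add: star_representation_def)

lemma pi_bounded: "a \<in> A \<Longrightarrow> bounded_operator V ip (\<pi> a)"
  using rep by (simp add: star_representation_def)

lemma pi_vector_zero: "a \<in> A \<Longrightarrow> \<pi> a \<zero>\<^bsub>V\<^esub> = \<zero>\<^bsub>V\<^esub>"
  using pi_bounded[of a] H.zero_smult'[OF H.zero_closed'] H.zero_closed' H.zero_smult'[OF pi_closed[OF _ H.zero_closed', of a]]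
  unfolding bounded_operator_def by metis

lemma pi_zero: "v \<in> carrier V \<Longrightarrow> \<pi> 0 v = \<zero>\<^bsub>V\<^esub>"
  using pi_scaleC[of 0 v 0] A_zero H.zero_smult'[OF pi_closed[OF A_zero, of v]] by simp

lemma pi_cong:
  assumes "\<And>a v. a \<in> J m \<Longrightarrow> v \<in> carrier V \<Longrightarrow> \<pi> a v = \<zero>\<^bsub>V\<^esub>"
    and "a \<in> A" "b \<in> A" "rho m a = rho m b" "v \<in> carrier V"
  shows "\<pi> a v = \<pi> b v"
proof -
  have "a - b \<in> J m" using J_minus_iff[OF assms(2,3)] assms(4) by simp
  then have "\<pi> ((a - b) + b) v = \<zero>\<^bsub>V\<^esub> \<oplus>\<^bsub>V\<^esub> \<pi> b v"
    using assms J_A by (subst pi_add) auto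
  also have "\<dots> = \<zero>\<^bsub>V\<^esub> \<oplus>\<^bsub>V\<^esub> \<pi> (0 + b) v" by simp
  also have "\<dots> = \<pi> b v"
    using pi_add[OF A_zero assms(3,5)] pi_zero[OF assms(5)] by simp
  finally show ?thesis by simp
qed

text \<open>The comparison is made at one vector \<open>v\<close>, with \<open>G j\<close> the
  squared norm of \<open>\<pi> j v\<close>. Multipliers of norm at most 1 do not increase
  \<open>G\<close>, and matrix units move a nonzero \<open>j\<close> between rows without loss, so a
  single entry of \<open>b\<close> can be tested.\<close>

lemma representation_faithful:
  assumes J: "\<And>m. \<exists>j\<in>J m. \<exists>v\<in>carrier V. \<pi> j v \<noteq> \<zero>\<^bsub>V\<^esub>"
    and a: "a \<in> A" "\<And>v. v \<in> carrier V \<Longrightarrow> \<pi> a v = \<zero>\<^bsub>V\<^esub>"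
  shows "a = 0"
proof (rule ccontr)
  assume "a \<noteq> 0"
  have "\<exists>n r s. r < 3 ^ Suc n \<and> s < 3 ^ Suc n \<and> rho n a $$ (r, s) \<noteq> 0"
  proof (rule ccontr)
    assume *: "\<not> ?thesis"
    have "rho n a = 0\<^sub>m (3 ^ Suc n) (3 ^ Suc n)" for n
      by (rule M3_eqI[OF rho_carrier zero_carrier_mat]) (use * in auto)
    then have "(\<lambda>n. 0) \<longlonglongrightarrow> a" using \<iota>_rho_tendsto[of a] by (simp only: \<iota>_zero)
    then show False using \<open>a \<noteq> 0\<close> by (simp add: LIMSEQ_const_iff)
  qed
  then obtain n r0 s0 where n: "r0 < 3 ^ Suc n" "s0 < 3 ^ Suc n" "rho n a $$ (r0, s0) \<noteq> 0" by blast
  define c where "c = cmod (rho n a $$ (r0, s0))"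
  obtain l x where x: "\<And>k. x k \<in> M3 (l k)" "(\<lambda>k. \<iota> (l k) (x k)) \<longlonglongrightarrow> a" using approx by metis
  \<comment> \<open>An error below half of the tested entry \<open>c\<close> leaves the
    corresponding entry of \<open>b\<close> larger than the error.\<close>
  obtain k where k: "dist (\<iota> (l k) (x k)) a < c / 2"
    using metric_LIMSEQ_D[OF x(2), of "c / 2"] n by (auto simp: c_def)
  \<comment> \<open>High enough to contain the approximant and to contain the prefixes of length
    \<open>n + 1\<close> on which the tested slice entry lives.\<close>
  define m where "m = max (Suc n) (l k)"
  obtain b where b: "b \<in> M3 m" "\<iota> m b = \<iota> (l k) (x k)"
    by (rule lift_level[OF x(1), of k m]) (auto simp: m_def)
  let ?N = "(3 :: nat) ^ m"
  define r where "r = pre (wd (Suc n) r0) m"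
  define s where "s = pre (wd (Suc n) s0) m"
  have rs: "r < ?N" "s < ?N" unfolding r_def s_def by (rule pre_less)+
  define \<epsilon> where "\<epsilon> = norm (\<iota> m b - a)"
  have \<epsilon>: "\<epsilon> < c / 2" using k b by (simp add: \<epsilon>_def dist_norm)
  have "c \<le> cmod (b $$ (r, s)) + \<epsilon>"
  proof -
    have "rho n (\<iota> m b - a) $$ (r0, s0) = b $$ (r, s) - rho n a $$ (r0, s0)"
      using n rho_\<iota>[OF b(1) _ n(1,2)]
      by (simp add: rho_minus carrier_matD[OF rho_carrier] r_def s_def m_def del: power_Suc)
    then have "cmod (b $$ (r, s) - rho n a $$ (r0, s0)) \<le> \<epsilon>"
      using rho_entry_le[OF n(1,2), of "\<iota> m b - a"] by (simp add: \<epsilon>_def)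
    then show ?thesis unfolding c_def using norm_triangle_ineq3[of "rho n a $$ (r0, s0)" "b $$ (r, s)"]
      by (simp add: norm_minus_commute)
  qed
  with \<epsilon> have b_big: "\<epsilon> < cmod (b $$ (r, s))" by linarith
  obtain j0 v where j0: "j0 \<in> J m" "v \<in> carrier V" "\<pi> j0 v \<noteq> \<zero>\<^bsub>V\<^esub>" using J[of m] by blast
  note v = j0(2)
  define F where "F a = Re (ip (\<pi> a v) v)" for a
  have F_add: "F (a + b) = F a + F b" if "a \<in> A" "b \<in> A" for a b
    using that v by (simp add: F_def pi_add H.ip_add pi_closed)
  have F_scaleR: "F (r *\<^sub>R a) = r * F a" if "a \<in> A" for r a
    using that v pi_scaleC[of a v "of_real r"] by (simp add: F_def scaleC_of_real H.ip_smult pi_closed)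
  have F_sq: "F (star a * a) = (H.nrm (\<pi> a v))\<^sup>2" if "a \<in> A" for a
  proof -
    have "ip (\<pi> (star a * a) v) v = ip (\<pi> a v) (\<pi> a v)"
      using that v pi_star[OF A_star[OF that] pi_closed[OF that v] v] by (simp add: pi_mult A_star star_star)
    then show ?thesis using H.ip_self[OF pi_closed[OF that v]] by (simp add: F_def)
  qed
  define G where "G a = (H.nrm (\<pi> a v))\<^sup>2" for a
  have bound: "G (d * j) \<le> (norm d)\<^sup>2 * G j" if "d \<in> idealizer m" "j \<in> J m" for d j
  proof -
    have "d * j \<in> A" "j \<in> A" using that J_A by (auto simp: idealizer_def)
    then show ?thesis
      using positive_bound[OF F_add F_scaleR _ that] by (simp add: F_sq G_def)
  qed
  define E where "E p q = \<iota> m (munit ?N p q)" for p q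
  have E_id: "E p q \<in> idealizer m" for p q unfolding E_def by (rule idealizer_M3[OF munit_carrier])
  have E_mult: "E p q * E q t = E p t" if "q < ?N" for p q t
    unfolding E_def using munit_mult[OF that, of p t] by (simp flip: \<iota>_mult)
  have E_bound: "G (E p q * j) \<le> G j" if "p < ?N" "q < ?N" "j \<in> J m" for p q j
  proof -
    have "G (E p q * j) \<le> (norm (E p q))\<^sup>2 * G j" by (rule bound[OF E_id that(3)])
    also have "\<dots> \<le> 1 * G j"
      using norm_munit_le[OF that(1,2)] by (intro mult_right_mono) (auto simp: E_def G_def power_le_one)
    finally show ?thesis by simp
  qed
  have EJ: "E p q * j \<in> J m" if "j \<in> J m" for p q j using E_id that by (auto simp: idealizer_def)
  \<comment> \<open>The diagonal units sum to 1; if all \<open>E t t * j0\<close> were invisible at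
    \<open>v\<close>, so would be \<open>j0\<close>.\<close>
  have "\<exists>t<?N. G (E t t * j0) \<noteq> 0"
  proof (rule ccontr)
    assume *: "\<not> ?thesis"
    have "star (E t t * j0) * (E t t * j0) = star j0 * (E t t * j0)" if "t < ?N" for t
      using E_mult[OF that, of t t] by (simp add: star_mult E_def munit_adjoint mult.assoc[symmetric] flip: \<iota>_adjoint) (simp add: mult.assoc)
    then have F0: "F (star j0 * (E t t * j0)) = 0" if "t < ?N" for t
      using * that F_sq[OF J_A[OF EJ[OF j0(1)]], of t t] unfolding G_def by metis
    have "F (\<Sum>t\<in>I. star j0 * (E t t * j0)) = 0 \<and> (\<Sum>t\<in>I. star j0 * (E t t * j0)) \<in> A" if "I \<subseteq> {..<?N}" for I
      using finite_subset[OF that finite_lessThan] that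
    proof (induction I rule: finite_induct)
      case empty
      show ?case using F_scaleR[OF A_zero, of 0] A_zero by simp
    next
      case (insert t I)
      have "star j0 * (E t t * j0) \<in> A" using A_mult A_star J_A j0(1) EJ by blast
      then show ?case using insert F0[of t] by (simp add: F_add A_add)
    qed
    from this[of "{..<?N}"] have "F (\<Sum>t<?N. star j0 * (E t t * j0)) = 0" by blast
    moreover have "(\<Sum>t<?N. star j0 * (E t t * j0)) = star j0 * j0"
      using \<iota>_munit_sum[of m] by (simp add: sum_distrib_left[symmetric] sum_distrib_right[symmetric] E_def)
    ultimately have "(H.nrm (\<pi> j0 v))\<^sup>2 = 0" using F_sq[OF J_A[OF j0(1)]] by simp
    then show False using j0 H.nrm_eq_0[OF pi_closed[OF J_A[OF j0(1)] v]] by simp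
  qed
  then obtain t where t: "t < ?N" "G (E t t * j0) \<noteq> 0" by blast
  \<comment> \<open>Moves row \<open>t\<close> to row \<open>s\<close>, the column index of the
    tested entry. Moving back by \<open>E t s\<close> shows that \<open>j\<close> is still visible
    at \<open>v\<close>.\<close>
  define j where "j = E s t * j0"
  have j: "j \<in> J m" unfolding j_def by (rule EJ[OF j0(1)])
  have "G (E t t * j0) = G (E t s * j)" unfolding j_def mult.assoc[symmetric] E_mult[OF rs(2)] ..
  moreover have "G (E t t * j0) > 0" using t(2) by (simp add: G_def)
  ultimately have Gj: "G j > 0" using E_bound[OF t(1) rs(2) j] by linarith
  have Ej: "E s s * j = j" unfolding j_def mult.assoc[symmetric] E_mult[OF rs(2)] ..
  have aj: "\<pi> (a * j) v = \<zero>\<^bsub>V\<^esub>" using a v J_A[OF j] pi_closed by (simp add: pi_mult)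
  define d where "d = \<iota> m b - a"
  have d: "d \<in> idealizer m" unfolding d_def by (intro idealizer_minus idealizer_M3 idealizer_A a b)
  have dj: "d * j \<in> A" using d j J_A by (auto simp: idealizer_def)
  have ajA: "a * j \<in> A" using a J_A[OF j] A_mult by blast
  \<comment> \<open>As \<open>\<pi>\<close> kills \<open>a * j\<close>, the product
    \<open>b * j\<close> acts at \<open>v\<close> like \<open>d * j\<close> with the small
    multiplier \<open>d\<close>.\<close>
  have "\<iota> m b * j = d * j + a * j" by (simp add: d_def algebra_simps)
  then have "\<pi> (\<iota> m b * j) v = \<pi> (d * j) v"
    using pi_add[OF dj ajA v] aj H.add_zero'[OF pi_closed[OF dj v]] by simp
  then have Gb: "G (\<iota> m b * j) = G (d * j)" by (simp add: G_def)
  have bj: "\<iota> m b * j \<in> J m" using idealizer_M3[OF b(1)] j by (auto simp: idealizer_def)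
  have "E r r * (\<iota> m b * j) = b $$ (r, s) *\<^sub>C (E r s * j)"
  proof -
    have "E r r * (\<iota> m b * j) = (E r r * \<iota> m b * E s s) * j" by (simp add: mult.assoc Ej)
    also have "E r r * \<iota> m b * E s s = \<iota> m (munit ?N r r * b * munit ?N s s)"
      unfolding E_def \<iota>_mult[OF mult_carrier_mat[OF munit_carrier b(1)] munit_carrier] \<iota>_mult[OF munit_carrier b(1)] ..
    also have "\<dots> = b $$ (r, s) *\<^sub>C E r s"
      unfolding munit_compress[OF b(1) rs] E_def by (rule \<iota>_smult[OF munit_carrier])
    finally show ?thesis by (simp add: mult_scaleC_left)
  qed
  then have "G (E r r * (\<iota> m b * j)) = (cmod (b $$ (r, s)))\<^sup>2 * G (E r s * j)"
    using pi_scaleC[OF J_A[OF EJ[OF j]] v] H.nrm_smult[OF pi_closed[OF J_A[OF EJ[OF j]] v]]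
    by (simp add: G_def power_mult_distrib)
  moreover have "G j \<le> G (E r s * j)"
  proof -
    have "G (E s r * (E r s * j)) \<le> G (E r s * j)" by (rule E_bound[OF rs(2,1) EJ[OF j]])
    then show ?thesis unfolding mult.assoc[symmetric] E_mult[OF rs(1)] Ej .
  qed
  ultimately have "(cmod (b $$ (r, s)))\<^sup>2 * G j \<le> G (E r r * (\<iota> m b * j))"
    by (simp add: mult_left_mono)
  also have "\<dots> \<le> G (\<iota> m b * j)" by (rule E_bound[OF rs(1,1) bj])
  also have "\<dots> \<le> \<epsilon>\<^sup>2 * G j" unfolding Gb \<epsilon>_def d_def[symmetric] by (rule bound[OF d j])
  finally have "(cmod (b $$ (r, s)))\<^sup>2 \<le> \<epsilon>\<^sup>2" using Gj by simp
  then have "cmod (b $$ (r, s)) \<le> \<epsilon>" by (rule power2_le_imp_le) (simp add: \<epsilon>_def)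
  with b_big show False by simp
qed

text \<open>Modulo \<open>J m\<close> the lifts \<open>p j\<close> of the three block units are
  central idempotents. If \<open>\<pi>\<close> killed all of them, it would kill
  \<open>J (m - 1)\<close>, or everything if \<open>m = 0\<close>. Irreducibility makes a surviving
  one act as the identity, and simplicity of its matrix block yields the kernel.\<close>

lemma kernel_of_block:
  assumes irr: "irreducible_representation A V ip \<pi>"
    and 0: "\<And>a v. a \<in> J m \<Longrightarrow> v \<in> carrier V \<Longrightarrow> \<pi> a v = \<zero>\<^bsub>V\<^esub>"
    and 1: "m > 0 \<Longrightarrow> \<exists>a\<in>J (m - 1). \<exists>v\<in>carrier V. \<pi> a v \<noteq> \<zero>\<^bsub>V\<^esub>"
  shows "\<exists>j<3. rep_kernel A V \<pi> = K m j"
proof -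
  let ?k = "m - 1"
  let ?N = "(3 :: nat) ^ ?k"
  \<comment> \<open>Some lift of the block element \<open>emb m j z\<close>; as \<open>\<pi>\<close>
    vanishes on \<open>J m\<close>, the choice does not influence \<open>\<pi>\<close>.\<close>
  define L where "L j z = (SOME a. z \<in> M3 ?k \<longrightarrow> a \<in> A \<and> rho m a = emb m j z)" for j z
  have "\<exists>a. z \<in> M3 ?k \<longrightarrow> a \<in> A \<and> rho m a = emb m j z" for j z
    using lift[OF emb_Aset, of z m j] by metis
  then have "\<And>j z. z \<in> M3 ?k \<longrightarrow> L j z \<in> A \<and> rho m (L j z) = emb m j z" unfolding L_def by (rule someI_ex)
  then have L: "\<And>j z. z \<in> M3 ?k \<Longrightarrow> L j z \<in> A" "\<And>j z. z \<in> M3 ?k \<Longrightarrow> rho m (L j z) = emb m j z" by auto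
  define p where "p j = L j (1\<^sub>m ?N)" for j
  have p: "p j \<in> A" "rho m (p j) = emb m j (1\<^sub>m ?N)" for j unfolding p_def by (rule L; simp)+
  have B: "blk m j (rho m a) \<in> M3 ?k" if "a \<in> A" for a j by (rule blk_carrier[OF rho_A[OF that]])
  have ap: "rho m (a * p j) = emb m j (blk m j (rho m a))" "rho m (p j * a) = emb m j (blk m j (rho m a))"
    if "a \<in> A" "j < 3" for a j
    using emb_mult[OF rho_A[OF that(1)] that(2) one_carrier_mat, of m] B[OF that(1), of j]
    by (simp_all add: rho_mult that p)
  note cong = pi_cong[of m, OF 0]
  have "\<exists>j<3. \<exists>v\<in>carrier V. \<pi> (p j) v \<noteq> \<zero>\<^bsub>V\<^esub>"
  proof (rule ccontr)
    assume neg: "\<not> ?thesis"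
    \<comment> \<open>For such \<open>a\<close> the slice at level \<open>m\<close> is the sum of
      its three block components, so \<open>\<pi> a\<close> factors through the operators
      \<open>\<pi> (p j)\<close>.\<close>
    have van: "\<pi> a v = \<zero>\<^bsub>V\<^esub>" if a: "a \<in> A" "m > 0 \<Longrightarrow> a \<in> J (m - 1)" and v: "v \<in> carrier V" for a v
    proof -
      have "m > 0 \<Longrightarrow> cut 1 (rho m a) = 0\<^sub>m (3 ^ m) (3 ^ m)"
        using cut_rho_Suc[of "m - 1" a] a(2) by (auto simp: J_def simp del: power_Suc)
      from emb_sum[OF rho_A[OF a(1)] this] have "rho m (a * p 0 + a * p 1 + a * p 2) = rho m a"
        using ap(1)[OF a(1)] by (simp add: rho_add)
      then have "\<pi> a v = \<pi> (a * p 0 + a * p 1 + a * p 2) v"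
        by (intro cong a v A_add A_mult p) simp_all
      also have "\<dots> = \<pi> a (\<pi> (p 0) v) \<oplus>\<^bsub>V\<^esub> \<pi> a (\<pi> (p 1) v) \<oplus>\<^bsub>V\<^esub> \<pi> a (\<pi> (p 2) v)"
        using a(1) v p(1) by (simp add: pi_add pi_mult A_add A_mult)
      also have "\<dots> = \<zero>\<^bsub>V\<^esub>"
      proof -
        have "\<pi> (p 0) v = \<zero>\<^bsub>V\<^esub>" "\<pi> (p 1) v = \<zero>\<^bsub>V\<^esub>" "\<pi> (p 2) v = \<zero>\<^bsub>V\<^esub>" using neg v by auto
        then show ?thesis using pi_vector_zero[OF a(1)] H.add_zero'[OF H.zero_closed'] by simp
      qed
      finally show ?thesis .
    qed
    show False
    proof (cases "m = 0")
      case True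
      then have "rep_kernel A V \<pi> = A" using van by (auto simp: rep_kernel_def)
      then show False using irr by (simp add: irreducible_representation_def)
    next
      case False
      then show False using 1 van J_A by blast
    qed
  qed
  then obtain j v0 where j: "j < 3" and v0: "v0 \<in> carrier V" "\<pi> (p j) v0 \<noteq> \<zero>\<^bsub>V\<^esub>" by blast
  \<comment> \<open>The range of the idempotent \<open>\<pi> (p j)\<close>, invariant because
    \<open>p j\<close> commutes with every \<open>a\<close> modulo \<open>J m\<close>.\<close>
  define W where "W = {v \<in> carrier V. \<pi> (p j) v = v}"
  have pb: "\<pi> (p j) (v \<oplus>\<^bsub>V\<^esub> w) = \<pi> (p j) v \<oplus>\<^bsub>V\<^esub> \<pi> (p j) w" "\<pi> (p j) (c \<odot>\<^bsub>V\<^esub> v) = c \<odot>\<^bsub>V\<^esub> \<pi> (p j) v"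
    if "v \<in> carrier V" "w \<in> carrier V" for v w c
    using pi_bounded[OF p(1)[of j]] that unfolding bounded_operator_def by blast+
  have "submodule class_ring W V"
    unfolding submodule_def
    using H.vectorspace by (auto simp: W_def vectorspace_def H.add_closed' H.smult_closed' H.zero_closed' pb pi_vector_zero[OF p(1)])
  then have "VectorSpace.subspace class_ring W V"
    unfolding VectorSpace.subspace_def using H.vectorspace by simp
  moreover have "closedin (Metric_space.mtopology (carrier V) (ip_dist V ip)) W"
    unfolding W_def by (rule H.closedin_fixed_points[OF pi_bounded[OF p(1)]])
  moreover have comm: "\<pi> (p j) (\<pi> a v) = \<pi> a (\<pi> (p j) v)" if "a \<in> A" "v \<in> carrier V" for a v
    using cong[of "p j * a" "a * p j" v] ap[OF that(1) j] A_mult p(1) that by (simp add: pi_mult)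
  then have "\<forall>a\<in>A. \<pi> a ` W \<subseteq> W" by (auto simp: W_def pi_closed)
  moreover have "\<pi> (p j) v0 \<in> W"
  proof -
    have "rho m (p j * p j) = rho m (p j)"
      using ap(1)[OF p(1) j] by (simp add: p blk_emb[OF j])
    then have "\<pi> (p j * p j) v0 = \<pi> (p j) v0" by (intro cong A_mult p v0)
    then show ?thesis using p(1) v0 by (simp add: W_def pi_closed pi_mult)
  qed
  ultimately have "W = carrier V"
    using irr v0(2) unfolding irreducible_representation_def by blast
  then have p1: "\<pi> (p j) v = v" if "v \<in> carrier V" for v using that by (auto simp: W_def)
  have emb0: "emb m j (0\<^sub>m ?N ?N) = 0\<^sub>m (3 ^ Suc m) (3 ^ Suc m)"
  proof -
    have "emb m j (0\<^sub>m ?N ?N) = 0 \<cdot>\<^sub>m emb m j (0\<^sub>m ?N ?N)" by (subst emb_smult) auto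
    also have "\<dots> = 0\<^sub>m (3 ^ Suc m) (3 ^ Suc m)"
      using Aset_carrier[OF emb_Aset[OF zero_carrier_mat, of m j]] by (intro eq_matI) (auto simp del: power_Suc)
    finally show ?thesis .
  qed
  have "rep_kernel A V \<pi> = K m j"
  proof (intro equalityI subsetI)
    fix a assume "a \<in> K m j"
    then have a: "a \<in> A" "blk m j (rho m a) = 0\<^sub>m ?N ?N" by (auto simp: K_def)
    have "\<pi> a v = \<zero>\<^bsub>V\<^esub>" if v: "v \<in> carrier V" for v
    proof -
      have "a * p j \<in> J m" using ap(1)[OF a(1) j] a A_mult p(1) emb0 by (simp add: J_def del: power_Suc)
      then show ?thesis using 0[of "a * p j" v] pi_mult[OF a(1) p(1) v] p1[OF v] v by simp
    qed
    then show "a \<in> rep_kernel A V \<pi>" using a by (simp add: rep_kernel_def)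
  next
    fix a assume "a \<in> rep_kernel A V \<pi>"
    then have a: "a \<in> A" "\<And>v. v \<in> carrier V \<Longrightarrow> \<pi> a v = \<zero>\<^bsub>V\<^esub>" by (auto simp: rep_kernel_def)
    let ?y = "blk m j (rho m a)"
    have "?y $$ (r, s) = 0" if rs: "r < ?N" "s < ?N" for r s
    proof (rule ccontr)
      assume y: "?y $$ (r, s) \<noteq> 0"
      \<comment> \<open>Simplicity of the full matrix block: multiplied by matrix units on both
        sides, one nonzero entry produces every diagonal unit.\<close>
      have unit: "\<pi> (L j (munit ?N q q)) v = \<zero>\<^bsub>V\<^esub>" if q: "q < ?N" and v: "v \<in> carrier V" for q v
      proof -
        let ?a = "L j (munit ?N q r)" and ?b = "L j (munit ?N s q)"
        have mc: "munit ?N q r * ?y * munit ?N s q \<in> M3 ?k" "munit ?N q r * ?y \<in> M3 ?k"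
          by (rule mult_carrier_mat[OF mult_carrier_mat[OF munit_carrier B[OF a(1)]] munit_carrier]
              mult_carrier_mat[OF munit_carrier B[OF a(1)]])+
        have "rho m (?a * a * ?b) = emb m j (munit ?N q r) * rho m a * emb m j (munit ?N s q)"
          by (simp add: rho_mult A_mult L a)
        also have "\<dots> = emb m j (munit ?N q r * ?y) * emb m j (munit ?N s q)"
          by (simp add: emb_mult(2)[OF rho_A[OF a(1)] j])
        also have "\<dots> = emb m j (munit ?N q r * ?y * munit ?N s q)"
          using emb_mult(1)[OF emb_Aset[OF mc(2)] j, of "munit ?N s q"] blk_emb[OF j mc(2)] by simp
        also have "munit ?N q r * ?y * munit ?N s q = ?y $$ (r, s) \<cdot>\<^sub>m munit ?N q q"
        proof (rule M3_eqI[OF mc(1)])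
          fix i l assume il: "i < ?N" "l < ?N"
          show "(munit ?N q r * ?y * munit ?N s q) $$ (i, l) = (?y $$ (r, s) \<cdot>\<^sub>m munit ?N q q) $$ (i, l)"
            unfolding munit_mult_right_entry[OF mc(2) rs(2) il]
            using munit_mult_left_entry[OF B[OF a(1)] rs(1) il(1) rs(2)] il by (simp add: munit_entry)
        qed simp
        also have "emb m j (?y $$ (r, s) \<cdot>\<^sub>m munit ?N q q) = ?y $$ (r, s) \<cdot>\<^sub>m emb m j (munit ?N q q)"
          by (rule emb_smult[symmetric]) simp
        also have "\<dots> = rho m (?y $$ (r, s) *\<^sub>C L j (munit ?N q q))" by (simp add: rho_scaleC L)
        finally have "\<pi> (?a * a * ?b) v = \<pi> (?y $$ (r, s) *\<^sub>C L j (munit ?N q q)) v"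
          by (intro cong A_mult A_scaleC L a v) simp_all
        moreover have "\<pi> (?a * a * ?b) v = \<zero>\<^bsub>V\<^esub>"
          using a v by (simp add: pi_mult A_mult L pi_closed pi_vector_zero)
        ultimately have "?y $$ (r, s) \<odot>\<^bsub>V\<^esub> \<pi> (L j (munit ?N q q)) v = \<zero>\<^bsub>V\<^esub>"
          using v by (simp add: pi_scaleC L)
        then have "cmod (?y $$ (r, s)) * H.nrm (\<pi> (L j (munit ?N q q)) v) = 0"
          using H.nrm_smult[OF pi_closed[OF L(1)[OF munit_carrier, of j q q] v], of "?y $$ (r, s)"] H.nrm_eq_0[OF H.zero_closed'] by simp
        then show ?thesis using y H.nrm_eq_0[OF pi_closed[OF L(1)[OF munit_carrier, of j q q] v]] by simp
      qed
      \<comment> \<open>Partial sums of the diagonal units; the last one is the block unit, so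
        \<open>p j\<close> would annihilate \<open>v0\<close>.\<close>
      define P where "P k = mat ?N ?N (\<lambda>(r, s). if r = s \<and> r < k then 1 else (0 :: complex))" for k
      have Pc: "P k \<in> M3 ?k" for k by (simp add: P_def)
      have "\<pi> (L j (P k)) v = \<zero>\<^bsub>V\<^esub>" if "k \<le> ?N" "v \<in> carrier V" for k v
        using that(1)
      proof (induction k)
        case 0
        have "P 0 = 0\<^sub>m ?N ?N" by (rule eq_matI) (auto simp: P_def)
        then have "L j (P 0) \<in> J m" using L[OF Pc, of j 0] emb0 by (simp add: J_def del: power_Suc)
        then show ?case using 0 that(2) \<open>\<And>a v. a \<in> J m \<Longrightarrow> v \<in> carrier V \<Longrightarrow> \<pi> a v = \<zero>\<^bsub>V\<^esub>\<close> by blast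
      next
        case (Suc k)
        have "P (Suc k) = P k + munit ?N k k" by (rule eq_matI) (auto simp: P_def munit_def)
        then have "rho m (L j (P (Suc k))) = rho m (L j (P k) + L j (munit ?N k k))"
          unfolding L(2)[OF Pc] rho_add L(2)[OF munit_carrier] by (simp only: emb_add[OF Pc munit_carrier])
        then have "\<pi> (L j (P (Suc k))) v = \<pi> (L j (P k) + L j (munit ?N k k)) v"
          by (intro cong A_add L Pc that) simp_all
        also have "\<dots> = \<zero>\<^bsub>V\<^esub> \<oplus>\<^bsub>V\<^esub> \<zero>\<^bsub>V\<^esub>"
          using Suc that unit[of k v] by (simp add: pi_add[OF L(1)[OF Pc] L(1)[OF munit_carrier] that(2)] del: One_nat_def)
        finally show ?case using H.add_zero'[OF H.zero_closed'] by simp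
      qed
      moreover have "P ?N = 1\<^sub>m ?N" by (rule eq_matI) (auto simp: P_def)
      ultimately have "\<pi> (p j) v0 = \<zero>\<^bsub>V\<^esub>" using v0(1) unfolding p_def by (metis order_refl)
      then show False using v0 by simp
    qed
    then have "?y = 0\<^sub>m ?N ?N" by (intro M3_eqI[OF B[OF a(1)]]) auto
    then show "a \<in> K m j" using a by (simp add: K_def)
  qed
  with j show ?thesis by blast
qed

lemma irreducible_kernel:
  assumes irr: "irreducible_representation A V ip \<pi>"
  shows "rep_kernel A V \<pi> = {0} \<or> (\<exists>m. \<exists>j<3. rep_kernel A V \<pi> = K m j)"
proof (cases "\<forall>m. \<exists>j\<in>J m. \<exists>v\<in>carrier V. \<pi> j v \<noteq> \<zero>\<^bsub>V\<^esub>")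
  case True
  then have "rep_kernel A V \<pi> \<subseteq> {0}"
    using representation_faithful unfolding rep_kernel_def by blast
  moreover have "0 \<in> rep_kernel A V \<pi>" by (simp add: rep_kernel_def A_zero pi_zero)
  ultimately show ?thesis by blast
next
  case False
  define P where "P m \<longleftrightarrow> (\<forall>j\<in>J m. \<forall>v\<in>carrier V. \<pi> j v = \<zero>\<^bsub>V\<^esub>)" for m
  define m where "m = (LEAST m. P m)"
  have "\<exists>m. P m" using False unfolding P_def by blast
  then have "P m" unfolding m_def by (rule LeastI_ex)
  then have 0: "\<pi> a v = \<zero>\<^bsub>V\<^esub>" if "a \<in> J m" "v \<in> carrier V" for a v using that unfolding P_def by blast
  have "\<not> P (m - 1)" if "m > 0"
    unfolding m_def by (rule not_less_Least) (use that in \<open>simp add: m_def\<close>)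
  then have 1: "\<exists>a\<in>J (m - 1). \<exists>v\<in>carrier V. \<pi> a v \<noteq> \<zero>\<^bsub>V\<^esub>" if "m > 0" using that unfolding P_def by blast
  have "\<exists>j<3. rep_kernel A V \<pi> = K m j" by (rule kernel_of_block[OF irr 0 1])
  then show ?thesis by blast
qed

end

end

section \<open>Concrete representations\<close>

text \<open>A sequence of complex numbers is coded by one set of natural numbers, and this by one
  real number. So a type that holds \<complex> also holds all such sequences.\<close>

lemma exists_injection_sequences:
  fixes f :: "complex \<Rightarrow> 'h"
  assumes "inj f"
  shows "\<exists>g :: (nat \<Rightarrow> complex) \<Rightarrow> 'h. inj g"
proof -
  obtain h :: "nat set \<Rightarrow> real" and r :: "real \<Rightarrow> nat set" where h: "inj h" and r: "inj r"
    using nat_sets_eqpoll_reals unfolding eqpoll_def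
    by (metis bij_betw_def bij_betw_the_inv_into)
  \<comment> \<open>Slots \<open>2 * k\<close> and \<open>2 * k + 1\<close> store the real and the
    imaginary part of entry \<open>k\<close>, each as a set of natural numbers.\<close>
  define S where "S \<phi> = {n. case prod_decode n of (i, l) \<Rightarrow>
    l \<in> r (if even i then Re (\<phi> (i div 2)) else Im (\<phi> (i div 2)))}" for \<phi> :: "nat \<Rightarrow> complex"
  have mem: "prod_encode (i, l) \<in> S \<phi> \<longleftrightarrow> l \<in> r (if even i then Re (\<phi> (i div 2)) else Im (\<phi> (i div 2)))" for i l \<phi>
    by (simp add: S_def)
  have "inj S"
  proof (rule injI, rule ext)
    fix \<phi> \<psi> k assume eq: "S \<phi> = S \<psi>"
    have "r (Re (\<phi> k)) = r (Re (\<psi> k))"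
      using mem[of "2 * k" _ \<phi>] mem[of "2 * k" _ \<psi>] eq by auto
    moreover have "r (Im (\<phi> k)) = r (Im (\<psi> k))"
      using mem[of "2 * k + 1" _ \<phi>] mem[of "2 * k + 1" _ \<psi>] eq by auto
    ultimately show "\<phi> k = \<psi> k" using r by (auto simp: complex_eq_iff dest: injD)
  qed
  then have "inj (f \<circ> complex_of_real \<circ> h \<circ> S)"
    by (intro inj_compose assms h) (simp add: inj_on_def)
  then show ?thesis by blast
qed

definition supported :: "'i set \<Rightarrow> 'i ell2 set" where
  "supported Y = {v. \<forall>w. w \<notin> Y \<longrightarrow> ell2_fun v w = 0}"

lemma supported_0 [simp]: "0 \<in> supported Y"
  and supported_add [simp]: "v \<in> supported Y \<Longrightarrow> w \<in> supported Y \<Longrightarrow> v + w \<in> supported Y"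
  and supported_minus [simp]: "v \<in> supported Y \<Longrightarrow> w \<in> supported Y \<Longrightarrow> v - w \<in> supported Y"
  and supported_uminus [simp]: "v \<in> supported Y \<Longrightarrow> - v \<in> supported Y"
  and supported_cscale [simp]: "v \<in> supported Y \<Longrightarrow> cscale c v \<in> supported Y"
  and supported_basis_vec: "i \<in> Y \<Longrightarrow> basis_vec i \<in> supported Y"
  by (auto simp: supported_def basis_vec_fun)

lemma closed_supported: "closed (supported Y)"
  unfolding closed_sequential_limits
proof (intro allI impI)
  fix u v assume u: "(\<forall>n. u n \<in> supported Y) \<and> u \<longlonglongrightarrow> v"
  show "v \<in> supported Y" unfolding supported_def
  proof (intro CollectI allI impI)
    fix w assume "w \<notin> Y"
    then have "ell2_fun (u n) w = 0" for n using u by (auto simp: supported_def)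
    then show "ell2_fun v w = 0" using ell2_fun_tendsto[of u v w] u LIMSEQ_unique[of "\<lambda>n. ell2_fun (u n) w"] by simp
  qed
qed

text \<open>A vector with countable support set \<open>Y\<close> is a sequence of complex numbers,
  so the representation spaces on countable sets of words fit into the given type.\<close>

lemma countable_supported_injection:
  fixes f :: "complex \<Rightarrow> 'h"
  assumes f: "inj f" and Y: "countable Y"
  shows "\<exists>g :: 'i ell2 \<Rightarrow> 'h. inj_on g (supported Y)"
proof -
  obtain g :: "(nat \<Rightarrow> complex) \<Rightarrow> 'h" where g: "inj g" using exists_injection_sequences[OF f] by blast
  have "inj_on (\<lambda>v. g (\<lambda>n. ell2_fun v (from_nat_into Y n))) (supported Y)"
  proof (rule inj_onI, rule ell2_eqI)
    fix u v w assume uv: "u \<in> supported Y" "v \<in> supported Y"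
      and "g (\<lambda>n. ell2_fun u (from_nat_into Y n)) = g (\<lambda>n. ell2_fun v (from_nat_into Y n))"
    then have eq: "ell2_fun u (from_nat_into Y n) = ell2_fun v (from_nat_into Y n)" for n
      using g by (metis injD)
    show "ell2_fun u w = ell2_fun v w"
      using uv eq[of "to_nat_on Y w"] Y by (cases "w \<in> Y") (auto simp: supported_def)
  qed
  then show ?thesis by blast
qed

text \<open>The points of the representation spaces must be elements of the given type \<open>'h\<close>, so the
  structure of a subspace of \<open>\<ell>\<^sup>2\<close> is transported along an injection \<open>g\<close>.\<close>

definition ell2_space :: "('i ell2 \<Rightarrow> 'h) \<Rightarrow> 'i set \<Rightarrow> (complex, 'h) module" where
  "ell2_space g Y = (let G = inv_into (supported Y) g in
     \<lparr>carrier = g ` supported Y, mult = undefined, one = undefined, zero = g 0,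
      add = \<lambda>x y. g (G x + G y), smult = \<lambda>c x. g (cscale c (G x))\<rparr>)"

definition ell2_ip :: "('i ell2 \<Rightarrow> 'h) \<Rightarrow> 'i set \<Rightarrow> 'h \<Rightarrow> 'h \<Rightarrow> complex" where
  "ell2_ip g Y x y = cip (inv_into (supported Y) g x) (inv_into (supported Y) g y)"

context
  fixes g :: "'i ell2 \<Rightarrow> 'h" and Y :: "'i set"
  assumes inj: "inj_on g (supported Y)"
begin

private abbreviation "V \<equiv> ell2_space g Y"
private abbreviation "S \<equiv> supported Y"

lemma ell2_space_simps:
  "carrier V = g ` S"
  "\<zero>\<^bsub>V\<^esub> = g 0"
  "u \<in> S \<Longrightarrow> v \<in> S \<Longrightarrow> g u \<oplus>\<^bsub>V\<^esub> g v = g (u + v)"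
  "v \<in> S \<Longrightarrow> c \<odot>\<^bsub>V\<^esub> g v = g (cscale c v)"
  "u \<in> S \<Longrightarrow> v \<in> S \<Longrightarrow> ell2_ip g Y (g u) (g v) = cip u v"
  using inj by (simp_all add: ell2_space_def ell2_ip_def Let_def)

lemma g_eq_iff: "u \<in> S \<Longrightarrow> v \<in> S \<Longrightarrow> g u = g v \<longleftrightarrow> u = v"
  using inj by (auto dest: inj_onD)

lemma abelian_group_ell2_space: "abelian_group V"
proof (rule abelian_groupI)
  show "\<exists>y\<in>carrier V. y \<oplus>\<^bsub>V\<^esub> x = \<zero>\<^bsub>V\<^esub>" if "x \<in> carrier V" for x
  proof -
    obtain v where "v \<in> S" "x = g v" using \<open>x \<in> carrier V\<close> by (auto simp: ell2_space_simps)
    then have "g (- v) \<oplus>\<^bsub>V\<^esub> x = \<zero>\<^bsub>V\<^esub>" "g (- v) \<in> carrier V" by (auto simp: ell2_space_simps)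
    then show ?thesis by blast
  qed
qed (auto simp: ell2_space_simps ac_simps)

lemma vectorspace_ell2_space: "vectorspace class_ring V"
  unfolding vectorspace_def
proof
  show "module class_ring V"
  proof (rule moduleI[OF _ abelian_group_ell2_space])
    show "cring (class_ring :: complex ring)" by (rule class_cring.cring_axioms)
  qed (auto simp: ell2_space_simps g_eq_iff intro!: ell2_eqI arg_cong[of _ _ g] simp: algebra_simps)
  show "field (class_ring :: complex ring)" by (rule class_field.field_axioms)
qed

lemma ell2_space_minus: "u \<in> S \<Longrightarrow> v \<in> S \<Longrightarrow> g u \<ominus>\<^bsub>V\<^esub> g v = g (u - v)"
proof -
  assume uv: "u \<in> S" "v \<in> S"
  interpret abelian_group V by (rule abelian_group_ell2_space)
  have "\<ominus>\<^bsub>V\<^esub> g v = g (- v)"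
    by (rule minus_equality) (use uv in \<open>auto simp: ell2_space_simps\<close>)
  then show ?thesis using uv by (simp add: a_minus_def ell2_space_simps)
qed

lemma ell2_space_dist: "u \<in> S \<Longrightarrow> v \<in> S \<Longrightarrow> ip_dist V (ell2_ip g Y) (g u) (g v) = dist u v"
proof -
  assume uv: "u \<in> S" "v \<in> S"
  then have "ip_dist V (ell2_ip g Y) (g u) (g v) = sqrt (Re (cip (u - v) (u - v)))"
    by (simp add: ip_dist_def ell2_space_minus ell2_space_simps)
  also have "\<dots> = dist u v" by (simp add: cip_self_norm dist_norm)
  finally show ?thesis .
qed

lemma metric_ell2_space: "Metric_space (carrier V) (ip_dist V (ell2_ip g Y))"
proof
  show "0 \<le> ip_dist V (ell2_ip g Y) x y" "ip_dist V (ell2_ip g Y) x y = ip_dist V (ell2_ip g Y) y x" for x y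
    by (cases "x \<in> carrier V \<and> y \<in> carrier V";
        auto simp: ell2_space_simps(1) ell2_space_dist dist_commute; simp add: ip_dist_def ell2_space_simps(1))+
  show "ip_dist V (ell2_ip g Y) x y = 0 \<longleftrightarrow> x = y" if "x \<in> carrier V" "y \<in> carrier V" for x y
    using that by (auto simp: ell2_space_simps(1) ell2_space_dist)
  show "ip_dist V (ell2_ip g Y) x z \<le> ip_dist V (ell2_ip g Y) x y + ip_dist V (ell2_ip g Y) y z"
    if "x \<in> carrier V" "y \<in> carrier V" "z \<in> carrier V" for x y z
    using that by (auto simp: ell2_space_simps(1) ell2_space_dist dist_triangle)
qed

interpretation M: Metric_space "carrier V" "ip_dist V (ell2_ip g Y)"
  by (rule metric_ell2_space)

lemma limitin_ell2_space:
  assumes "\<And>n. u n \<in> S" "v \<in> S"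
  shows "limitin M.mtopology (\<lambda>n. g (u n)) (g v) sequentially \<longleftrightarrow> u \<longlonglongrightarrow> v"
  using assms unfolding M.limit_metric_sequentially LIMSEQ_def
  by (simp add: ell2_space_dist) (simp add: ell2_space_simps(1))

lemma complex_hilbert_space_ell2: "complex_hilbert_space V (ell2_ip g Y)"
proof (rule complex_hilbert_space.intro)
  show "vectorspace class_ring V" by (rule vectorspace_ell2_space)
  show "M.mcomplete" unfolding M.mcomplete_def
  proof (intro allI impI)
    fix \<sigma> assume \<sigma>: "M.MCauchy \<sigma>"
    then have "range \<sigma> \<subseteq> carrier V" by (simp add: M.MCauchy_def)
    then have "range \<sigma> \<subseteq> g ` S" by (simp only: ell2_space_simps(1))
    then have "\<forall>n. \<exists>u. u \<in> S \<and> \<sigma> n = g u" by blast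
    then obtain u where u: "\<And>n. u n \<in> S" "\<And>n. \<sigma> n = g (u n)" by (auto dest!: choice)
    then have "Cauchy u" using \<sigma> by (simp add: M.MCauchy_def Cauchy_def ell2_space_dist)
    then obtain v where v: "u \<longlonglongrightarrow> v" using Cauchy_convergent_iff convergent_def by blast
    have "v \<in> S" by (rule closed_sequentially[OF closed_supported u(1) v])
    then have "limitin M.mtopology (\<lambda>n. g (u n)) (g v) sequentially" using u(1) v by (simp add: limitin_ell2_space)
    moreover have "\<sigma> = (\<lambda>n. g (u n))" using u(2) by blast
    ultimately show "\<exists>x. limitin M.mtopology \<sigma> x sequentially" by blast
  qed
  show "ell2_ip g Y x y = cnj (ell2_ip g Y y x)" for x y unfolding ell2_ip_def by (rule cip_commute)
  show "x = \<zero>\<^bsub>V\<^esub>" if x: "x \<in> carrier V" "ell2_ip g Y x x = 0" for x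
  proof -
    obtain v where "v \<in> S" "x = g v" using x by (auto simp: ell2_space_simps)
    with x show ?thesis by (simp add: ell2_space_simps cip_self_norm)
  qed
qed (auto simp: ell2_space_simps cip_add_left cip_scale_left cip_self_norm)

lemma closed_preimage:
  assumes "closedin M.mtopology W"
  shows "closed {v \<in> S. g v \<in> W}"
  unfolding closed_sequential_limits
proof (intro allI impI)
  fix u v assume u: "(\<forall>n. u n \<in> {v \<in> S. g v \<in> W}) \<and> u \<longlonglongrightarrow> v"
  have "v \<in> S" by (rule closed_sequentially[OF closed_supported, of u]) (use u in auto)
  moreover have "limitin M.mtopology (\<lambda>n. g (u n)) (g v) sequentially" using u \<open>v \<in> S\<close> by (simp add: limitin_ell2_space)
  ultimately show "v \<in> {v \<in> S. g v \<in> W}"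
    using assms u unfolding M.metric_closedin_iff_sequentially_closed by (auto simp: image_subset_iff dest!: spec[of _ "\<lambda>n. g (u n)"])
qed

end

context uhf_three_infty
begin

text \<open>Irreducibility reduces to \<open>trans\<close>, since a closed subspace with all basis
  vectors is the whole space. The last clause of the conclusion transfers nonvanishing to the copy
  of the space, for the case in which the kernel is found by an indirect argument.\<close>

lemma concrete_primitive_ideal:
  fixes g :: "digits ell2 \<Rightarrow> 'h"
  assumes inj: "inj_on g (supported Y)" and Y: "Y \<noteq> {}"
    and pres: "\<And>a v. a \<in> A \<Longrightarrow> v \<in> supported Y \<Longrightarrow> T a v \<in> supported Y"
    and trans: "\<And>W v w0 w. closed W \<Longrightarrow> 0 \<in> W \<Longrightarrow> (\<And>u v. u \<in> W \<Longrightarrow> v \<in> W \<Longrightarrow> u + v \<in> W) \<Longrightarrow>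
      (\<And>c v. v \<in> W \<Longrightarrow> cscale c v \<in> W) \<Longrightarrow> (\<And>a v. a \<in> A \<Longrightarrow> v \<in> W \<Longrightarrow> T a v \<in> W) \<Longrightarrow>
      v \<in> W \<Longrightarrow> v \<in> supported Y \<Longrightarrow> w0 \<in> Y \<Longrightarrow> ell2_fun v w0 \<noteq> 0 \<Longrightarrow> w \<in> Y \<Longrightarrow> basis_vec w \<in> W"
  shows "\<exists>V ip \<pi>. irreducible_representation A (V :: (complex, 'h) module) ip \<pi> \<and>
    rep_kernel A V \<pi> = {a \<in> A. \<forall>v\<in>supported Y. T a v = 0} \<and>
    (\<forall>a\<in>A. (\<exists>v\<in>supported Y. T a v \<noteq> 0) \<longrightarrow> (\<exists>v\<in>carrier V. \<pi> a v \<noteq> \<zero>\<^bsub>V\<^esub>))"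
proof -
  let ?S = "supported Y" and ?V = "ell2_space g Y" and ?ip = "ell2_ip g Y"
  define \<pi> where "\<pi> a x = g (T a (inv_into ?S g x))" for a x
  note simps = ell2_space_simps[OF inj] g_eq_iff[OF inj]
  have \<pi>: "\<pi> a (g v) = g (T a v)" if "v \<in> ?S" for a v
    using that inj by (simp add: \<pi>_def)
  have rep: "star_representation A ?V ?ip \<pi>"
    unfolding star_representation_def
  proof (intro conjI ballI allI)
    show "complex_hilbert_space ?V ?ip" by (rule complex_hilbert_space_ell2[OF inj])
    show "bounded_operator ?V ?ip (\<pi> a)" if a: "a \<in> A" for a
      unfolding bounded_operator_def
    proof (intro conjI ballI allI)
      have "\<forall>x\<in>carrier ?V. sqrt (Re (?ip (\<pi> a x) (\<pi> a x))) \<le> norm a * sqrt (Re (?ip x x))"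
        using T_norm[of a] pres[OF a] by (auto simp: simps \<pi> cip_self_norm)
      then show "\<exists>K. \<forall>x\<in>carrier ?V. sqrt (Re (?ip (\<pi> a x) (\<pi> a x))) \<le> K * sqrt (Re (?ip x x))" by blast
    qed (use pres[OF a] in \<open>auto simp: simps \<pi> T_vadd T_vscale\<close>)
  qed (use pres A_star in \<open>auto simp: simps \<pi> T_add T_scaleC T_mult T_adjoint\<close>)
  have ker: "rep_kernel A ?V \<pi> = {a \<in> A. \<forall>v\<in>?S. T a v = 0}"
    unfolding rep_kernel_def using pres by (auto simp: simps \<pi>)
  obtain y where y: "y \<in> Y" using Y by blast
  have "basis_vec y \<noteq> (0 :: digits ell2)" using norm_basis_vec[of y] by auto
  then have "1 \<notin> rep_kernel A ?V \<pi>"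
    unfolding ker using supported_basis_vec[OF y] by (auto simp: T_one)
  then have nz: "rep_kernel A ?V \<pi> \<noteq> A" using A_one by blast
  have irr: "W = {\<zero>\<^bsub>?V\<^esub>} \<or> W = carrier ?V"
    if W: "VectorSpace.subspace class_ring W ?V" "closedin (Metric_space.mtopology (carrier ?V) (ip_dist ?V ?ip)) W"
      "\<forall>a\<in>A. \<pi> a ` W \<subseteq> W" for W
  proof -
    interpret W: submodule class_ring W ?V using W(1) by (simp add: VectorSpace.subspace_def)
    define W' where "W' = {v \<in> ?S. g v \<in> W}"
    have WW: "W = g ` W'" using W.subset by (auto simp: W'_def simps)
    have W'S: "v \<in> ?S" if "v \<in> W'" for v using that by (simp add: W'_def)
    have cl: "closed W'" unfolding W'_def by (rule closed_preimage[OF inj W(2)])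
    have z: "0 \<in> W'" using W.zero_closed by (simp add: W'_def simps)
    have ad: "u + v \<in> W'" if "u \<in> W'" "v \<in> W'" for u v
      using that W.m_closed[of "g u" "g v"] by (simp add: W'_def simps)
    have sc: "cscale c v \<in> W'" if "v \<in> W'" for c v
      using that W.smult_closed[of c "g v"] by (simp add: W'_def simps)
    have inv: "T a v \<in> W'" if a: "a \<in> A" and v: "v \<in> W'" for a v
    proof -
      have "\<pi> a (g v) \<in> W" using W(3) a v by (auto simp: W'_def)
      then show ?thesis using v pres[OF a] by (simp add: W'_def \<pi>)
    qed
    show ?thesis
    proof (cases "\<forall>v\<in>W'. \<forall>w\<in>Y. ell2_fun v w = 0")
      case True
      have "v = 0" if "v \<in> W'" for v
        by (rule ell2_eqI) (use True that W'S[OF that] in \<open>auto simp: supported_def\<close>)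
      then have "W' = {0}" using z by blast
      then show ?thesis by (simp add: WW simps)
    next
      case False
      then obtain v w0 where v: "v \<in> W'" "w0 \<in> Y" "ell2_fun v w0 \<noteq> 0" by blast
      have "basis_vec w \<in> W'" if "w \<in> Y" for w
        by (rule trans[OF cl z ad sc inv v(1) W'S[OF v(1)] v(2,3) that])
      then have "u \<in> W'" if "u \<in> ?S" for u
        using ell2_closed_subspace_eqI[OF z ad sc cl, of Y u] that by (auto simp: supported_def)
      then have "W' = ?S" using W'S by blast
      then show ?thesis by (simp add: WW simps)
    qed
  qed
  have "irreducible_representation A ?V ?ip \<pi>"
    unfolding irreducible_representation_def using rep nz irr by blast
  moreover have "\<exists>v\<in>carrier ?V. \<pi> a v \<noteq> \<zero>\<^bsub>?V\<^esub>" if "a \<in> A" "\<exists>v\<in>?S. T a v \<noteq> 0" for a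
    using that pres[OF that(1)] by (auto simp: simps \<pi>)
  ultimately show ?thesis using ker by blast
qed

end

lemma pre_eq_dig: "pre u n = pre w n \<Longrightarrow> i < n \<Longrightarrow> dig u i = dig w i"
proof (induction n)
  case (Suc n)
  have "pre u (Suc n) mod 3 = dig u n" "pre w (Suc n) mod 3 = dig w n"
    "pre u (Suc n) div 3 = pre u n" "pre w (Suc n) div 3 = pre w n"
    by simp_all
  then have "dig u n = dig w n" "pre u n = pre w n" using Suc.prems(1) by metis+
  then show ?case using Suc by (cases "i = n") auto
qed simp

section \<open>The representations on the words of \<open>X m j\<close>\<close>

context uhf_three_infty
begin

lemma countable_X: "countable (X m j)"
proof (rule countable_subset)
  show "X m j \<subseteq> range (wd (Suc m))"
  proof
    fix w assume "w \<in> X m j"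
    then have "rep (Suc m) (pre w (Suc m)) w = wd (Suc m) (pre w (Suc m))"
      unfolding wd_def by (intro rep_cong) (auto simp: X_def dig_constw)
    then show "w \<in> range (wd (Suc m))" by (metis rep_pre rangeI)
  qed
qed simp

lemma X_nonempty: "j < 3 \<Longrightarrow> X m j \<noteq> {}"
proof -
  assume j: "j < 3"
  have "upd (if m = 0 then constw 1 else upd (constw 1) m 0) (m - 1) j \<in> X m j"
    using j by (auto simp: X_def dig_upd dig_constw)
  then show ?thesis by blast
qed

lemma rep_X: "rep (m - 1) s w \<in> X m j \<longleftrightarrow> w \<in> X m j"
  by (auto simp: X_def dig_rep)

lemma K_primitive:
  fixes f :: "complex \<Rightarrow> 'h"
  assumes f: "inj f" and j: "j < 3"
  shows "K m j \<in> primitive_ideals TYPE('h) A"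
proof -
  let ?Y = "X m j" and ?k = "m - 1"
  obtain g :: "digits ell2 \<Rightarrow> 'h" where g: "inj_on g (supported ?Y)"
    using countable_supported_injection[OF f countable_X] by blast
  have B: "blk m j (rho m a) \<in> M3 ?k" if "a \<in> A" for a by (rule blk_carrier[OF rho_A[OF that]])
  have Ta: "T a v = op ?k (blk m j (rho m a)) v" if "a \<in> A" "v \<in> supported ?Y" for a v
    by (rule T_block[OF that(1) j]) (use that(2) in \<open>simp add: supported_def\<close>)
  have pres: "T a v \<in> supported ?Y" if a: "a \<in> A" and v: "v \<in> supported ?Y" for a v
  proof -
    have "ell2_fun (T a v) w = 0" if "w \<notin> ?Y" for w
      unfolding Ta[OF a v] op_fun[OF B[OF a]] opf_def
    proof (intro sum.neutral ballI)
      fix s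
      show "blk m j (rho m a) $$ (pre w ?k, s) * ell2_fun v (rep ?k s w) = 0"
        using v that rep_X[of m s w j] by (simp add: supported_def)
    qed
    then show ?thesis by (simp add: supported_def)
  qed
  have trans: "basis_vec w \<in> W"
    if sc: "\<And>c v. v \<in> W \<Longrightarrow> cscale c v \<in> W" and inv: "\<And>a v. a \<in> A \<Longrightarrow> v \<in> W \<Longrightarrow> T a v \<in> W"
      and v: "v \<in> W" "v \<in> supported ?Y" and w0: "w0 \<in> ?Y" "ell2_fun v w0 \<noteq> 0" and w: "w \<in> ?Y" for W v w0 w
  proof -
    let ?e = "munit (3 ^ ?k) (pre w ?k) (pre w0 ?k)"
    obtain a where a: "a \<in> A" "rho m a = emb m j ?e" using lift[OF emb_Aset[OF munit_carrier]] .
    have "T a v = op ?k ?e v" unfolding Ta[OF a(1) v(2)] a(2) blk_emb[OF j munit_carrier] ..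
    also have "\<dots> = cscale (ell2_fun v w0) (basis_vec w)"
      by (rule op_munit_X[OF w w0(1)]) (use v(2) in \<open>simp add: supported_def\<close>)
    finally have "basis_vec w = cscale (1 / ell2_fun v w0) (T a v)"
      using w0(2) by (auto intro!: ell2_eqI)
    then show ?thesis using sc[OF inv[OF a(1) v(1)]] by simp
  qed
  have ker: "{a \<in> A. \<forall>v\<in>supported ?Y. T a v = 0} = K m j"
  proof (intro equalityI subsetI)
    fix a assume "a \<in> {a \<in> A. \<forall>v\<in>supported ?Y. T a v = 0}"
    then have a: "a \<in> A" "\<And>v. v \<in> supported ?Y \<Longrightarrow> T a v = 0" by auto
    obtain w0 where w0: "w0 \<in> ?Y" using X_nonempty[OF j] by blast
    \<comment> \<open>All words with the tail of \<open>w0\<close> belong to \<open>X m j\<close>,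
      and the entries of the block are the coefficients of \<open>T a\<close> between their basis
      vectors.\<close>
    have "blk m j (rho m a) $$ (r, s) = 0" if rs: "r < 3 ^ ?k" "s < 3 ^ ?k" for r s
    proof -
      have s: "basis_vec (rep ?k s w0) \<in> supported ?Y" by (rule supported_basis_vec) (simp add: rep_X[simplified] w0)
      have "opf ?k (blk m j (rho m a)) (basis_vec (rep ?k s w0)) (rep ?k r w0) = 0"
        unfolding op_fun[OF B[OF a(1)], symmetric] Ta[OF a(1) s, symmetric] a(2)[OF s] by simp
      then show ?thesis by (simp add: opf_basis_vec dig_rep pre_rep rs del: One_nat_def)
    qed
    then have "blk m j (rho m a) = 0\<^sub>m (3 ^ ?k) (3 ^ ?k)" by (intro M3_eqI[OF B[OF a(1)]]) auto
    then show "a \<in> K m j" using a(1) by (simp add: K_def)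
  next
    fix a assume "a \<in> K m j"
    then have a: "a \<in> A" "blk m j (rho m a) = 0\<^sub>m (3 ^ ?k) (3 ^ ?k)" by (auto simp: K_def)
    have "T a v = 0" if "v \<in> supported ?Y" for v
      unfolding Ta[OF a(1) that] a(2)
      by (rule ell2_eqI) (simp add: op_fun opf_def pre_less)
    then show "a \<in> {a \<in> A. \<forall>v\<in>supported ?Y. T a v = 0}" using a(1) by blast
  qed
  have "\<exists>V ip \<pi>. irreducible_representation A (V :: (complex, 'h) module) ip \<pi> \<and>
    rep_kernel A V \<pi> = {a \<in> A. \<forall>v\<in>supported ?Y. T a v = 0} \<and>
    (\<forall>a\<in>A. (\<exists>v\<in>supported ?Y. T a v \<noteq> 0) \<longrightarrow> (\<exists>v\<in>carrier V. \<pi> a v \<noteq> \<zero>\<^bsub>V\<^esub>))"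
    by (rule concrete_primitive_ideal[OF g X_nonempty[OF j] pres]) (assumption | rule trans)+
  then show ?thesis unfolding ker primitive_ideals_def by blast
qed

text \<open>Provides, with bounds independent of \<open>m\<close>, elements of \<open>J m\<close>
  that do not degenerate on the words equal to 0 from position \<open>m\<close> on. The start is
  \<open>b\<close> in \<open>\<A> (m + 1)\<close> with unit coefficients and zero middle block; the
  zero block puts every lift of \<open>b\<close> into \<open>J m\<close>.\<close>

lemma diagonal_element:
  obtains g f where "g \<in> J m" "norm g \<le> 2" "\<forall>v w. ell2_fun (T g v) w = f w * ell2_fun v w"
    "\<forall>w. (\<forall>i\<ge>m. dig w i = 0) \<longrightarrow> 1 / 2 \<le> cmod (f w)"
proof -
  define b where "b = join m (\<lambda>_. 1\<^sub>m (3 ^ m)) (0\<^sub>m (3 ^ Suc m) (3 ^ Suc m))"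
  have cut_b: "cut 1 b = 0\<^sub>m (3 ^ Suc m) (3 ^ Suc m)" "cut 0 b = 1\<^sub>m (3 ^ Suc m)" "cut 2 b = 1\<^sub>m (3 ^ Suc m)"
    unfolding b_def cut_join[OF zero_carrier_mat] dsum_one by (rule refl)+
  have b: "b \<in> Aset (Suc m)" unfolding b_def by (rule join_in_Aset[OF one_carrier_mat Aset_zero])
  have diag: "diagm (Suc (Suc m)) b" unfolding b_def by (rule diagm_join) (auto simp: diagm_def)
  have gap: "gap (Suc m) b 1"
    unfolding gap_def
  proof (intro allI impI)
    fix c d :: nat assume "c < 3" "d < 3"
    then show "norm (\<iota> (Suc m) (cut c b) - \<iota> (Suc m) (cut d b)) \<le> 1"
      by (elim less_3_cases[THEN disjE] disjE) (simp_all only: cut_b \<iota>_one \<iota>_zero diff_self diff_zero diff_0 norm_minus_cancel norm_one norm_zero order_refl zero_le_one)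
  qed
  have "b = dsum (Suc m) (\<lambda>c. if c = 1 then 0\<^sub>m (3 ^ Suc m) (3 ^ Suc m) else 1\<^sub>m (3 ^ Suc m))"
    unfolding b_def join_def dsum_one if_cancel ..
  moreover have "norm (\<iota> (Suc m) (if c = 1 then 0\<^sub>m (3 ^ Suc m) (3 ^ Suc m) else 1\<^sub>m (3 ^ Suc m))) \<le> 1" for c :: nat
    by (cases "c = 1") (simp_all only: if_True if_False simp_thms \<iota>_zero \<iota>_one norm_zero norm_one order_refl zero_le_one)
  ultimately have norm_b: "norm (\<iota> (Suc (Suc m)) b) \<le> 1"
    by (simp only:) (rule norm_dsum_le; simp)
  \<comment> \<open>The gap of \<open>b\<close> is 1, and a lift within distance 1 could vanish at
    the words in question. One explicit averaging step brings the error down to 1/2, and the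
    diagonal entry of \<open>b2\<close> at those words is still 1.\<close>
  define b2 where "b2 = interp (Suc m) b"
  have b2: "b2 \<in> Aset (Suc (Suc m))" and diag2: "diagm (Suc (Suc (Suc m))) b2"
    unfolding b2_def by (rule interp_Aset[OF b] diagm_interp[OF b diag])+
  note gap2 = interp_gap[OF b gap, folded b2_def]
  have "\<exists>g. g \<in> A \<and> rho (Suc (Suc m)) g = b2 \<and> norm (g - \<iota> (Suc (Suc (Suc m))) b2) \<le> 1 / 2 \<and>
    (\<exists>f. \<forall>v w. ell2_fun (T g v) w = f w * ell2_fun v w)"
    by (rule lift_near[OF b2 gap2(1)]) (use diag2 in blast)
  then obtain g f where g: "g \<in> A" "rho (Suc (Suc m)) g = b2" "norm (g - \<iota> (Suc (Suc (Suc m))) b2) \<le> 1 / 2"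
    and f: "\<And>v w. ell2_fun (T g v) w = f w * ell2_fun v w" by blast
  have cut_b2: "cut 1 b2 = b"
    "cut 0 b2 = dsum (Suc m) (\<lambda>c. (1 / 2) \<cdot>\<^sub>m (cut c b + cut ((c + 2) mod 3) b))"
    unfolding b2_def interp_def cut_join[OF Aset_carrier[OF b]] by (rule refl)+
  have "rho (Suc m) g = b" using cut_rho_Suc[of "Suc m" g] by (simp only: g(2) cut_b2)
  then have "rho m g = 0\<^sub>m (3 ^ Suc m) (3 ^ Suc m)" using cut_rho_Suc[of m g] by (simp only: cut_b)
  then have "g \<in> J m" using g(1) by (simp add: J_def)
  \<comment> \<open>The lifting error 1/2, the averaging step 1/2 and the norm of \<open>b\<close>,
    at most 1, add up to 2.\<close>
  moreover have "norm g \<le> 2"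
    using norm_triangle_ineq[of "g - \<iota> (Suc (Suc (Suc m))) b2" "\<iota> (Suc (Suc (Suc m))) b2"]
      norm_triangle_ineq[of "\<iota> (Suc (Suc (Suc m))) b2 - \<iota> (Suc (Suc m)) b" "\<iota> (Suc (Suc m)) b"]
      g(3) gap2(2) norm_b by simp
  moreover have "1 / 2 \<le> cmod (f w)" if w: "\<And>i. i \<ge> m \<Longrightarrow> dig w i = 0" for w
  proof -
    let ?N = "Suc (Suc (Suc m))" and ?p = "pre w (Suc m)"
    have p: "?p < 3 ^ Suc m" "3 * ?p + 0 < 3 ^ Suc (Suc m)"
      using pre_less[of w "Suc m"] pre_less[of w "Suc (Suc m)"] w by (simp_all del: power_Suc)
    have pre: "pre w ?N = 3 * (3 * ?p + 0) + 0" using w by simp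
    have h: "(1 / 2) \<cdot>\<^sub>m (cut c b + cut ((c + 2) mod 3) b) \<in> M3 (Suc m)" for c
      by (intro smult_carrier_mat add_carrier_mat cut_carrier Aset_carrier b)
    have "b2 $$ (pre w ?N, pre w ?N) = cut 0 b2 $$ (3 * ?p + 0, 3 * ?p + 0)"
      unfolding pre by (rule cut_entry[OF Aset_carrier[OF b2] p(2) p(2), symmetric])
    also have "\<dots> = cut 0 (cut 0 b2) $$ (?p, ?p)"
      by (rule cut_entry[OF cut_carrier[OF Aset_carrier[OF b2]] p(1) p(1), symmetric])
    also have "cut 0 (cut 0 b2) = (1 / 2) \<cdot>\<^sub>m (cut 0 b + cut ((0 + 2) mod 3) b)"
      unfolding cut_b2 by (rule cut_dsum) (simp, rule h)
    also have "(0 + 2) mod 3 = (2 :: nat)" by simp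
    also have "((1 / 2) \<cdot>\<^sub>m (cut 0 b + cut 2 b)) $$ (?p, ?p) = 1"
      unfolding cut_b using p(1) by (simp del: power_Suc pre.simps)
    finally have entry: "b2 $$ (pre w ?N, pre w ?N) = 1" .
    have "ell2_fun (T (g - \<iota> ?N b2) (basis_vec w)) w = f w - 1"
    proof -
      have "T g (basis_vec w) = T (g - \<iota> ?N b2) (basis_vec w) + T (\<iota> ?N b2) (basis_vec w)"
        unfolding T_add[symmetric] by simp
      moreover have "ell2_fun (T (\<iota> ?N b2) (basis_vec w)) w = 1"
        unfolding T_\<iota>[OF Aset_carrier[OF b2]] op_fun[OF Aset_carrier[OF b2]] opf_basis_vec using entry by simp
      ultimately show ?thesis using f[of "basis_vec w" w] by (simp add: basis_vec_fun eq_diff_eq)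
    qed
    then have "cmod (f w - 1) \<le> norm (T (g - \<iota> ?N b2) (basis_vec w))"
      using ell2_coord_le[of "T (g - \<iota> ?N b2) (basis_vec w)" w] by simp
    also have "\<dots> \<le> 1 / 2" using T_norm[of "g - \<iota> ?N b2" "basis_vec w"] g(3) by (simp add: norm_basis_vec)
    finally show ?thesis using norm_triangle_ineq2[of 1 "1 - f w"] by (simp add: norm_minus_commute)
  qed
  ultimately show thesis using f by (intro that[of g f]) auto
qed

section \<open>The representation on the words that are eventually 0\<close>

definition Y0 :: "digits set" where
  "Y0 = {w. \<exists>n. \<forall>i\<ge>n. dig w i = 0}"

lemma countable_Y0: "countable Y0"
proof (rule countable_subset)
  show "Y0 \<subseteq> range (\<lambda>(n, s). rep n s (constw 0))"
  proof
    fix w assume "w \<in> Y0"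
    then obtain n where "\<forall>i\<ge>n. dig w i = 0" by (auto simp: Y0_def)
    then have "rep n (pre w n) w = rep n (pre w n) (constw 0)" by (intro rep_cong) (simp add: dig_constw)
    then have "w = (\<lambda>(n, s). rep n s (constw 0)) (n, pre w n)" by simp
    then show "w \<in> range (\<lambda>(n, s). rep n s (constw 0))" by blast
  qed
qed simp

lemma rep_Y0: "rep n s w \<in> Y0 \<longleftrightarrow> w \<in> Y0"
proof
  assume "rep n s w \<in> Y0"
  then obtain k where "\<And>i. i \<ge> k \<Longrightarrow> dig (rep n s w) i = 0" by (auto simp: Y0_def)
  then have "\<forall>i\<ge>max k n. dig w i = 0" using dig_rep by (metis max.bounded_iff)
  then show "w \<in> Y0" unfolding Y0_def by blast
next
  assume "w \<in> Y0"
  then obtain k where "\<And>i. i \<ge> k \<Longrightarrow> dig w i = 0" by (auto simp: Y0_def)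
  then have "\<forall>i\<ge>max k n. dig (rep n s w) i = 0" by (simp add: dig_rep)
  then show "rep n s w \<in> Y0" unfolding Y0_def by blast
qed

text \<open>Matrices change only finitely many letters, so this space is invariant under the whole
  UHF algebra; density does the rest.\<close>

lemma T_supported_Y0: "v \<in> supported Y0 \<Longrightarrow> T a v \<in> supported Y0"
proof -
  assume v: "v \<in> supported Y0"
  obtain x n where x: "\<And>k. x k \<in> M3 (n k)" "(\<lambda>k. \<iota> (n k) (x k)) \<longlonglongrightarrow> a" using approx by metis
  have "ell2_fun (T (\<iota> (n k) (x k)) v) w = 0" if "w \<notin> Y0" for k w
    unfolding T_\<iota>[OF x(1)] op_fun[OF x(1)] opf_def
  proof (intro sum.neutral ballI)
    fix s
    show "x k $$ (pre w (n k), s) * ell2_fun v (rep (n k) s w) = 0"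
      using v that rep_Y0[of "n k" s w] by (simp add: supported_def)
  qed
  then have "T (\<iota> (n k) (x k)) v \<in> supported Y0" for k by (simp add: supported_def)
  then show ?thesis by (rule closed_sequentially[OF closed_supported _ T_tendsto[OF x(2)]])
qed

text \<open>A long prefix separates \<open>w0\<close> from the other words that carry most of
  \<open>v\<close>. A matrix unit at that level, multiplied into \<open>\<A>_infty\<close> by a
  diagonal element of \<open>J m\<close>, sends the part at \<open>w0\<close> to a multiple of
  \<open>basis_vec w\<close> bounded away from zero and the rest of \<open>v\<close> to a small
  vector.\<close>

lemma Y0_transitive:
  assumes W: "closed W" "\<And>c v. v \<in> W \<Longrightarrow> cscale c v \<in> W" "\<And>a v. a \<in> A \<Longrightarrow> v \<in> W \<Longrightarrow> T a v \<in> W"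
    and v: "v \<in> W" "w0 \<in> Y0" "ell2_fun v w0 \<noteq> 0" and w: "w \<in> Y0"
  shows "basis_vec w \<in> W"
proof -
  obtain n0 n1 where n: "\<And>i. i \<ge> n0 \<Longrightarrow> dig w0 i = 0" "\<And>i. i \<ge> n1 \<Longrightarrow> dig w i = 0"
    using v(2) w by (auto simp: Y0_def)
  let ?x = "ell2_fun v w0"
  have "\<exists>y\<in>W. dist y (basis_vec w) < \<epsilon>" if \<epsilon>: "\<epsilon> > 0" for \<epsilon>
  proof -
    \<comment> \<open>Chosen so that \<open>2 * \<delta>\<close>, divided by the lower bound
      \<open>cmod ?x / 2\<close> for the coefficient, is \<open>\<epsilon> / 2\<close>.\<close>
    define \<delta> where "\<delta> = \<epsilon> * cmod ?x / 8"
    have \<delta>: "\<delta> > 0" using \<epsilon> v(3) by (simp add: \<delta>_def)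
    have "\<exists>F. finite F \<and> (\<forall>z. (\<forall>i. i \<notin> F \<longrightarrow> cmod (ell2_fun z i) \<le> cmod (ell2_fun v i)) \<longrightarrow>
      (\<forall>i\<in>F. ell2_fun z i = 0) \<longrightarrow> norm z \<le> \<delta>)"
    proof (rule ell2_finite_tail[OF \<delta>, of v])
      fix F assume "finite F" and "\<And>w. (\<And>i. i \<notin> F \<Longrightarrow> cmod (ell2_fun w i) \<le> cmod (ell2_fun v i)) \<Longrightarrow>
        (\<And>i. i \<in> F \<Longrightarrow> ell2_fun w i = 0) \<Longrightarrow> norm w \<le> \<delta>"
      then show ?thesis by (intro exI[of _ F] conjI allI impI) simp_all
    qed
    then obtain F where F: "finite F" "\<And>z. \<forall>i. i \<notin> F \<longrightarrow> cmod (ell2_fun z i) \<le> cmod (ell2_fun v i) \<Longrightarrow>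
      \<forall>i\<in>F. ell2_fun z i = 0 \<Longrightarrow> norm z \<le> \<delta>"
      by (elim exE conjE) simp
    have "\<forall>\<^sub>F m in sequentially. u \<noteq> w0 \<longrightarrow> pre u m \<noteq> pre w0 m" for u
    proof (cases "u = w0")
      case False
      then obtain i where "dig u i \<noteq> dig w0 i" using digits_eqI by blast
      then show ?thesis
        using pre_eq_dig[of u _ w0 i] by (intro eventually_mono[OF eventually_gt_at_top[of i]]) auto
    qed simp
    then have "\<forall>\<^sub>F m in sequentially. \<forall>u\<in>F. u \<noteq> w0 \<longrightarrow> pre u m \<noteq> pre w0 m"
      by (intro eventually_ball_finite F(1)) blast
    then have "\<forall>\<^sub>F m in sequentially. (\<forall>u\<in>F. u \<noteq> w0 \<longrightarrow> pre u m \<noteq> pre w0 m) \<and> max n0 n1 \<le> m"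
      by (intro eventually_conj eventually_ge_at_top)
    \<comment> \<open>One level separates \<open>w0\<close> from all other words of the finite set
      \<open>F\<close> and lies beyond the last nonzero letters of \<open>w0\<close> and
      \<open>w\<close>.\<close>
    then obtain m where m: "\<And>u. u \<in> F \<Longrightarrow> u \<noteq> w0 \<Longrightarrow> pre u m \<noteq> pre w0 m" "n0 \<le> m" "n1 \<le> m"
      unfolding eventually_sequentially by auto
    obtain g f where g: "g \<in> J m" "norm g \<le> 2" "\<forall>v w. ell2_fun (T g v) w = f w * ell2_fun v w"
      and f: "\<forall>w. (\<forall>i\<ge>m. dig w i = 0) \<longrightarrow> 1 / 2 \<le> cmod (f w)"
      using diagonal_element[of m] .
    have f0: "1 / 2 \<le> cmod (f w0)" using f n(1) m(2) by simp
    then have f_nz: "f w0 \<noteq> 0" by auto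
    let ?E = "munit (3 ^ m) (pre w m) (pre w0 m)"
    define c where "c = \<iota> m ?E * g"
    have c: "c \<in> A" unfolding c_def by (rule J_A[OF J_mult_M3[OF munit_carrier g(1)]])
    have "norm c \<le> 1 * norm g"
      unfolding c_def by (rule order_trans[OF norm_mult_ineq mult_right_mono[OF norm_munit_le[OF pre_less pre_less]]]) simp
    then have norm_c: "norm c \<le> 2" using g(2) by simp
    \<comment> \<open>The rest of \<open>v\<close> that shares the prefix of \<open>w0\<close>. It
      vanishes on \<open>F\<close> by the choice of \<open>m\<close>, hence is small.\<close>
    obtain z where z: "\<And>u. ell2_fun z u = (if u \<in> {u. pre u m = pre w0 m \<and> u \<noteq> w0} then ell2_fun v u else 0)"
      using ell2_restrict[of "{u. pre u m = pre w0 m \<and> u \<noteq> w0}" v] by metis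
    have norm_z: "norm z \<le> \<delta>" by (rule F(2)) (use m(1) in \<open>auto simp: z\<close>)
    have Tc: "ell2_fun (T c y) u = (if pre u m = pre w m then f (rep m (pre w0 m) u) * ell2_fun y (rep m (pre w0 m) u) else 0)" for y u
      unfolding c_def T_mult T_\<iota>[OF munit_carrier] op_munit_fun[OF pre_less pre_less] g(3)[rule_format] ..
    have "T c v = T c z + cscale (f w0 * ?x) (basis_vec w)"
    proof (rule ell2_eqI)
      fix u
      \<comment> \<open>Beyond position \<open>m\<close> both \<open>w0\<close> and \<open>w\<close>
        are 0, so exchanging their prefixes exchanges the words.\<close>
      have u: "rep m (pre w0 m) u = w0 \<longleftrightarrow> u = w" if "pre u m = pre w m"
      proof -
        have "rep m (pre w0 m) u = w0 \<longleftrightarrow> (\<forall>i\<ge>m. dig u i = 0)"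
          using n(1) m(2) by (simp add: rep_eq_iff pre_less)
        also have "\<dots> \<longleftrightarrow> rep m (pre w m) u = w"
          using n(2) m(3) by (simp add: rep_eq_iff pre_less)
        also have "rep m (pre w m) u = u" using rep_pre[of m u] that by simp
        finally show ?thesis .
      qed
      show "ell2_fun (T c v) u = ell2_fun (T c z + cscale (f w0 * ?x) (basis_vec w)) u"
        using u by (auto simp: Tc z basis_vec_fun pre_rep pre_less)
    qed
    then have "cscale (1 / (f w0 * ?x)) (T c v) - basis_vec w = cscale (1 / (f w0 * ?x)) (T c z)"
      using f_nz v(3) by (intro ell2_eqI) (simp add: field_simps)
    then have "dist (cscale (1 / (f w0 * ?x)) (T c v)) (basis_vec w) = norm (T c z) / (cmod (f w0) * cmod ?x)"
      by (simp add: dist_norm ell2_norm_cscale norm_divide norm_mult)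
    also have "\<dots> \<le> (2 * \<delta>) / (1 / 2 * cmod ?x)"
    proof (rule frac_le)
      show "norm (T c z) \<le> 2 * \<delta>"
        using T_norm[of c z] mult_mono[OF norm_c norm_z] by simp
    qed (use f0 v(3) \<delta> in auto)
    also have "\<dots> = \<epsilon> / 2" using v(3) by (simp add: \<delta>_def)
    also have "\<dots> < \<epsilon>" using \<epsilon> by simp
    finally show ?thesis using W(2)[OF W(3)[OF c v(1)]] by blast
  qed
  then show ?thesis using closed_approachable[OF W(1)] by blast
qed

text \<open>The kernel is not computed from the action: the diagonal elements show that each
  \<open>J m\<close> acts nontrivially, and \<open>representation_faithful\<close> then forces the
  kernel to be zero.\<close>

lemma zero_primitive:
  fixes f :: "complex \<Rightarrow> 'h"
  assumes f: "inj f"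
  shows "{0} \<in> primitive_ideals TYPE('h) A"
proof -
  obtain g :: "digits ell2 \<Rightarrow> 'h" where g: "inj_on g (supported Y0)"
    using countable_supported_injection[OF f countable_Y0] by blast
  have w: "constw 0 \<in> Y0" by (simp add: Y0_def dig_constw)
  then have "Y0 \<noteq> {}" by blast
  have "\<exists>V ip \<pi>. irreducible_representation A (V :: (complex, 'h) module) ip \<pi> \<and>
    rep_kernel A V \<pi> = {a \<in> A. \<forall>v\<in>supported Y0. T a v = 0} \<and>
    (\<forall>a\<in>A. (\<exists>v\<in>supported Y0. T a v \<noteq> 0) \<longrightarrow> (\<exists>v\<in>carrier V. \<pi> a v \<noteq> \<zero>\<^bsub>V\<^esub>))"
    by (rule concrete_primitive_ideal[OF g \<open>Y0 \<noteq> {}\<close> T_supported_Y0]) (assumption | rule Y0_transitive)+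
  then obtain V :: "(complex, 'h) module" and ip \<pi> where irr: "irreducible_representation A V ip \<pi>"
    and nz: "\<And>a. a \<in> A \<Longrightarrow> \<exists>v\<in>supported Y0. T a v \<noteq> 0 \<Longrightarrow> \<exists>v\<in>carrier V. \<pi> a v \<noteq> \<zero>\<^bsub>V\<^esub>"
    by blast
  have rep: "star_representation A V ip \<pi>" using irr by (simp add: irreducible_representation_def)
  have J: "\<exists>a\<in>J m. \<exists>v\<in>carrier V. \<pi> a v \<noteq> \<zero>\<^bsub>V\<^esub>" for m
  proof -
    obtain a f where a: "a \<in> J m" "norm a \<le> 2" "\<forall>v w. ell2_fun (T a v) w = f w * ell2_fun v w"
      and "\<forall>w. (\<forall>i\<ge>m. dig w i = 0) \<longrightarrow> 1 / 2 \<le> cmod (f w)"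
      using diagonal_element[of m] .
    then have "1 / 2 \<le> cmod (f (constw 0))" by (simp add: dig_constw)
    then have "ell2_fun (T a (basis_vec (constw 0))) (constw 0) \<noteq> 0" by (auto simp: a basis_vec_fun)
    then have "T a (basis_vec (constw 0)) \<noteq> 0" by auto
    then show ?thesis using nz[OF J_A[OF a(1)]] a(1) supported_basis_vec[OF w] by blast
  qed
  have "rep_kernel A V \<pi> \<subseteq> {0}"
    using representation_faithful[OF rep J] unfolding rep_kernel_def by blast
  moreover have "0 \<in> rep_kernel A V \<pi>" by (simp add: rep_kernel_def A_zero pi_zero[OF rep])
  ultimately have "rep_kernel A V \<pi> = {0}" by blast
  with irr show ?thesis unfolding primitive_ideals_def by blast
qed

section \<open>Identification with the kernels in the theorem, shifting \<open>j\<close> by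
  one\<close>

lemma ker_\<xi>_eq_K: "j < 3 \<Longrightarrow> ker_\<xi>_\<rho> \<iota> (Suc j) = K 0 j"
proof -
  assume j: "j < 3"
  have "\<xi> 0 (Suc j) (rho 0 a) = 0 \<longleftrightarrow> blk 0 j (rho 0 a) = 0\<^sub>m (3 ^ (0 - 1)) (3 ^ (0 - 1))" if "a \<in> A" for a
  proof -
    have c: "cut j (rho 0 a) \<in> carrier_mat 1 1" using cut_carrier[OF rho_carrier[of 0 a]] by simp
    have "\<xi> 0 (Suc j) (rho 0 a) = cut j (rho 0 a) $$ (0, 0)"
      using \<xi>_0[OF rho_A[OF that], of "Suc j"] less_3_cases[OF j] by auto
    moreover have "cut j (rho 0 a) $$ (0, 0) = 0 \<longleftrightarrow> cut j (rho 0 a) = 0\<^sub>m 1 1"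
      using c by (auto intro!: eq_matI)
    ultimately show ?thesis by (simp add: blk_def)
  qed
  then show ?thesis unfolding ker_\<xi>_\<rho>_def K_def \<rho>_eq_rho by blast
qed

lemma ker_\<eta>_eq_K: "j < 3 \<Longrightarrow> ker_\<eta>_\<rho> \<iota> (Suc n) (Suc j) = K (Suc n) j"
proof -
  assume j: "j < 3"
  have "\<eta> (Suc n) n (Suc j) (rho (Suc n) a) = blk (Suc n) j (rho (Suc n) a)" if "a \<in> A" for a
    using \<eta>_Suc[OF rho_A[OF that], of "Suc j"] less_3_cases[OF j] by (auto simp: blk_def)
  then show ?thesis unfolding ker_\<eta>_\<rho>_def K_def \<rho>_eq_rho by auto
qed

lemma primitive_ideals_A:
  fixes f :: "complex \<Rightarrow> 'h"
  assumes "inj f"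
  shows "primitive_ideals TYPE('h) A = {{0}} \<union> {K m j | m j. j < 3}"
proof (intro equalityI subsetI)
  fix I assume "I \<in> primitive_ideals TYPE('h) A"
  then obtain V :: "(complex, 'h) module" and ip \<pi> where irr: "irreducible_representation A V ip \<pi>"
    and I: "I = rep_kernel A V \<pi>" by (auto simp: primitive_ideals_def)
  then have "star_representation A V ip \<pi>" by (simp add: irreducible_representation_def)
  from irreducible_kernel[OF this irr] show "I \<in> {{0}} \<union> {K m j | m j. j < 3}" unfolding I by blast
qed (use zero_primitive[OF assms] K_primitive[OF assms] in blast)

lemma kernels_eq_K:
  "{ker_\<xi>_\<rho> \<iota> j | j. j \<in> {1, 2, 3}} \<union> {ker_\<eta>_\<rho> \<iota> m j | m j. m \<ge> 1 \<and> j \<in> {1, 2, 3}} = {K m j | m j. j < 3}"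
proof (intro equalityI subsetI)
  have j: "\<exists>i<3. j = Suc i" if "j \<in> {1, 2, 3}" for j :: nat
    using that by (intro exI[of _ "j - 1"]) auto
  fix I assume "I \<in> {ker_\<xi>_\<rho> \<iota> j | j. j \<in> {1, 2, 3}} \<union> {ker_\<eta>_\<rho> \<iota> m j | m j. m \<ge> 1 \<and> j \<in> {1, 2, 3}}"
  then consider j where "I = ker_\<xi>_\<rho> \<iota> j" "j \<in> {1, 2, 3}"
    | m j where "I = ker_\<eta>_\<rho> \<iota> m j" "m \<ge> 1" "j \<in> {1, 2, 3}" by blast
  then show "I \<in> {K m j | m j. j < 3}"
  proof cases
    case 1
    obtain i where i: "i < 3" "j = Suc i" using j[OF 1(2)] by blast
    have "I = K 0 i" unfolding 1(1) i(2) by (rule ker_\<xi>_eq_K[OF i(1)])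
    then show ?thesis using i(1) by blast
  next
    case 2
    obtain n where n: "m = Suc n" using 2(2) by (cases m) auto
    obtain i where i: "i < 3" "j = Suc i" using j[OF 2(3)] by blast
    have "I = K m i" unfolding 2(1) i(2) n by (rule ker_\<eta>_eq_K[OF i(1)])
    then show ?thesis using i(1) by blast
  qed
next
  fix I assume "I \<in> {K m j | m j. j < 3}"
  then obtain m j where I: "I = K m j" "j < 3" by blast
  have j: "Suc j \<in> {1, 2, 3}" using I(2) by auto
  show "I \<in> {ker_\<xi>_\<rho> \<iota> j | j. j \<in> {1, 2, 3}} \<union> {ker_\<eta>_\<rho> \<iota> m j | m j. m \<ge> 1 \<and> j \<in> {1, 2, 3}}"
  proof (cases m)
    case 0
    then have "I = ker_\<xi>_\<rho> \<iota> (Suc j)" using I ker_\<xi>_eq_K by simp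
    then show ?thesis using j by blast
  next
    case (Suc n)
    then have "I = ker_\<eta>_\<rho> \<iota> m (Suc j)" "m \<ge> 1" using I ker_\<eta>_eq_K by simp_all
    then show ?thesis using j by blast
  qed
qed

end

theorem proposition3p15:
  fixes \<iota> :: "nat \<Rightarrow> complex mat \<Rightarrow> 'u :: unital_cstar_algebra"
    and f :: "complex \<Rightarrow> 'h"
  assumes uhf: "uhf_three_infty \<iota>"
    and large: "inj f"
  shows "countable (primitive_ideals TYPE('h) (\<A>_infty \<iota>)) \<and>
    primitive_ideals TYPE('h) (\<A>_infty \<iota>) =
      {{0}} \<union>
      {ker_\<xi>_\<rho> \<iota> j | j. j \<in> {1, 2, 3}} \<union>
      {ker_\<eta>_\<rho> \<iota> m j | m j. m \<ge> 1 \<and> j \<in> {1, 2, 3}}"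
proof -
  interpret uhf_three_infty \<iota> by (rule uhf)
  have "{K m j | m j. j < 3} \<subseteq> range (\<lambda>(m, j). K m j)" by auto
  then have "countable {K m j | m j. j < 3}" by (rule countable_subset) simp
  then have "countable (primitive_ideals TYPE('h) A)" unfolding primitive_ideals_A[OF large] by simp
  then show ?thesis unfolding primitive_ideals_A[OF large] Un_assoc kernels_eq_K by blast
qed

end
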